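(* Let $\lambda$ be a strict partition and $T$ any fixed increasing shifted tableau of shape $\lambda$. Then $$K_\lambda=\sum_{w:\ P(w)=T} f_{\mathcal D(w)},$$ the sum over all words $w$ of positive integers whose shifted Hecke insertion tableau is $T$.
   Context: Order $1'<1<2'<2<\cdots$. Shifted shape of strict $\lambda$: boxes $(i,j)$, $i\le j\le i+\lambda_i-1$; boxes $(i,i)$ form the main diagonal. A weak set-valued shifted tableau of shape $\lambda$ is a filling with finite nonempty multisets of primed/unprimed positive integers such that: (1) the smallest element of each box is $\ge$ the largest element of the box to its left; (2) the smallest element of each box is $\ge$ the largest element of the box above; (3) no primed entries on the main diagonal; (4) each unprimed integer appears in at most one box per column; (5) each primed integer appears in at most one box per row. $x^T=\prod_i x_i^{a_i}$, $a_i$ = number of occurrences of $i$ and $i'$; $K_\lambda=\sum_T x^T$ over weak set-valued shifted tableaux of shape $\lambda$. For a word $w=w_1\cdots w_n$, $\mathcal D(w)=\{i\in[n-1]:w_i>w_{i+1}\}$, and for $\mathcal D\subseteq[n-1]$, $f_{\mathcal D}=\sum x_{i_1}\cdots x_{i_n}$ over $i_1\le\dots\le i_n$ with $i_j<i_{j+1}$ for $j\in\mathcal D$ (fundamental quasisymmetric function of degree $n$). Increasing shifted tableau: entries strictly increase along rows and down columns. Shifted Hecke insertion of $x$ into an increasing shifted tableau: first insert $x$ into row 1. When $x$ is inserted into a row (resp. column): (i) if $x$ is weakly larger than all entries and adjoining a box containing $x$ at the end of that row (resp. column) gives an increasing shifted tableau, do so and stop (adjoining to an empty row $i$ means adding box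 $(i,i)$); (ii) if $x$ is weakly larger than all entries but adjoining fails to give an increasing shifted tableau, leave the tableau unchanged and stop; (iii) otherwise let $y$ be the smallest entry strictly larger than $x$ there; replace $y$ by $x$ if the result is increasing, otherwise change nothing; in either case $y$ is output: if $x$ was inserted into a column or $y$ lies on the main diagonal, $y$ is inserted into the next column to the right (all subsequent outputs go into successive columns), otherwise into the next row below. $P(w)=(\cdots(\emptyset\leftarrow w_1)\cdots)\leftarrow w_n$. *)

theory Defs
  imports "HOL-Library.Multiset" "HOL-Analysis.Infinite_Sum"
begin

text \<open>Rows and columns are indexed from 0; row i of the shifted shape consists of
the boxes (i,j) with i \<le> j < i + lam!i. The main diagonal is the boxes (i,i).\<close>

definition strict_partition :: "nat list \<Rightarrow> bool" where
  "strict_partition lam \<longleftrightarrow> sorted_wrt (>) lam \<and> (\<forall>x\<in>set lam. 0 < x)"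

definition shifted_shape :: "nat list \<Rightarrow> (nat \<times> nat) set" where
  "shifted_shape lam = {(i, j). i < length lam \<and> i \<le> j \<and> j < i + lam ! i}"

text \<open>Letters are encoded as natural numbers: k' is 2k-1 and k is 2k (k \<ge> 1).
Hence the order 1' < 1 < 2' < 2 < ... is the usual order on codes, a code c is
primed iff it is odd, and codes of positive letters are exactly the c \<ge> 1.\<close>

definition primed_letter :: "nat \<Rightarrow> nat" where "primed_letter k = 2 * k - 1"
definition unprimed_letter :: "nat \<Rightarrow> nat" where "unprimed_letter k = 2 * k"

definition wsvt :: "nat list \<Rightarrow> (nat \<times> nat \<Rightarrow> nat multiset) \<Rightarrow> bool" where
  "wsvt lam T \<longleftrightarrow>
     (\<forall>b. b \<notin> shifted_shape lam \<longrightarrow> T b = {#}) \<and>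
     (\<forall>b\<in>shifted_shape lam. T b \<noteq> {#} \<and> (\<forall>c\<in>#T b. 1 \<le> c)) \<and>
     \<comment> \<open>(1) smallest element of a box \<ge> largest element of the box to its left\<close>
     (\<forall>i j. (i, j) \<in> shifted_shape lam \<and> (i, Suc j) \<in> shifted_shape lam \<longrightarrow>
        Max (set_mset (T (i, j))) \<le> Min (set_mset (T (i, Suc j)))) \<and>
     \<comment> \<open>(2) smallest element of a box \<ge> largest element of the box above\<close>
     (\<forall>i j. (i, j) \<in> shifted_shape lam \<and> (Suc i, j) \<in> shifted_shape lam \<longrightarrow>
        Max (set_mset (T (i, j))) \<le> Min (set_mset (T (Suc i, j)))) \<and>
     \<comment> \<open>(3) no primed entries on the main diagonal\<close>
     (\<forall>i c. c \<in># T (i, i) \<longrightarrow> even c) \<and>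
     \<comment> \<open>(4) each unprimed letter in at most one box per column\<close>
     (\<forall>j k. card {i. unprimed_letter k \<in># T (i, j)} \<le> 1) \<and>
     \<comment> \<open>(5) each primed letter in at most one box per row\<close>
     (\<forall>i k. 1 \<le> k \<longrightarrow> card {j. primed_letter k \<in># T (i, j)} \<le> 1)"

definition wsvt_weight :: "nat list \<Rightarrow> (nat \<times> nat \<Rightarrow> nat multiset) \<Rightarrow> nat \<Rightarrow> nat" where
  "wsvt_weight lam T k = (if k = 0 then 0 else
     (\<Sum>b\<in>shifted_shape lam. count (T b) (unprimed_letter k) + count (T b) (primed_letter k)))"

text \<open>Coefficient of the monomial x^a = prod_k x_k^(a k) in K_lam.\<close>
definition K_coeff :: "nat list \<Rightarrow> (nat \<Rightarrow> nat) \<Rightarrow> nat" where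
  "K_coeff lam a = card {T. wsvt lam T \<and> wsvt_weight lam T = a}"

text \<open>Descent set of a word, with positions 1-indexed as in the paper.\<close>
definition descents :: "nat list \<Rightarrow> nat set" where
  "descents w = {i. 1 \<le> i \<and> i < length w \<and> w ! (i - 1) > w ! i}"

text \<open>Coefficient of x^a in the fundamental quasisymmetric function f_D of degree n:
the number of sequences i_1 \<le> ... \<le> i_n of positive integers, strict at positions
in D, whose content is a.\<close>
definition fund_coeff :: "nat set \<Rightarrow> nat \<Rightarrow> (nat \<Rightarrow> nat) \<Rightarrow> nat" where
  "fund_coeff D n a = card {s. length s = n \<and> (\<forall>x\<in>set s. 1 \<le> x) \<and> sorted s \<and>
      (\<forall>j\<in>D. s ! (j - 1) < s ! j) \<and> (\<forall>k. count (mset s) k = a k)}"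

type_synonym itab = "nat \<times> nat \<Rightarrow> nat option"

definition increasing_tab :: "itab \<Rightarrow> bool" where
  "increasing_tab T \<longleftrightarrow>
     (\<exists>lam. strict_partition lam \<and> dom T = shifted_shape lam) \<and>
     (\<forall>v\<in>ran T. 1 \<le> v) \<and>
     (\<forall>i j j' v v'. j < j' \<and> T (i, j) = Some v \<and> T (i, j') = Some v' \<longrightarrow> v < v') \<and>
     (\<forall>i i' j v v'. i < i' \<and> T (i, j) = Some v \<and> T (i', j) = Some v' \<longrightarrow> v < v')"

definition row_vals :: "itab \<Rightarrow> nat \<Rightarrow> nat set" where
  "row_vals T r = {v. \<exists>j. T (r, j) = Some v}"

definition col_vals :: "itab \<Rightarrow> nat \<Rightarrow> nat set" where
  "col_vals T c = {v. \<exists>i. T (i, c) = Some v}"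

definition row_end :: "itab \<Rightarrow> nat \<Rightarrow> nat \<times> nat" where
  "row_end T r = (r, r + card {j. (r, j) \<in> dom T})"

definition col_end :: "itab \<Rightarrow> nat \<Rightarrow> nat \<times> nat" where
  "col_end T c = (card {i. (i, c) \<in> dom T}, c)"

inductive row_ins :: "itab \<Rightarrow> nat \<Rightarrow> nat \<Rightarrow> itab \<Rightarrow> bool"
  and col_ins :: "itab \<Rightarrow> nat \<Rightarrow> nat \<Rightarrow> itab \<Rightarrow> bool" where
  row_add: "\<lbrakk>\<forall>v\<in>row_vals T r. v \<le> x; increasing_tab (T(row_end T r \<mapsto> x))\<rbrakk>
     \<Longrightarrow> row_ins T r x (T(row_end T r \<mapsto> x))"
| row_stop: "\<lbrakk>\<forall>v\<in>row_vals T r. v \<le> x; \<not> increasing_tab (T(row_end T r \<mapsto> x))\<rbrakk>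
     \<Longrightarrow> row_ins T r x T"
| row_bump_diag: "\<lbrakk>T (r, r) = Some y; x < y; \<forall>v\<in>row_vals T r. x < v \<longrightarrow> y \<le> v;
     T1 = (if increasing_tab (T((r, r) \<mapsto> x)) then T((r, r) \<mapsto> x) else T);
     col_ins T1 (Suc r) y T'\<rbrakk>
     \<Longrightarrow> row_ins T r x T'"
| row_bump: "\<lbrakk>T (r, j) = Some y; j \<noteq> r; x < y; \<forall>v\<in>row_vals T r. x < v \<longrightarrow> y \<le> v;
     T1 = (if increasing_tab (T((r, j) \<mapsto> x)) then T((r, j) \<mapsto> x) else T);
     row_ins T1 (Suc r) y T'\<rbrakk>
     \<Longrightarrow> row_ins T r x T'"
| col_add: "\<lbrakk>\<forall>v\<in>col_vals T c. v \<le> x; increasing_tab (T(col_end T c \<mapsto> x))\<rbrakk>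
     \<Longrightarrow> col_ins T c x (T(col_end T c \<mapsto> x))"
| col_stop: "\<lbrakk>\<forall>v\<in>col_vals T c. v \<le> x; \<not> increasing_tab (T(col_end T c \<mapsto> x))\<rbrakk>
     \<Longrightarrow> col_ins T c x T"
| col_bump: "\<lbrakk>T (i, c) = Some y; x < y; \<forall>v\<in>col_vals T c. x < v \<longrightarrow> y \<le> v;
     T1 = (if increasing_tab (T((i, c) \<mapsto> x)) then T((i, c) \<mapsto> x) else T);
     col_ins T1 (Suc c) y T'\<rbrakk>
     \<Longrightarrow> col_ins T c x T'"

inductive hecke_P :: "nat list \<Rightarrow> itab \<Rightarrow> bool" where
  hecke_Nil: "hecke_P [] Map.empty"
| hecke_snoc: "\<lbrakk>hecke_P w T; row_ins T 0 x T'\<rbrakk> \<Longrightarrow> hecke_P (w @ [x]) T'"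

end

theory Submission
  imports Defs
begin

text \<open>
A shifted tableau is doubled to a symmetric one by reflecting it in the main diagonal. Shifted Hecke
insertion then becomes plain row-by-row Hecke insertion into the symmetric tableau: the phase of
column insertions is the part of the bumping path below the diagonal, and the place where the insertion
terminates is recorded by a corner of the symmetric shape, below the diagonal in case of termination in a
column insertion. This corner is where a primed letter is written in the recording tableau.

Instead of reversing bumping paths, cut the tableaux by value: the restriction to the entries at most v of
the result is computed from the one for v - 1 by a local rule (as in the Hecke growth diagrams of Patrias
and Pylyavskyy). The local rule is a bijection, so one insertion step (T, x) is determined by, and can be
prescribed through, the resulting tableau with the terminating corner and the bit telling whether
this corner is a new box. Stacking two local rules shows that consecutive letters x, y satisfy x <= y iff
the row of the second corner is at most the row of the first one.

Hence the words w with P(w) = T that are compatible with a fixed weakly increasing sequence s correspond to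
sequences of marked corners, which in turn are exactly the ways to build a weak set-valued tableau by
adding the letters of s one at a time: the last letter added is the one of largest code, in the largest
possible column of the doubled shape. Finally s is determined by the monomial.
\<close>

section \<open>Symmetric shapes and the local rule\<close>

text \<open>A blocked Hecke insertion leaves no trace where it fails: the entry \<open>y\<close> is
  sent to the next row although it also stays in place, and there it may be blocked in turn by its
  own copy above. So the bumping path cannot be read off from the result row by row. At a single
  level \<open>v\<close> the difficulty is local: the boxes holding \<open>v\<close> form a rook
  strip, and only the final box of the path at level \<open>v - 1\<close> and its right and lower
  neighbours decide what happens. The recorded box is therefore not the row being processed. It is
  the terminating corner of the insertion restricted to entries at most \<open>v\<close>; while
  blocked values pass down column \<open>l\<close>, this corner stays at the bottom of column
  \<open>l - 1\<close>. Reconciling the two descriptions is the main work in relating insertion to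
  the local rule. The entries of \<open>T\<close> influence the words but not their number: for
  fixed \<open>T\<close> the words correspond to all marked ways of building its shape. Since the
  number of marks is the degree of the monomial, only finitely many words contribute to a given
  coefficient.\<close>

type_synonym diagram = "(nat \<times> nat) set"

definition young :: "diagram \<Rightarrow> bool" where
  "young M \<longleftrightarrow> finite M \<and> (\<forall>i j. (i, j) \<in> M \<longrightarrow> (j, i) \<in> M) \<and> (\<forall>i j. (i, Suc j) \<in> M \<longrightarrow> (i, j) \<in> M)"

definition corner :: "diagram \<Rightarrow> nat \<Rightarrow> nat \<Rightarrow> bool" where
  "corner M i j \<longleftrightarrow> (i, j) \<in> M \<and> (i, Suc j) \<notin> M \<and> (Suc i, j) \<notin> M"

definition addable :: "diagram \<Rightarrow> nat \<Rightarrow> nat \<Rightarrow> bool" where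
  "addable M i j \<longleftrightarrow> (i, j) \<notin> M \<and> (\<forall>k. i = Suc k \<longrightarrow> (k, j) \<in> M) \<and> (\<forall>k. j = Suc k \<longrightarrow> (i, k) \<in> M)"

text \<open>The model of a level set: in an increasing tableau the boxes with a common value are
  corners of the diagram of entries not exceeding it, hence lie in different rows and columns.
  Symmetry reflects the doubling.\<close>

definition rook :: "diagram \<Rightarrow> diagram \<Rightarrow> bool" where
  "rook M S \<longleftrightarrow> (\<forall>i j. (i, j) \<in> S \<longrightarrow> (j, i) \<in> S \<and> corner M i j)"

text \<open>By symmetry of the diagram this is at once the length of row \<open>p\<close> and of
  column \<open>p\<close>; both readings are used.\<close>

definition len :: "diagram \<Rightarrow> nat \<Rightarrow> nat" where
  "len M p = (LEAST l. (p, l) \<notin> M)"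

lemma young_swap: "young M \<Longrightarrow> (i, j) \<in> M \<longleftrightarrow> (j, i) \<in> M"
  unfolding young_def by blast

lemma young_left: "young M \<Longrightarrow> (i, j) \<in> M \<Longrightarrow> j' \<le> j \<Longrightarrow> (i, j') \<in> M"
proof (induction j)
  case (Suc j)
  then show ?case unfolding young_def by (metis le_SucE)
qed simp

lemma young_mono: "young M \<Longrightarrow> (i, j) \<in> M \<Longrightarrow> i' \<le> i \<Longrightarrow> j' \<le> j \<Longrightarrow> (i', j') \<in> M"
  by (meson young_left young_swap)

lemma young_len: assumes "young M" shows "(p, i) \<in> M \<longleftrightarrow> i < len M p"
proof -
  have "finite ((\<lambda>l. (p, l)) -` M)"
    using assms by (intro finite_vimageI) (auto simp: young_def inj_on_def)
  then obtain l where "(p, l) \<notin> M"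
    by (metis ex_new_if_finite infinite_UNIV_nat vimageI)
  then have "(p, len M p) \<notin> M" unfolding len_def by (rule LeastI)
  moreover have "i < len M p \<Longrightarrow> (p, i) \<in> M" unfolding len_def using not_less_Least by blast
  ultimately show ?thesis using assms young_left by (metis not_le)
qed

lemma len_eqI: "young M \<Longrightarrow> (p, l) \<notin> M \<Longrightarrow> (\<And>k. l = Suc k \<Longrightarrow> (p, k) \<in> M) \<Longrightarrow> len M p = l"
  by (cases l) (auto simp: young_len)

text \<open>An edge \<open>Some (b, e)\<close> records a corner \<open>b\<close> of the symmetric shape and whether \<open>b\<close> (with its mirror
image) was added by the insertion; \<open>None\<close> means that the inserted value exceeds the current level.\<close>

type_synonym edge = "((nat \<times> nat) \<times> bool) option"

text \<open>Inserts the current value \<open>v\<close> into row \<open>p\<close> of the shape \<open>M\<close> of the entries at most \<open>v\<close>, whose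
boxes with entry \<open>v\<close> form \<open>S\<close>: a row ending in \<open>v\<close> cannot be extended.\<close>

definition row_rule :: "nat \<Rightarrow> diagram \<Rightarrow> diagram \<Rightarrow> diagram \<times> diagram \<times> edge" where
  "row_rule p M S = (let l = len M p in
     if 0 < l \<and> (p, l - 1) \<in> S then (M, S, Some ((p, l - 1), False))
     else (M \<union> {(p, l), (l, p)}, S \<union> {(p, l), (l, p)}, Some ((p, l), True)))"

text \<open>The local rule at level \<open>v\<close>: \<open>X\<close> says that \<open>v\<close> is the inserted letter, \<open>M\<close> and \<open>S\<close> are the boxes with
entry at most \<open>v\<close> and equal to \<open>v\<close> before the insertion, and \<open>E\<close> is the edge at level \<open>v - 1\<close>.
If the path ended at level \<open>v - 1\<close> in a box holding \<open>v\<close>, then \<open>v\<close> is bumped into the next row.\<close>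

definition cell :: "bool \<Rightarrow> diagram \<Rightarrow> diagram \<Rightarrow> edge \<Rightarrow> diagram \<times> diagram \<times> edge" where
  "cell X M S E = (case E of None \<Rightarrow> if X then row_rule 0 M S else (M, S, None)
     | Some ((k, j), e) \<Rightarrow>
         if e then (if (k, j) \<in> S then row_rule (Suc k) M (S - {(k, j), (j, k)})
                    else (M \<union> {(k, j), (j, k)}, S, E))
         else (if (k, Suc j) \<in> S \<or> (Suc k, j) \<in> S then row_rule (Suc k) M S else (M, S, E)))"

fun del :: "edge \<Rightarrow> diagram \<Rightarrow> diagram" where
  "del (Some ((k, j), True)) M = M - {(k, j), (j, k)}"
| "del _ M = M"

fun app :: "edge \<Rightarrow> diagram \<Rightarrow> diagram" where
  "app (Some ((k, j), True)) M = M \<union> {(k, j), (j, k)}"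
| "app _ M = M"

text \<open>Refers to the diagram before the insertion, \<open>edge_out\<close> to the one after it:
  a new box is addable before and a corner after, while an old terminating box is a corner both
  times.\<close>

definition edge_in :: "diagram \<Rightarrow> edge \<Rightarrow> bool" where
  "edge_in M E \<longleftrightarrow> (\<forall>k j e. E = Some ((k, j), e) \<longrightarrow> (if e then addable M k j else corner M k j))"

definition edge_out :: "diagram \<Rightarrow> edge \<Rightarrow> bool" where
  "edge_out M E \<longleftrightarrow> (\<forall>k j e. E = Some ((k, j), e) \<longrightarrow> corner M k j)"

text \<open>Reads the local rule backwards. If the final box does not hold \<open>v\<close>, then
  \<open>v\<close> took no part. Otherwise \<open>v\<close> was last inserted into row
  \<open>p\<close>: as the letter itself if \<open>p = 0\<close>, and else after a bump from row
  \<open>k = p - 1\<close>. The last box of row \<open>k\<close> tells three kinds of bump apart: it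
  holds \<open>v\<close>, and the edge was to its left; or it has a box below it, which then holds
  \<open>v\<close>; or \<open>v\<close> was displaced from it and is restored to
  \<open>S\<close>.\<close>

definition uncell :: "diagram \<Rightarrow> diagram \<Rightarrow> edge \<Rightarrow> bool \<times> diagram \<times> diagram \<times> edge" where
  "uncell M' S' E' = (case E' of None \<Rightarrow> (False, M', S', None)
     | Some ((p, q), e) \<Rightarrow>
        if (p, q) \<notin> S' then (False, del E' M', S', E')
        else (let M = del E' M'; S = del E' S' in
          case p of 0 \<Rightarrow> (True, M, S, None)
          | Suc k \<Rightarrow> let j = len M k - 1 in
              if (k, j) \<in> S then (False, M, S, Some ((k, j - 1), False))
              else if (Suc k, j) \<in> M then (False, M, S, Some ((k, j), False))
              else (False, M, S \<union> {(k, j), (j, k)}, Some ((k, j), True))))"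

section \<open>Symmetric diagrams under adding and removing a mirrored pair of boxes\<close>

lemma addable_sym: "young M \<Longrightarrow> addable M i j \<Longrightarrow> addable M j i"
  unfolding addable_def by (metis young_swap)

lemma corner_sym: "young M \<Longrightarrow> corner M i j \<Longrightarrow> corner M j i"
  unfolding corner_def by (metis young_swap)

lemma youngI: "finite M \<Longrightarrow> (\<And>i j. (i, j) \<in> M \<Longrightarrow> (j, i) \<in> M) \<Longrightarrow>
    (\<And>i j. (i, Suc j) \<in> M \<Longrightarrow> (i, j) \<in> M) \<Longrightarrow> young M"
  unfolding young_def by blast

lemma young_finite: "young M \<Longrightarrow> finite M"
  unfolding young_def by blast

lemma young_add: assumes "young M" "addable M i j" shows "young (M \<union> {(i, j), (j, i)})"
proof (rule youngI)
  fix a b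
  show "(a, b) \<in> M \<union> {(i, j), (j, i)} \<Longrightarrow> (b, a) \<in> M \<union> {(i, j), (j, i)}"
    using young_swap[OF assms(1), of a b] by auto
  show "(a, Suc b) \<in> M \<union> {(i, j), (j, i)} \<Longrightarrow> (a, b) \<in> M \<union> {(i, j), (j, i)}"
    using young_mono[OF assms(1), of a "Suc b" a b] assms(2) addable_sym[OF assms]
    unfolding addable_def by auto
qed (simp add: young_finite[OF assms(1)])

lemma young_diff: assumes "young M" "rook M S" shows "young (M - S)"
proof (rule youngI)
  fix a b
  have "(a, b) \<in> S \<longleftrightarrow> (b, a) \<in> S" using assms(2) unfolding rook_def by blast
  then show "(a, b) \<in> M - S \<Longrightarrow> (b, a) \<in> M - S"
    using young_swap[OF assms(1), of a b] by simp
  have "(a, b) \<in> S \<Longrightarrow> corner M a b" using assms(2) unfolding rook_def by blast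
  then show "(a, Suc b) \<in> M - S \<Longrightarrow> (a, b) \<in> M - S"
    using young_mono[OF assms(1), of a "Suc b" a b] by (auto simp: corner_def)
qed (simp add: young_finite[OF assms(1)])

lemma rook_pair: "young M \<Longrightarrow> corner M i j \<Longrightarrow> rook M {(i, j), (j, i)}"
  using corner_sym by (auto simp: rook_def)

lemma young_del: assumes "young M" "corner M i j" shows "young (M - {(i, j), (j, i)})"
  using assms(1) rook_pair[OF assms] by (rule young_diff)

lemma corner_add: assumes "young M" "addable M i j" shows "corner (M \<union> {(i, j), (j, i)}) i j"
proof -
  have "(i, Suc j) \<notin> M" "(Suc i, j) \<notin> M"
    using assms young_mono[OF assms(1), of i "Suc j" i j] young_mono[OF assms(1), of "Suc i" j i j]
    unfolding addable_def by auto
  then show ?thesis unfolding corner_def by auto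
qed

lemma addable_del: assumes "young M" "corner M i j" shows "addable (M - {(i, j), (j, i)}) i j"
proof -
  have "(k, j) \<in> M" if "i = Suc k" for k
    using young_mono[OF assms(1), of i j k j] assms(2) that unfolding corner_def by auto
  moreover have "(i, k) \<in> M" if "j = Suc k" for k
    using young_mono[OF assms(1), of i j i k] assms(2) that unfolding corner_def by auto
  ultimately show ?thesis unfolding addable_def by auto
qed

lemma edge_in_simps [simp]: "edge_in M None" "edge_in M (Some ((k, j), True)) = addable M k j"
  "edge_in M (Some ((k, j), False)) = corner M k j"
  by (auto simp: edge_in_def)

lemma edge_out_simps [simp]: "edge_out M None" "edge_out M (Some ((k, j), e)) = corner M k j"
  by (auto simp: edge_out_def)

lemma app_Some: "app (Some ((k, j), e)) M = (if e then M \<union> {(k, j), (j, k)} else M)"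
  by (cases e) auto

lemma del_Some: "del (Some ((k, j), e)) M = (if e then M - {(k, j), (j, k)} else M)"
  by (cases e) auto

lemma edge_cases: obtains "E = None" | k j e where "E = Some ((k, j), e)"
  by (metis option.exhaust surj_pair)

lemma edge_out_app: assumes "young M" "edge_in M E" shows "edge_out (app E M) E"
proof (cases E rule: edge_cases)
  case (2 k j e)
  then show ?thesis using assms corner_add[OF assms(1), of k j]
    by (cases e) (simp_all add: app_Some)
qed simp

lemma edge_in_del: assumes "young M" "edge_out M E" shows "edge_in (del E M) E"
proof (cases E rule: edge_cases)
  case (2 k j e)
  then show ?thesis using assms addable_del[OF assms(1), of k j]
    by (cases e) (simp_all add: del_Some)
qed simp

lemma young_del_edge: assumes "young M" "edge_out M E" shows "young (del E M)"
proof (cases E rule: edge_cases)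
  case (2 k j e)
  then show ?thesis using assms young_del[OF assms(1), of k j]
    by (cases e) (simp_all add: del_Some)
qed (use assms in simp)

lemma rook_sym: "rook M S \<Longrightarrow> (i, j) \<in> S \<longleftrightarrow> (j, i) \<in> S"
  unfolding rook_def by blast

lemma rook_corner: "rook M S \<Longrightarrow> (i, j) \<in> S \<Longrightarrow> corner M i j"
  unfolding rook_def by blast

lemma rook_subset: "rook M S \<Longrightarrow> S \<subseteq> M"
  unfolding rook_def corner_def by auto

lemma corner_len: "young M \<Longrightarrow> corner M p q \<Longrightarrow> len M p = Suc q"
  by (rule len_eqI) (auto simp: corner_def)

section \<open>The row rule and the invariants of the local rule\<close>

lemma row_rule_old: assumes "young M" "rook M S" "(p, q) \<in> S"
  shows "row_rule p M S = (M, S, Some ((p, q), False))"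
  using corner_len[OF assms(1) rook_corner[OF assms(2,3)]] assms(3) by (simp add: row_rule_def)

lemma row_rule_new: assumes "young M" "rook M S" "\<And>q. (p, q) \<notin> S" "l = len M p"
  shows "row_rule p M S = (M \<union> {(p, l), (l, p)}, S \<union> {(p, l), (l, p)}, Some ((p, l), True))"
  using assms by (simp add: row_rule_def Let_def)

lemma rook_add: assumes y: "young M" and r: "rook M S" and a: "addable M p l"
    and left: "\<And>k. l = Suc k \<Longrightarrow> (p, k) \<notin> S" and up: "\<And>k. p = Suc k \<Longrightarrow> (k, l) \<notin> S"
  shows "rook (M \<union> {(p, l), (l, p)}) (S \<union> {(p, l), (l, p)})" (is "rook ?M ?S")
  unfolding rook_def
proof (intro allI impI)
  fix i j assume *: "(i, j) \<in> ?S"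
  have c: "corner ?M p l" using corner_add[OF y a] .
  have c': "corner ?M l p" using corner_sym[OF young_add[OF y a] c] .
  have "corner ?M i j" if "(i, j) \<in> S"
  proof -
    have m: "corner M i j" using rook_corner[OF r that] .
    have "(i, Suc j) \<noteq> (p, l)" "(Suc i, j) \<noteq> (l, p)" "(Suc i, j) \<noteq> (p, l)" "(i, Suc j) \<noteq> (l, p)"
      using left up that rook_sym[OF r] by blast+
    with m show ?thesis unfolding corner_def by blast
  qed
  then have "corner ?M i j" using * c c' by blast
  moreover have "(j, i) \<in> ?S" using * rook_sym[OF r, of i j] by blast
  ultimately show "(j, i) \<in> ?S \<and> corner ?M i j" by blast
qed

text \<open>Describes \<open>v\<close> arriving by a bump: the row above has an entry smaller than
  \<open>v\<close> with no entry smaller than \<open>v\<close> beneath it. This guarantees that a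
  new box of row \<open>p\<close> is addable and does not lie under another
  \<open>v\<close>.\<close>

definition row_rule_pre :: "nat \<Rightarrow> diagram \<Rightarrow> diagram \<Rightarrow> bool" where
  "row_rule_pre p M S \<longleftrightarrow> (\<forall>k. p = Suc k \<longrightarrow> (\<exists>j. (k, j) \<in> M - S \<and> ((p, j) \<notin> M \<or> (p, j) \<in> S)))"

lemma row_rule_out:
  assumes y: "young M" and r: "rook M S" and pre: "row_rule_pre p M S"
    and row_rule: "row_rule p M S = (M', S', E')"
  shows "young M'" (is ?a) "rook M' S'" (is ?b) "M' - S' = M - S" (is ?c) "del E' M' = M" (is ?d)
    "del E' S' = S" (is ?e) "\<exists>q e. E' = Some ((p, q), e) \<and> (p, q) \<in> S'" (is ?f)
proof -
  have "?a \<and> ?b \<and> ?c \<and> ?d \<and> ?e \<and> ?f"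
  proof (cases "\<exists>q. (p, q) \<in> S")
    case True
    then obtain q where q: "(p, q) \<in> S" by blast
    show ?thesis using row_rule_old[OF y r q] row_rule q y r by (auto intro: exI[of _ q] exI[of _ False])
  next
    case False
    define l where "l = len M p"
    have l: "(p, l) \<notin> M" "(l, p) \<notin> M" using young_len[OF y, of p l] young_swap[OF y, of p l] l_def by auto
    \<comment> \<open>As row \<open>p\<close> holds no \<open>v\<close>, the witness column lies
      weakly right of the end \<open>l\<close> of row \<open>p\<close>, so the box above the new one
      is present. It could hold \<open>v\<close> only as the last box of its row, that is at the
      witness itself, whose entry is smaller.\<close>
    have up: "(k, l) \<in> M \<and> (k, l) \<notin> S" if p: "p = Suc k" for k
    proof -
      obtain j where j: "(k, j) \<in> M" "(k, j) \<notin> S" "(p, j) \<notin> M" using pre False p unfolding row_rule_pre_def by blast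
      have "l \<le> j" using j(3) young_len[OF y, of p j] l_def by auto
      then have "(k, l) \<in> M" using young_mono[OF y j(1), of k l] by simp
      moreover have "(k, l) \<notin> S" 
      proof
        assume "(k, l) \<in> S"
        then have "(k, Suc l) \<notin> M" using rook_corner[OF r] unfolding corner_def by blast
        then have "\<not> Suc l \<le> j" using young_mono[OF y j(1), of k "Suc l"] by blast
        then have "l = j" using \<open>l \<le> j\<close> by simp
        then show False using j(2) \<open>(k, l) \<in> S\<close> by simp
      qed
      ultimately show ?thesis by simp
    qed
    have a: "addable M p l" unfolding addable_def using up l young_len[OF y, of p] l_def by auto
    have nS: "(p, l) \<notin> S" "(l, p) \<notin> S" using l rook_subset[OF r] by auto
    have eq: "M' = M \<union> {(p, l), (l, p)}" "S' = S \<union> {(p, l), (l, p)}" "E' = Some ((p, l), True)"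
      using row_rule_new[OF y r _ l_def] False row_rule by auto
    have "rook M' S'" unfolding eq using rook_add[OF y r a] False up by blast
    moreover have "young M'" unfolding eq using young_add[OF y a] .
    moreover have "M' - S' = M - S" unfolding eq using l by blast
    moreover have "del E' M' = M" "del E' S' = S" unfolding eq using l nS by auto
    ultimately show ?thesis using eq by blast
  qed
  then show ?a ?b ?c ?d ?e ?f by blast+
qed

lemma rook_minus: "rook M S \<Longrightarrow> rook M (S - {(i, j), (j, i)})"
  unfolding rook_def by blast

text \<open>Every bump from \<open>(k, j)\<close> goes into row \<open>Suc k\<close>, and
  \<open>(k, j)\<close> itself witnesses \<open>row_rule_pre\<close> there, as it holds an entry
  smaller than \<open>v\<close> once the path has ended in it. In \<open>bump_below\<close> the next
  row already ends in \<open>v\<close>, so the edge just moves one box down.\<close>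

lemma cell_cases:
  assumes y: "young M" and r: "rook M S" and ein: "edge_in (M - S) E" and X: "X \<longrightarrow> E = None"
  obtains (null) "E = None" "\<not> X" "cell X M S E = (M, S, None)"
  | (start) "E = None" "X" "cell X M S E = row_rule 0 M S" "row_rule_pre 0 M S"
  | (stay) k j e where "E = Some ((k, j), e)" "\<not> X" "(k, j) \<notin> S" "(k, Suc j) \<notin> S" "(Suc k, j) \<notin> S"
      "edge_in M E" "cell X M S E = (app E M, S, E)"
  | (bump_new) k j where "E = Some ((k, j), True)" "\<not> X" "(k, j) \<in> S"
      "cell X M S E = row_rule (Suc k) M (S - {(k, j), (j, k)})" "row_rule_pre (Suc k) M (S - {(k, j), (j, k)})"
  | (bump_right) k j where "E = Some ((k, j), False)" "\<not> X" "(k, j) \<in> M" "(k, j) \<notin> S" "(k, Suc j) \<in> S"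
      "cell X M S E = row_rule (Suc k) M S" "row_rule_pre (Suc k) M S"
  | (bump_below) k j where "E = Some ((k, j), False)" "\<not> X" "(k, j) \<in> M" "(k, j) \<notin> S" "(k, Suc j) \<notin> M" "(Suc k, j) \<in> S"
      "cell X M S E = row_rule (Suc k) M S" "row_rule_pre (Suc k) M S"
proof (cases E rule: edge_cases)
  case 1
  then show ?thesis using that(1,2) by (cases X) (auto simp: cell_def row_rule_pre_def)
next
  case (2 k j e)
  then have nX: "\<not> X" using X by auto
  show ?thesis
  proof (cases e)
    case True
    have a: "addable (M - S) k j" using ein 2 True by simp
    show ?thesis
    proof (cases "(k, j) \<in> S")
      case t: True
      have "corner M k j" using rook_corner[OF r t] .
      then have "row_rule_pre (Suc k) M (S - {(k, j), (j, k)})" unfolding row_rule_pre_def corner_def by auto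
      then show ?thesis using 2 True t nX by (intro that(4)) (auto simp: cell_def)
    next
      case f: False
      then have n: "(k, j) \<notin> M" using a unfolding addable_def by blast
      have "(k, Suc j) \<notin> M" "(Suc k, j) \<notin> M"
        using n young_mono[OF y, of k "Suc j" k j] young_mono[OF y, of "Suc k" j k j] by auto
      then have "(k, Suc j) \<notin> S" "(Suc k, j) \<notin> S" using rook_subset[OF r] by auto
      moreover have "addable M k j" using a n unfolding addable_def by blast
      ultimately show ?thesis using 2 True f nX by (intro that(3)) (auto simp: cell_def)
    qed
  next
    case False
    have c: "corner (M - S) k j" using ein 2 False by simp
    then have m: "(k, j) \<in> M" "(k, j) \<notin> S" unfolding corner_def by auto
    have b: "(Suc k, j) \<notin> M \<or> (Suc k, j) \<in> S" using c unfolding corner_def by auto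
    have pre: "row_rule_pre (Suc k) M S" using m b unfolding row_rule_pre_def by blast
    show ?thesis
    proof (cases "(k, Suc j) \<in> S")
      case True
      then show ?thesis using 2 False m nX pre by (intro that(5)) (auto simp: cell_def)
    next
      case nr: False
      then have nr': "(k, Suc j) \<notin> M" using c unfolding corner_def by blast
      show ?thesis
      proof (cases "(Suc k, j) \<in> S")
        case True
        then show ?thesis using 2 False m nX pre nr' by (intro that(6)) (auto simp: cell_def)
      next
        case nb: False
        then have "corner M k j" using c nr' unfolding corner_def by blast
        then show ?thesis using 2 False m nr nb nX by (intro that(3)) (auto simp: cell_def)
      qed
    qed
  qed
qed

lemma cell_out:
  assumes y: "young M" and r: "rook M S" and ein: "edge_in (M - S) E" and X: "X \<longrightarrow> E = None"
    and cell: "cell X M S E = (M', S', E')"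
  shows "young M'" (is ?a) "rook M' S'" (is ?b) "edge_out M' E'" (is ?c)
    "M' - S' = app E (M - S)" (is ?d) "del E' M' = M" (is ?e)
proof -
  have rr: "?a \<and> ?b \<and> ?c \<and> M' - S' = M - S0 \<and> ?e"
    if "row_rule p M S0 = (M', S', E')" "row_rule_pre p M S0" "rook M S0" for p S0
    using row_rule_out[OF y that(3,2,1)] rook_corner by auto
  have "?a \<and> ?b \<and> ?c \<and> ?d \<and> ?e"
    using y r ein X
  proof (cases rule: cell_cases)
    case null
    then show ?thesis using cell y r by simp
  next
    case start
    then show ?thesis using rr[of 0 S] cell r by simp
  next
    case (stay k j e)
    have eq: "M' = app E M" "S' = S" "E' = E" using stay cell by auto
    have o: "edge_out M' E'" unfolding eq using edge_out_app[OF y stay(6)] .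
    show ?thesis
    proof (cases e)
      case True
      have eps: "E = Some ((k, j), True)" using stay(1) True by simp
      then have mu: "M' = M \<union> {(k, j), (j, k)}" using eq by simp
      have a: "addable M k j" using stay(6) eps by simp
      have "(j, k) \<notin> S" using stay rook_sym[OF r] by blast
      moreover have "(k, j) \<notin> M" "(j, k) \<notin> M" using a addable_sym[OF y a] unfolding addable_def by auto
      \<comment> \<open>A box addable to \<open>M - S\<close> has its left and upper neighbours in
        \<open>M - S\<close>, so the corners in \<open>S\<close> stay corners when it is
        filled.\<close>
      moreover have "rook M' S"
        unfolding rook_def
      proof (intro allI impI conjI)
        fix u v assume uv: "(u, v) \<in> S"
        then show "(v, u) \<in> S" using rook_sym[OF r] by blast
        have m: "corner M u v" using rook_corner[OF r uv] .
        have "(u, Suc v) \<noteq> (k, j)" "(Suc u, v) \<noteq> (k, j)" "(u, Suc v) \<noteq> (j, k)" "(Suc u, v) \<noteq> (j, k)"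
          using ein uv rook_sym[OF r, of u v] unfolding eps edge_in_simps addable_def by auto
        then show "corner M' u v" using m unfolding corner_def mu by blast
      qed
      moreover have "young M'" unfolding mu using young_add[OF y a] .
      ultimately show ?thesis using o stay(3) eps eq by auto
    next
      case False
      then show ?thesis using o y r eq stay(1) by simp
    qed
  next
    case (bump_new k j)
    have "(k, j) \<in> M" "(j, k) \<in> M" using bump_new(3) rook_subset[OF r] rook_sym[OF r, of k j] by blast+
    then have "M - (S - {(k, j), (j, k)}) = app E (M - S)" using bump_new(1) by auto
    then show ?thesis using rr[OF _ bump_new(5) rook_minus[OF r]] bump_new(4) cell by simp
  next
    case (bump_right k j)
    then show ?thesis using rr[of "Suc k" S] cell r by simp
  next
    case (bump_below k j)
    then show ?thesis using rr[of "Suc k" S] cell r by simp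
  qed
  then show ?a ?b ?c ?d ?e by blast+
qed

text \<open>Isolates what the comparison of consecutive letters needs to know about rows: one level
  moves the edge down by at most one row, and a move leaves a \<open>v\<close> in the row it
  reaches.\<close>

lemma cell_row:
  assumes y: "young M" and r: "rook M S" and ein: "edge_in (M - S) E" and X: "X \<longrightarrow> E = None"
    and cell: "cell X M S E = (M', S', E')"
  shows "E = None \<Longrightarrow> \<not> X \<Longrightarrow> E' = None"
    "X \<Longrightarrow> \<exists>q e. E' = Some ((0, q), e) \<and> (0, q) \<in> S'" (is "_ \<Longrightarrow> ?b")
    "E = Some ((k, j), e) \<Longrightarrow> (E' = E \<and> S' = S \<and> (k, j) \<notin> S \<and> (k, Suc j) \<notin> S \<and> (Suc k, j) \<notin> S) \<or>
       (\<exists>q e'. E' = Some ((Suc k, q), e') \<and> (Suc k, q) \<in> S')" (is "_ \<Longrightarrow> ?c k j")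
proof -
  have rr: "\<exists>q e. E' = Some ((p, q), e) \<and> (p, q) \<in> S'"
    if "row_rule p M S0 = (M', S', E')" "row_rule_pre p M S0" "rook M S0" for p S0
    using row_rule_out(6)[OF y that(3,2,1)] .
  have "(E = None \<longrightarrow> \<not> X \<longrightarrow> E' = None) \<and> (X \<longrightarrow> ?b) \<and> (\<forall>k j e. E = Some ((k, j), e) \<longrightarrow> ?c k j)"
    using y r ein X
  proof (cases rule: cell_cases)
    case null
    then show ?thesis using cell by simp
  next
    case start
    then show ?thesis using rr[of 0 S] cell r by simp
  next
    case (stay k j e)
    then have "E' = E" "S' = S" using cell by auto
    then show ?thesis using stay by auto
  next
    case (bump_new k j)
    then show ?thesis using rr[OF _ bump_new(5) rook_minus[OF r]] cell by simp
  next
    case (bump_right k j)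
    then show ?thesis using rr[of "Suc k" S] cell r by simp
  next
    case (bump_below k j)
    then show ?thesis using rr[of "Suc k" S] cell r by simp
  qed
  then show "E = None \<Longrightarrow> \<not> X \<Longrightarrow> E' = None" "X \<Longrightarrow> ?b" "E = Some ((k, j), e) \<Longrightarrow> ?c k j" by blast+
qed

section \<open>Inverting and stacking the local rule\<close>

lemma rook_addable: assumes y: "young M" and r: "rook M S" and "(k, j) \<in> S"
  shows "addable (M - S) k j"
proof -
  have m: "(k, j) \<in> M" using assms rook_subset by blast
  have "(k', j) \<in> M - S" if "k = Suc k'" for k'
    using young_mono[OF y m, of k' j] rook_corner[OF r, of k' j] m that unfolding corner_def by auto
  moreover have "(k, j') \<in> M - S" if "j = Suc j'" for j'
    using young_mono[OF y m, of k j'] rook_corner[OF r, of k j'] m that unfolding corner_def by auto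
  ultimately show ?thesis using assms(3) unfolding addable_def by blast
qed

lemma uncell_bump:
  assumes "E' = Some ((Suc k, q), e)" "(Suc k, q) \<in> S'" "del E' M' = M" "del E' S' = S0" "len M k = Suc j"
  shows "uncell M' S' E' = (if (k, j) \<in> S0 then (False, M, S0, Some ((k, j - 1), False))
              else if (Suc k, j) \<in> M then (False, M, S0, Some ((k, j), False))
              else (False, M, S0 \<union> {(k, j), (j, k)}, Some ((k, j), True)))"
  using assms by (simp add: uncell_def Let_def del: del.simps)

text \<open>The row rule is undone by deleting the box it added. In the three bump cases the last
  box of row \<open>k\<close> is the vacated \<open>(k, j)\<close>, the \<open>v\<close> in
  \<open>(k, Suc j)\<close>, or \<open>(k, j)\<close> with a \<open>v\<close> below it, so the tests
  in \<open>uncell\<close> separate them.\<close>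

lemma uncell_cell:
  assumes y: "young M" and r: "rook M S" and ein: "edge_in (M - S) E" and X: "X \<longrightarrow> E = None"
    and cell: "cell X M S E = (M', S', E')"
  shows "uncell M' S' E' = (X, M, S, E)"
  using y r ein X
proof (cases rule: cell_cases)
  case null
  then show ?thesis using cell by (simp add: uncell_def)
next
  case start
  then have n: "row_rule 0 M S = (M', S', E')" using cell by simp
  obtain q e where "E' = Some ((0, q), e)" "(0, q) \<in> S'" using row_rule_out(6)[OF y r start(4) n] by blast
  then show ?thesis using row_rule_out(4,5)[OF y r start(4) n] start(1,2)
    by (simp add: uncell_def Let_def del: del.simps)
next
  case (stay k j e)
  have eq: "M' = app E M" "S' = S" "E' = E" using stay cell by auto
  have "del E (app E M) = M"
    using stay(6) addable_sym[OF y, of k j] unfolding stay(1) by (cases e) (auto simp: addable_def)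
  then show ?thesis using stay eq by (simp add: uncell_def del: del.simps app.simps)
next
  case (bump_new k j)
  let ?S = "S - {(k, j), (j, k)}"
  have n: "row_rule (Suc k) M ?S = (M', S', E')" using cell bump_new by simp
  obtain q e where e: "E' = Some ((Suc k, q), e)" "(Suc k, q) \<in> S'"
    using row_rule_out(6)[OF y rook_minus[OF r] bump_new(5) n] by blast
  have c: "corner M k j" using rook_corner[OF r bump_new(3)] .
  have "?S \<union> {(k, j), (j, k)} = S" using bump_new(3) rook_sym[OF r] by blast
  then show ?thesis
    using uncell_bump[OF e row_rule_out(4,5)[OF y rook_minus[OF r] bump_new(5) n] corner_len[OF y c]] bump_new(1,2) c
    by (simp add: corner_def)
next
  case (bump_right k j)
  have n: "row_rule (Suc k) M S = (M', S', E')" using cell bump_right by simp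
  obtain q e where e: "E' = Some ((Suc k, q), e)" "(Suc k, q) \<in> S'"
    using row_rule_out(6)[OF y r bump_right(7) n] by blast
  show ?thesis
    using uncell_bump[OF e row_rule_out(4,5)[OF y r bump_right(7) n] corner_len[OF y rook_corner[OF r bump_right(5)]]] bump_right
    by simp
next
  case (bump_below k j)
  have n: "row_rule (Suc k) M S = (M', S', E')" using cell bump_below by simp
  obtain q e where e: "E' = Some ((Suc k, q), e)" "(Suc k, q) \<in> S'"
    using row_rule_out(6)[OF y r bump_below(8) n] by blast
  have "len M k = Suc j" using bump_below(3,5) by (intro len_eqI[OF y]) auto
  then show ?thesis
    using uncell_bump[OF e row_rule_out(4,5)[OF y r bump_below(8) n]] bump_below rook_subset[OF r]
    by auto
qed

lemma row_rule_inverse: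
  assumes y: "young M'" and r: "rook M' S'" and b: "(p, q) \<in> S'" and e: "E' = Some ((p, q), e)"
  shows "young (del E' M')" (is ?a) "rook (del E' M') (del E' S')" (is ?b)
    "row_rule p (del E' M') (del E' S') = (M', S', E')" (is ?c)
proof -
  have c: "corner M' p q" using rook_corner[OF r b] .
  have "?a \<and> ?b \<and> ?c"
  proof (cases e)
    case True
    let ?M = "M' - {(p, q), (q, p)}" and ?S = "S' - {(p, q), (q, p)}"
    have 1: "del E' M' = ?M" "del E' S' = ?S" using e True by auto
    have y1: "young ?M" using young_del[OF y c] .
    have r1: "rook ?M ?S" using r unfolding rook_def corner_def by blast
    have f: "\<And>v. (p, v) \<notin> ?S"
      using corner_len[OF y c] corner_len[OF y rook_corner[OF r]] by auto
    have l: "q = len ?M p"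
      using addable_del[OF y c] unfolding addable_def by (intro len_eqI[OF y1, symmetric]) auto
    have u: "?M \<union> {(p, q), (q, p)} = M'" "?S \<union> {(p, q), (q, p)} = S'"
      using b rook_sym[OF r, of p q] rook_subset[OF r] by auto
    have "row_rule p ?M ?S = (M', S', E')" using row_rule_new[OF y1 r1 f l] unfolding u using e True by simp
    then show ?thesis unfolding 1 using y1 r1 by blast
  next
    case False
    then show ?thesis using row_rule_old[OF y r b] e y r by simp
  qed
  then show ?a ?b ?c by blast+
qed

text \<open>Beyond undoing the row rule, the point is that the edge produced is admissible for
  \<open>M - S\<close>: in each case of \<open>uncell\<close> its box is a corner or an addable box
  once the boxes with \<open>v\<close> are removed.\<close>

lemma cell_uncell:
  assumes y: "young M'" and r: "rook M' S'" and o: "edge_out M' E'"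
    and u: "uncell M' S' E' = (X, M, S, E)"
  shows "young M" (is ?a) "rook M S" (is ?b) "edge_in (M - S) E" (is ?c) "X \<longrightarrow> E = None" (is ?d)
    "cell X M S E = (M', S', E')" (is ?e)
proof -
  have "?a \<and> ?b \<and> ?c \<and> ?d \<and> ?e"
  proof (cases E' rule: edge_cases)
    case 1
    then show ?thesis using u y r by (auto simp: uncell_def cell_def)
  next
    case (2 p q e)
    have c: "corner M' p q" using o 2 by simp
    show ?thesis
    proof (cases "(p, q) \<in> S'")
      case False
      have eq: "X = False" "M = del E' M'" "S = S'" "E = E'" using u 2 False by (auto simp: uncell_def)
      have f: "(q, p) \<notin> S'" using False rook_sym[OF r] by blast
      have n: "(p, Suc q) \<notin> S'" "(Suc p, q) \<notin> S'" using c rook_subset[OF r] unfolding corner_def by auto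
      show ?thesis
      proof (cases e)
        case True
        have m: "M = M' - {(p, q), (q, p)}" using eq 2 True by simp
        have "rook M S" using r False f unfolding eq(3) m rook_def corner_def by blast
        moreover have "addable (M - S) p q"
        proof -
          have "(k, q) \<notin> S'" if "p = Suc k" for k using rook_corner[OF r, of k q] c that unfolding corner_def by auto
          moreover have "(p, k) \<notin> S'" if "q = Suc k" for k using rook_corner[OF r, of p k] c that unfolding corner_def by auto
          ultimately show ?thesis using addable_del[OF y c] unfolding m eq(3) addable_def by blast
        qed
        moreover have "M \<union> {(p, q), (q, p)} = M'" using c corner_sym[OF y c] unfolding m corner_def by blast
        ultimately show ?thesis using eq 2 True young_del[OF y c] m False by (simp add: cell_def)
      next
        case False
        then show ?thesis using eq 2 c n \<open>(p, q) \<notin> S'\<close> r y by (auto simp: cell_def corner_def)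
      qed
    next
      case True
      let ?M = "del E' M'" and ?S = "del E' S'"
      note inv = row_rule_inverse[OF y r True 2]
      have sub: "?M \<subseteq> M'" "?S \<subseteq> S'" using 2 by (auto simp: del_Some split: if_splits)
      have eqF: "?S = S'" "\<not> e" if "(p, q) \<in> ?M" using 2 that by (auto simp: del_Some split: if_splits)
      have lq: "(p, j) \<in> M' \<Longrightarrow> j \<le> q" for j
        using young_len[OF y, of p] corner_len[OF y c] by simp
      show ?thesis
      proof (cases p)
        case 0
        then show ?thesis using u 2 True inv by (auto simp: uncell_def Let_def cell_def)
      next
        case (Suc k)
        have kq: "(k, q) \<in> ?M"
        proof (cases e)
          case t: True
          then show ?thesis using addable_del[OF y c] 2 Suc unfolding addable_def by simp
        next
          case False
          then show ?thesis using 2 Suc c young_mono[OF y, of p q k q] unfolding corner_def by simp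
        qed
        define j where "j = len ?M k - 1"
        have qj: "q \<le> j" "len ?M k = Suc j" using kq young_len[OF inv(1), of k q] j_def by auto
        have kj: "(k, j) \<in> ?M" "(k, Suc j) \<notin> ?M" using qj(2) young_len[OF inv(1), of k] by auto
        note u' = uncell_bump[OF 2[unfolded Suc] True[unfolded Suc] refl refl qj(2)]
        show ?thesis
        proof (cases "(k, j) \<in> ?S")
          case rS: True
          \<comment> \<open>A corner \<open>(k, j)\<close> of \<open>M'\<close> has nothing below
            it, whereas \<open>(Suc k, q)\<close> is present. Hence \<open>j\<close> exceeds
            \<open>q\<close> and the subtraction \<open>j - 1\<close> in \<open>uncell\<close> is
            not truncated.\<close>
          then have "(Suc k, j) \<notin> M'" using sub rook_corner[OF r, of k j] unfolding corner_def by blast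
          then have "j \<noteq> q" using c Suc unfolding corner_def by auto
          then obtain i where i: "j = Suc i" "q \<le> i" using qj(1) by (cases j) auto
          have eq: "X = False" "M = ?M" "S = ?S" "E = Some ((k, i), False)" using u u' rS i by auto
          have ki: "(k, i) \<in> ?M" using young_mono[OF inv(1) kj(1), of k i] i by simp
          have kS: "(k, i) \<notin> ?S" using rook_corner[OF inv(2), of k i] kj(1) i unfolding corner_def by auto
          have "(Suc k, i) \<in> ?S" if "(Suc k, i) \<in> ?M"
          proof -
            have "i = q" using lq[of i] that sub i Suc by auto
            then show ?thesis using eqF that True Suc by auto
          qed
          then have "corner (M - S) k i" using ki kS rS i unfolding eq corner_def by blast
          then show ?thesis using eq inv rS i Suc by (simp add: cell_def)
        next
          case nS: False
          show ?thesis
          proof (cases "(Suc k, j) \<in> ?M")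
            case b: True
            have eq: "X = False" "M = ?M" "S = ?S" "E = Some ((k, j), False)" using u u' nS b by auto
            have "j = q" using lq[of j] b sub Suc qj by auto
            then have "(Suc k, j) \<in> ?S" using eqF b True Suc by auto
            then show ?thesis using eq inv kj nS Suc by (auto simp: cell_def corner_def)
          next
            case nb: False
            let ?T = "?S \<union> {(k, j), (j, k)}"
            have eq: "X = False" "M = ?M" "S = ?T" "E = Some ((k, j), True)" using u u' nS nb by auto
            have cm: "corner ?M k j" using kj nb unfolding corner_def by blast
            have r1: "rook ?M ?T" using inv(2) rook_pair[OF inv(1) cm] unfolding rook_def by blast
            have a: "addable (M - S) k j" using rook_addable[OF inv(1) r1, of k j] eq by simp
            have "?T - {(k, j), (j, k)} = ?S" using nS rook_sym[OF inv(2), of k j] by blast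
            then have "cell X M S E = (M', S', E')" using inv(3) Suc unfolding eq by (simp add: cell_def)
            then show ?thesis using a inv(1) r1 eq by simp
          qed
        qed
      qed
    qed
  qed
  then show ?a ?b ?c ?d ?e by blast+
qed

text \<open>Each edge descends by at most one row, so the order could break only if both lie in row
  \<open>k\<close>, the first stays and the second moves. But row \<open>k\<close> of
  \<open>M' - S'\<close> ends in the box of the first edge, so the box of the second is the same or
  the next one; as the first edge met no \<open>v\<close> there, neither does the second.\<close>

lemma stacked_row_le:
  assumes y: "young M" and r: "rook M S" and ein: "edge_in (M - S) E1" 
    and cell: "cell X M S E1 = (M', S', E1')" and X: "X \<longrightarrow> E1 = None"
    and e2: "edge_in (M' - S') E2" and cell2: "cell False M' S' E2 = (M'', S'', E2')"
    and s: "E1 = Some ((k, j), e)" "E2 = Some ((k2, j2), f)" and le: "k2 \<le> k"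
  shows "\<exists>k j e k2 j2 f. E1' = Some ((k, j), e) \<and> E2' = Some ((k2, j2), f) \<and> k2 \<le> k"
proof -
  note o = cell_out[OF y r ein X cell]
  have F: "False \<longrightarrow> E2 = None" by simp
  have y0: "young (M - S)" using young_diff[OF y r] .
  have c1: "corner (M' - S') k j" using edge_out_app[OF y0 ein] o(4) s(1) by simp
  have y': "young (M' - S')" using young_diff o by blast
  consider "E1' = E1" "S' = S" "(k, j) \<notin> S" "(k, Suc j) \<notin> S" "(Suc k, j) \<notin> S"
    | q e' where "E1' = Some ((Suc k, q), e')" using cell_row(3)[OF y r ein X cell s(1)] by blast
  then show ?thesis
  proof cases
    case 1
    consider "E2' = E2" | q e' where "E2' = Some ((Suc k2, q), e')"
      using cell_row(3)[OF o(1,2) e2 F cell2 s(2)] by blast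
    then show ?thesis
    proof cases
      case 1
      then show ?thesis using s le \<open>E1' = E1\<close> by simp
    next
      case (2 q e')
      have "k2 \<noteq> k"
      proof
        assume [simp]: "k2 = k"
        have n: "(k, j) \<notin> S'" "(k, Suc j) \<notin> S'" "(Suc k, j) \<notin> S'" using 1 by auto
        show False
        proof (cases f)
          case True
          then have "addable (M' - S') k j2" using e2 s by simp
          then have "j2 = len (M' - S') k" unfolding addable_def by (intro len_eqI[OF y', symmetric]) auto
          then have "j2 = Suc j" using corner_len[OF y' c1] by simp
          then have "cell False M' S' E2 = (M' \<union> {(k, j2), (j2, k)}, S', E2)" using n s True by (simp add: cell_def)
          then show False using cell2 2 s by simp
        next
          case False
          then have "corner (M' - S') k j2" using e2 s by simp
          then have "j2 = j" using corner_len[OF y'] c1 by (metis nat.inject)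
          then have "cell False M' S' E2 = (M', S', E2)" using n s False by (simp add: cell_def)
          then show False using cell2 2 s by simp
        qed
      qed
      then show ?thesis using 1 2 s le by simp
    qed
  next
    case (2 q e')
    then show ?thesis using cell_row(3)[OF o(1,2) e2 F cell2 s(2)] s le by fastforce
  qed
qed

text \<open>Without \<open>S\<close>, row \<open>k\<close> ends just before its box with
  \<open>v\<close>. An edge in row \<open>k\<close> is therefore this box or its left neighbour, and
  it meets \<open>v\<close>.\<close>

lemma row_move:
  assumes y: "young M" and r: "rook M S" and q: "(k, q) \<in> S"
    and e2: "edge_in (M - S) E2" and cell2: "cell False M S E2 = (M'', S'', E2')"
    and s: "E2 = Some ((k, j2), f)"
  shows "\<exists>j2 f. E2' = Some ((Suc k, j2), f)"
proof -
  have F: "False \<longrightarrow> E2 = None" by simp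
  have y': "young (M - S)" using young_diff y r by blast
  have a: "addable (M - S) k q" using rook_addable[OF y r q] .
  then have l: "len (M - S) k = q" unfolding addable_def by (intro len_eqI[OF y']) auto
  show ?thesis
  proof (cases f)
    case True
    then have "addable (M - S) k j2" using e2 s by simp
    then have "j2 = len (M - S) k" unfolding addable_def by (intro len_eqI[OF y', symmetric]) auto
    then have "(k, j2) \<in> S" using l q by simp
    then show ?thesis using cell_row(3)[OF y r e2 F cell2 s] by blast
  next
    case False
    then have "corner (M - S) k j2" using e2 s by simp
    then have "q = Suc j2" using corner_len[OF y'] l by simp
    then have "(k, Suc j2) \<in> S" using l q by simp
    then show ?thesis using cell_row(3)[OF y r e2 F cell2 s] by blast
  qed
qed

text \<open>The first edge can catch up only by entering the row of the second; but then it leaves a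
  \<open>v\<close> there, and \<open>row_move\<close> pushes the second edge down as well. The case
  \<open>X\<close>, where the first edge starts in row 0, is of the same kind.\<close>

lemma stacked_row_gt:
  assumes y: "young M" and r: "rook M S" and ein: "edge_in (M - S) E1" 
    and cell: "cell X M S E1 = (M', S', E1')" and X: "X \<longrightarrow> E1 = None"
    and e2: "edge_in (M' - S') E2" and cell2: "cell False M' S' E2 = (M'', S'', E2')"
    and s: "E2 = Some ((k2, j2), f)" and X0: "X \<or> (\<exists>k j e. E1 = Some ((k, j), e) \<and> k < k2)"
  shows "\<exists>k j e k2 j2 f. E1' = Some ((k, j), e) \<and> E2' = Some ((k2, j2), f) \<and> k < k2"
proof -
  note o = cell_out[OF y r ein X cell]
  have F: "False \<longrightarrow> E2 = None" by simp
  have c2: "E2' = E2 \<or> (\<exists>q e. E2' = Some ((Suc k2, q), e))"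
    using cell_row(3)[OF o(1,2) e2 F cell2 s] by blast
  then obtain k3 j3 f3 where e3: "E2' = Some ((k3, j3), f3)" "k2 \<le> k3" using s by auto
  have key: ?thesis if k: "E1' = Some ((k, q), e)" "(k, q) \<in> S'" "k \<le> k2" for k q e
  proof (cases "k = k2")
    case True
    then show ?thesis using row_move[OF o(1,2) that(2) e2 cell2, of j2 f] s k(1) by auto
  next
    case False
    then show ?thesis using k e3 by auto
  qed
  show ?thesis
  proof (cases X)
    case True
    then show ?thesis using cell_row(2)[OF y r ein X cell True] key by blast
  next
    case False
    then obtain k j e where 1: "E1 = Some ((k, j), e)" "k < k2" using X0 by blast
    then show ?thesis using cell_row(3)[OF y r ein X cell 1(1)] key[of "Suc k"] e3 by auto
  qed
qed

section \<open>Doubled tableaux and growth\<close>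

definition entry :: "itab \<Rightarrow> nat \<Rightarrow> nat \<Rightarrow> nat option" where
  "entry T i j = T (min i j, max i j)"

definition below :: "itab \<Rightarrow> nat \<Rightarrow> diagram" where
  "below T v = {(i, j). \<exists>u\<le>v. entry T i j = Some u}"

definition level :: "itab \<Rightarrow> nat \<Rightarrow> diagram" where
  "level T v = {(i, j). entry T i j = Some v}"

definition shape :: "itab \<Rightarrow> diagram" where
  "shape T = {(i, j). entry T i j \<noteq> None}"

text \<open>Demanding a smaller left neighbour for each entry outside column 0 encodes the increase
  along rows together with the shape; columns are covered by the symmetry of
  \<open>entry\<close>.\<close>

definition sym_inc :: "itab \<Rightarrow> bool" where
  "sym_inc T \<longleftrightarrow> (\<forall>i j. T (i, j) \<noteq> None \<longrightarrow> i \<le> j) \<and> finite (dom T) \<and> (\<forall>v\<in>ran T. 1 \<le> v) \<and>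
     (\<forall>i j v. entry T i (Suc j) = Some v \<longrightarrow> (\<exists>u<v. entry T i j = Some u))"

lemma entry_commute: "entry T i j = entry T j i"
  by (simp add: entry_def min.commute max.commute)

lemma in_below: "(i, j) \<in> below T v \<longleftrightarrow> (\<exists>u\<le>v. entry T i j = Some u)" by (simp add: below_def)

lemma in_level: "(i, j) \<in> level T v \<longleftrightarrow> entry T i j = Some v" by (simp add: level_def)

lemma in_shape: "(i, j) \<in> shape T \<longleftrightarrow> (\<exists>u. entry T i j = Some u)" by (auto simp add: shape_def)

lemma sym_inc_left: "sym_inc T \<Longrightarrow> entry T i (Suc j) = Some v \<Longrightarrow> \<exists>u<v. entry T i j = Some u"
  unfolding sym_inc_def by blast

lemma sym_inc_up: "sym_inc T \<Longrightarrow> entry T (Suc i) j = Some v \<Longrightarrow> \<exists>u<v. entry T i j = Some u"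
  using sym_inc_left by (metis entry_commute)

lemma sym_inc_pos: "sym_inc T \<Longrightarrow> entry T i j = Some v \<Longrightarrow> 1 \<le> v"
  unfolding sym_inc_def entry_def by (metis ranI)

lemma finite_shape: assumes "sym_inc T" shows "finite (shape T)"
proof -
  have "shape T \<subseteq> dom T \<union> prod.swap ` dom T"
    by (auto simp: shape_def entry_def min_def max_def split: if_splits)
  then show ?thesis using assms unfolding sym_inc_def by (meson finite_Un finite_imageI finite_subset)
qed

lemma below_subset_shape: "below T v \<subseteq> shape T"
  by (auto simp: below_def shape_def)

lemma young_below: assumes "sym_inc T" shows "young (below T v)"
proof (rule youngI)
  show "finite (below T v)" using finite_shape[OF assms] below_subset_shape finite_subset by blast
  show "(i, j) \<in> below T v \<Longrightarrow> (j, i) \<in> below T v" for i j by (simp add: in_below entry_commute[of T j i])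
  show "(i, Suc j) \<in> below T v \<Longrightarrow> (i, j) \<in> below T v" for i j
    using sym_inc_left[OF assms] unfolding in_below by (metis le_trans less_imp_le)
qed

lemma young_shape: assumes "sym_inc T" shows "young (shape T)"
proof (rule youngI)
  show "finite (shape T)" using finite_shape[OF assms] .
  show "(i, j) \<in> shape T \<Longrightarrow> (j, i) \<in> shape T" for i j by (simp add: in_shape entry_commute[of T j i])
  show "(i, Suc j) \<in> shape T \<Longrightarrow> (i, j) \<in> shape T" for i j
    using sym_inc_left[OF assms] unfolding in_shape by blast
qed

lemma rook_level: assumes "sym_inc T" shows "rook (below T v) (level T v)"
  unfolding rook_def
proof (intro allI impI conjI)
  fix i j assume *: "(i, j) \<in> level T v"
  then show "(j, i) \<in> level T v" by (simp add: in_level entry_commute[of T j i])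
  have "(i, Suc j) \<notin> below T v" "(Suc i, j) \<notin> below T v"
    using * sym_inc_left[OF assms, of i j] sym_inc_up[OF assms, of i j] unfolding in_below in_level by fastforce+
  then show "corner (below T v) i j" using * by (auto simp: corner_def in_below in_level)
qed

lemma below_Suc: "below T (Suc v) - level T (Suc v) = below T v"
  by (auto simp: below_def level_def le_Suc_eq)

lemma level_below: "level T v \<subseteq> below T v"
  by (auto simp: below_def level_def)

lemma below_0: "sym_inc T \<Longrightarrow> below T 0 = {}"
  using sym_inc_pos by (fastforce simp: below_def)

lemma level_0: "sym_inc T \<Longrightarrow> level T 0 = {}"
  using sym_inc_pos by (fastforce simp: level_def)

lemma below_bound: assumes "sym_inc T" obtains V where "\<And>v. V \<le> v \<Longrightarrow> below T v = shape T" "\<And>v. V < v \<Longrightarrow> level T v = {}"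
proof -
  have f: "finite ((\<lambda>(i, j). the (entry T i j)) ` shape T)" using finite_shape[OF assms] by simp
  define V where "V = Max (insert 0 ((\<lambda>(i, j). the (entry T i j)) ` shape T))"
  have b: "u \<le> V" if "entry T i j = Some u" for i j u
  proof -
    have "(i, j) \<in> shape T" using that in_shape by blast
    then have "u \<in> (\<lambda>(i, j). the (entry T i j)) ` shape T" using that by (force simp: image_iff)
    then show ?thesis unfolding V_def using f by (intro Max_ge) auto
  qed
  have "below T v = shape T" if "V \<le> v" for v
  proof -
    have "u \<le> v" if "entry T i j = Some u" for i j u using b[OF that] \<open>V \<le> v\<close> by simp
    then show ?thesis by (auto simp: below_def shape_def)
  qed
  moreover have "level T v = {}" if "V < v" for v
    using b that by (fastforce simp: level_def)
  ultimately show ?thesis using that by blast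
qed

lemma tab_eqI: assumes "sym_inc T1" "sym_inc T2" "\<And>v. level T1 (Suc v) = level T2 (Suc v)" shows "T1 = T2"
proof
  fix b :: "nat \<times> nat"
  obtain i j where b: "b = (i, j)" by fastforce
  have "level T1 v = level T2 v" for v using assms level_0 by (cases v) auto
  then have "entry T1 i j = Some v \<longleftrightarrow> entry T2 i j = Some v" for v using in_level by blast
  then have e: "entry T1 i j = entry T2 i j" by (metis option.exhaust)
  show "T1 b = T2 b"
  proof (cases "i \<le> j")
    case True
    then show ?thesis using e b by (simp add: entry_def min_def max_def)
  next
    case False
    then have "T1 b = None" "T2 b = None" using assms b unfolding sym_inc_def by metis+
    then show ?thesis by simp
  qed
qed

section \<open>Chains of local rules, their determinism and their reversal\<close>

definition chain :: "itab \<Rightarrow> nat \<Rightarrow> itab \<Rightarrow> (nat \<Rightarrow> edge) \<Rightarrow> bool" where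
  "chain T x T' E \<longleftrightarrow> E 0 = None \<and> (\<forall>v. cell (Suc v = x) (below T (Suc v)) (level T (Suc v)) (E v) =
     (below T' (Suc v), level T' (Suc v), E (Suc v)))"

text \<open>Edges become constant above the largest entry; the stable value is the terminating
  corner of the whole insertion with its bit.\<close>

definition growth :: "itab \<Rightarrow> nat \<Rightarrow> itab \<Rightarrow> (nat \<times> nat) \<times> bool \<Rightarrow> bool" where
  "growth T x T' \<beta> \<longleftrightarrow> (\<exists>E. chain T x T' E \<and> (\<exists>V. \<forall>v\<ge>V. E v = Some \<beta>))"

lemma del_app: assumes "young M" "edge_in M E" shows "del E (app E M) = M"
proof (cases E rule: edge_cases)
  case (2 k j e)
  then show ?thesis using assms addable_sym[OF assms(1), of k j] by (cases e) (auto simp: addable_def)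
qed simp

text \<open>The edge at level \<open>v\<close> records exactly how the diagram of entries at most
  \<open>v\<close> changes, which makes it an admissible input for the next cell.\<close>

lemma chain_facts:
  assumes T: "sym_inc T" and x: "1 \<le> x" and c: "chain T x T' E"
  shows "edge_in (below T v) (E v)" "edge_out (below T' v) (E v)" "below T' v = app (E v) (below T v)"
    "E v = None \<longleftrightarrow> v < x" "Suc v = x \<longrightarrow> E v = None" "young (below T' v)"
    "cell (Suc v = x) (below T (Suc v)) (level T (Suc v)) (E v) =
     (below T' (Suc v), level T' (Suc v), E (Suc v))"
proof -
  have c0: "E 0 = None" and cell: "\<And>v. cell (Suc v = x) (below T (Suc v)) (level T (Suc v)) (E v) =
     (below T' (Suc v), level T' (Suc v), E (Suc v))" using c unfolding chain_def by auto
  have main: "edge_in (below T v) (E v) \<and> edge_out (below T' v) (E v) \<and> (E v = None \<longleftrightarrow> v < x) \<and> below T' v = app (E v) (below T v)" for v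
  proof (induction v)
    case 0
    have "below T' 0 = app None (below T 0)"
      using cell_out(4)[OF young_below[OF T] rook_level[OF T] _ _ cell[of 0]] c0
      unfolding below_Suc by simp
    then show ?case using x c0 by simp
  next
    case (Suc v)
    note y = young_below[OF T, of "Suc v"] and r = rook_level[OF T, of "Suc v"]
    have i: "edge_in (below T (Suc v) - level T (Suc v)) (E v)" using Suc below_Suc by simp
    have X: "Suc v = x \<longrightarrow> E v = None" using Suc by auto
    note o = cell_out[OF y r i X cell]
    have i1: "edge_in (below T (Suc v)) (E (Suc v))" using edge_in_del[OF o(1,3)] o(5) by simp
    moreover have "E (Suc v) = None \<longleftrightarrow> Suc v < x"
    proof (cases "E v" rule: edge_cases)
      case 1
      then show ?thesis using cell_row(1,2)[OF y r i X cell] Suc by (metis Suc_lessI option.distinct(1) less_irrefl)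
    next
      case (2 k j e)
      then show ?thesis using cell_row(3)[OF y r i X cell 2] Suc by auto
    qed
    \<comment> \<open>Read off from the cell one level higher, whose diagrams become those of level
      \<open>Suc v\<close> when the boxes with the next value are removed.\<close>
    moreover have "below T' (Suc v) = app (E (Suc v)) (below T (Suc v))"
    proof -
      have X': "Suc (Suc v) = x \<longrightarrow> E (Suc v) = None" using calculation(2) by auto
      have "edge_in (below T (Suc (Suc v)) - level T (Suc (Suc v))) (E (Suc v))" using i1 below_Suc by simp
      then show ?thesis
        using cell_out(4)[OF young_below[OF T] rook_level[OF T] _ X' cell[of "Suc v"]]
        unfolding below_Suc by simp
    qed
    ultimately show ?case using o by blast
  qed
  then show "edge_in (below T v) (E v)" "edge_out (below T' v) (E v)" "below T' v = app (E v) (below T v)"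
    "E v = None \<longleftrightarrow> v < x" "Suc v = x \<longrightarrow> E v = None"
    using main[of v] by (blast, blast, blast, blast, simp)
  show "cell (Suc v = x) (below T (Suc v)) (level T (Suc v)) (E v) =
     (below T' (Suc v), level T' (Suc v), E (Suc v))" by (rule cell)
  show "young (below T' v)"
  proof (cases v)
    case 0
    have "below T' 0 = {}" using main[of 0] c0 below_0[OF T] by simp
    then show ?thesis using 0 by (simp add: young_def)
  next
    case (Suc u)
    have "edge_in (below T (Suc u) - level T (Suc u)) (E u)" "Suc u = x \<longrightarrow> E u = None"
      using main[of u] below_Suc by auto
    then show ?thesis using cell_out(1)[OF young_below[OF T] rook_level[OF T] _ _ cell[of u]] Suc by blast
  qed
qed

lemma growth_unique:
  assumes "growth T x T1 \<beta>1" "growth T x T2 \<beta>2" "sym_inc T1" "sym_inc T2"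
  shows "T1 = T2" "\<beta>1 = \<beta>2"
proof -
  obtain e1 V1 where 1: "chain T x T1 e1" "\<And>v. v \<ge> V1 \<Longrightarrow> e1 v = Some \<beta>1" using assms(1) unfolding growth_def by blast
  obtain e2 V2 where 2: "chain T x T2 e2" "\<And>v. v \<ge> V2 \<Longrightarrow> e2 v = Some \<beta>2" using assms(2) unfolding growth_def by blast
  have e: "e1 v = e2 v" for v
  proof (induction v)
    case 0
    then show ?case using 1(1) 2(1) by (simp add: chain_def)
  next
    case (Suc v)
    then show ?case using 1(1) 2(1) unfolding chain_def by (metis prod.inject)
  qed
  then have "level T1 (Suc v) = level T2 (Suc v)" for v
    using 1(1) 2(1) unfolding chain_def by (metis prod.inject)
  then show "T1 = T2" using tab_eqI assms(3,4) by blast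
  show "\<beta>1 = \<beta>2" using 1(2)[of "max V1 V2"] 2(2)[of "max V1 V2"] e by simp
qed

text \<open>\<open>uncell\<close> runs both chains downwards from a level where the edges have
  become \<open>\<beta>\<close>. The output side \<open>T'\<close> is common, so all cells agree,
  and the component \<open>Suc v = x\<close> identifies the letter.\<close>

lemma growth_inj:
  assumes "growth T1 x1 T' \<beta>" "growth T2 x2 T' \<beta>" "sym_inc T1" "sym_inc T2" "1 \<le> x1" "1 \<le> x2"
  shows "T1 = T2" "x1 = x2"
proof -
  obtain e1 V1 where 1: "chain T1 x1 T' e1" "\<And>v. v \<ge> V1 \<Longrightarrow> e1 v = Some \<beta>" using assms(1) unfolding growth_def by blast
  obtain e2 V2 where 2: "chain T2 x2 T' e2" "\<And>v. v \<ge> V2 \<Longrightarrow> e2 v = Some \<beta>" using assms(2) unfolding growth_def by blast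
  have u: "uncell (below T' (Suc v)) (level T' (Suc v)) (e (Suc v)) = (Suc v = x, below T (Suc v), level T (Suc v), e v)"
    if "chain T x T' e" "sym_inc T" "1 \<le> x" for T x e v
    using chain_facts[OF that(2,3,1), of v] uncell_cell[OF young_below[OF that(2)] rook_level[OF that(2)]]
    by (simp add: below_Suc)
  note u1 = u[OF 1(1) assms(3,5)] and u2 = u[OF 2(1) assms(4,6)]
  have e: "e1 v = e2 v" if "v \<le> max V1 V2" for v
    using that
  proof (induction v rule: inc_induct)
    case base
    then show ?case using 1(2) 2(2) by simp
  next
    case (step n)
    then show ?case using u1[of n] u2[of n] by simp
  qed
  have e: "e1 v = e2 v" for v using e 1(2) 2(2) by (cases "v \<le> max V1 V2") auto
  then have q: "(Suc v = x1, below T1 (Suc v), level T1 (Suc v), e1 v) = (Suc v = x2, below T2 (Suc v), level T2 (Suc v), e2 v)" for v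
    using u1[of v] u2[of v] by simp
  then show "T1 = T2" using tab_eqI assms(3,4) by blast
  show "x1 = x2" using q[of "x1 - 1"] assms(5) by simp
qed

fun unstep :: "edge \<Rightarrow> itab \<Rightarrow> nat \<Rightarrow> edge" where
  "unstep E T v = snd (snd (snd (uncell (below T v) (level T v) E)))"

text \<open>Starting with the prescribed mark above all entries of \<open>T'\<close>,
  \<open>uncell\<close> is iterated down to level 0. The diagrams \<open>M v\<close> obtained are
  nested, and \<open>T\<close> is the tableau whose entries at most \<open>v\<close> fill
  \<open>M v\<close>.\<close>

lemma growth_surj:
  assumes T': "sym_inc T'" and c: "corner (shape T') p q"
  obtains T x where "sym_inc T" "1 \<le> x" "growth T x T' ((p, q), e)" "shape T = del (Some ((p, q), e)) (shape T')"
proof -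
  define \<beta> where "\<beta> = ((p, q), e)"
  obtain V where V: "\<And>v. V \<le> v \<Longrightarrow> below T' v = shape T'" "\<And>v. V < v \<Longrightarrow> level T' v = {}"
    using below_bound[OF T'] by blast
  \<comment> \<open>\<open>f n\<close> is the edge at level \<open>V - n\<close>. In
    \<open>E\<close> the truncated subtraction gives the prescribed mark at all levels from
    \<open>V\<close> on.\<close>
  define f where "f n = rec_nat (Some \<beta>) (\<lambda>n E. unstep E T' (V - n)) n" for n
  define E where "E v = f (V - v)" for v
  have f0: "f 0 = Some \<beta>" and fS: "f (Suc n) = unstep (f n) T' (V - n)" for n by (simp_all add: f_def)
  have eV: "E v = Some \<beta>" if "V \<le> v" for v using that f0 by (simp add: E_def)
  have eS: "E v = unstep (E (Suc v)) T' (Suc v)" if "v < V" for v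
    using that fS[of "V - Suc v"] unfolding E_def by (simp add: Suc_diff_Suc)
  \<comment> \<open>Above \<open>V\<close> the level sets of \<open>T'\<close> are empty, so
    \<open>uncell\<close> keeps the edge and the recursion holds at every level.\<close>
  have eS': "E v = unstep (E (Suc v)) T' (Suc v)" for v
    using eS[of v] eV V(2)[of "Suc v"] by (cases "v < V") (simp_all add: \<beta>_def uncell_def)
  define M where "M v = del (E v) (below T' v)" for v
  define X where "X v = fst (uncell (below T' (Suc v)) (level T' (Suc v)) (E (Suc v)))" for v
  define S where "S v = fst (snd (snd (uncell (below T' v) (level T' v) (E v))))" for v
  have step: "edge_out (below T' v) (E v) \<and> M (Suc v) - S (Suc v) = M v \<and> rook (M (Suc v)) (S (Suc v)) \<and>
     edge_in (M (Suc v) - S (Suc v)) (E v) \<and> (X v \<longrightarrow> E v = None) \<and> young (M (Suc v)) \<and>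
     cell (X v) (M (Suc v)) (S (Suc v)) (E v) = (below T' (Suc v), level T' (Suc v), E (Suc v))"
    if o: "edge_out (below T' (Suc v)) (E (Suc v))" for v
  proof -
    obtain N where u: "uncell (below T' (Suc v)) (level T' (Suc v)) (E (Suc v)) = (X v, N, S (Suc v), E v)"
      unfolding X_def S_def eS'[of v] unstep.simps by (metis prod.collapse)
    note cu = cell_uncell[OF young_below[OF T'] rook_level[OF T'] o u]
    note co = cell_out[OF cu(1-5)]
    have N: "N = M (Suc v)" using co(5) M_def by simp
    have y: "young (N - S (Suc v))" using young_diff cu by blast
    have a: "below T' v = app (E v) (N - S (Suc v))" using co(4) below_Suc by simp
    then have "M v = N - S (Suc v)" using del_app[OF y cu(3)] unfolding M_def by simp
    then show ?thesis using edge_out_app[OF y cu(3)] a cu unfolding N by simp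
  qed
  have out: "edge_out (below T' v) (E v)" for v
  proof (cases "V \<le> v")
    case True
    then show ?thesis using eV V(1) c by (simp add: \<beta>_def)
  next
    case False
    then have "v \<le> V" by simp
    then show ?thesis
    proof (induction rule: inc_induct)
      case base
      then show ?case using eV V(1) c by (simp add: \<beta>_def)
    qed (use step in blast)
  qed
  note step = step[OF out]
  have b0: "below T' 0 = {}" using below_0[OF T'] .
  \<comment> \<open>An edge needs a corner of the diagram after the insertion, and this diagram is
    empty at level 0; so a letter must have been met on the way down.\<close>
  have e0: "E 0 = None"
    using out[of 0] b0 by (cases "E 0" rule: edge_cases) (auto simp: corner_def)
  have m0: "M 0 = {}" using b0 by (simp add: M_def e0)
  have ym: "young (M v)" for v using young_del_edge[OF young_below[OF T'] out] by (simp add: M_def)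
  have mono: "M v \<subseteq> M (Suc v)" for v using step[of v] by blast
  have monole: "u \<le> v \<Longrightarrow> M u \<subseteq> M v" for u v by (rule lift_Suc_mono_le[of M]) (rule mono)
  have SS: "S (Suc v) = M (Suc v) - M v" for v using step[of v] rook_subset[of "M (Suc v)" "S (Suc v)"] by blast
  have mV: "M v = del (Some \<beta>) (shape T')" if "V \<le> v" for v using eV V(1) that by (simp add: M_def)
  define T where "T b = (if fst b \<le> snd b \<and> (\<exists>v. b \<in> M v) then Some (LEAST v. b \<in> M v) else None)" for b
  have syT: "entry T i j = (if \<exists>v. (i, j) \<in> M v then Some (LEAST v. (i, j) \<in> M v) else None)" for i j
  proof -
    have "(min i j, max i j) \<in> M v \<longleftrightarrow> (i, j) \<in> M v" for v
      using young_swap[OF ym, of i j] by (simp add: min_def max_def)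
    moreover have "min i j \<le> max i j" by simp
    ultimately show ?thesis by (simp add: entry_def T_def)
  qed
  have bT: "below T v = M v" for v
  proof -
    have "(i, j) \<in> below T v \<longleftrightarrow> (i, j) \<in> M v" for i j
    proof
      assume "(i, j) \<in> below T v"
      then obtain u where "u \<le> v" "entry T i j = Some u" by (auto simp: in_below)
      then have "\<exists>v. (i, j) \<in> M v" "u = (LEAST v. (i, j) \<in> M v)" using syT by (auto split: if_splits)
      then have "(i, j) \<in> M u" by (metis LeastI)
      then show "(i, j) \<in> M v" using monole \<open>u \<le> v\<close> by blast
    next
      assume "(i, j) \<in> M v"
      then show "(i, j) \<in> below T v" by (auto simp: in_below syT intro: Least_le)
    qed
    then show ?thesis by auto
  qed
  have lT: "level T (Suc v) = S (Suc v)" for v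
    using below_Suc[of T v] level_below[of T "Suc v"] unfolding bT SS[of v] by blast
  have sh: "shape T = del (Some \<beta>) (shape T')"
  proof -
    have "(i, j) \<in> shape T \<longleftrightarrow> (i, j) \<in> M V" for i j
    proof -
      have "(i, j) \<in> shape T \<longleftrightarrow> (\<exists>v. (i, j) \<in> M v)" by (auto simp: in_shape syT)
      also have "\<dots> \<longleftrightarrow> (i, j) \<in> M V" using monole mV by (metis nat_le_linear subsetD)
      finally show ?thesis .
    qed
    then show ?thesis using mV by auto
  qed
  have "sym_inc T"
    unfolding sym_inc_def
  proof (intro conjI allI impI ballI)
    show "T (i, j) \<noteq> None \<Longrightarrow> i \<le> j" for i j by (auto simp: T_def split: if_splits)
    have "dom T \<subseteq> shape T" by (auto simp: T_def shape_def entry_def split: if_splits)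
    moreover have "finite (shape T)" using sh young_finite[OF young_shape[OF T']] by (simp add: \<beta>_def del_Some)
    ultimately show "finite (dom T)" using finite_subset by blast
  next
    fix v assume "v \<in> ran T"
    then obtain b u where "b \<in> M u" "v = (LEAST v. b \<in> M v)" by (auto simp: ran_def T_def split: if_splits)
    then have "b \<in> M v" by (metis LeastI)
    then show "1 \<le> v" using m0 by (cases v) auto
  next
    fix i j v assume "entry T i (Suc j) = Some v"
    then have l: "(i, Suc j) \<in> level T v" by (simp add: in_level)
    have "v \<noteq> 0" using l level_below[of T 0] bT[of 0] m0 by (metis empty_iff subsetD)
    then obtain u where u: "v = Suc u" by (cases v) auto
    have m: "(i, Suc j) \<in> M v" using l level_below bT by blast
    then have "(i, j) \<in> M v" using young_mono[OF ym, of i "Suc j" v i j] by simp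
    moreover have "(i, j) \<notin> S v" using step[of u] rook_corner[of "M (Suc u)" "S (Suc u)" i j] m u unfolding corner_def by blast
    ultimately have "(i, j) \<in> below T u" using SS[of u] u bT by blast
    then show "\<exists>u<v. entry T i j = Some u" using u by (auto simp: in_below le_imp_less_Suc)
  qed
  have per: "E (Suc v) \<noteq> None" if nn: "E v \<noteq> None" for v
  proof -
    obtain k j e where s: "E v = Some ((k, j), e)" using nn by (cases "E v" rule: edge_cases) auto
    show ?thesis using cell_row(3)[of "M (Suc v)" "S (Suc v)" "E v" "X v", OF _ _ _ _ _ s] step[of v] s by fastforce
  qed
  \<comment> \<open>\<open>X v\<close> holds just where the edge comes into existence. As edges
    persist upwards by \<open>per\<close>, this happens only once, and \<open>x\<close> will be that
    level.\<close>
  have XI: "X v \<longleftrightarrow> E v = None \<and> E (Suc v) \<noteq> None" for v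
  proof
    assume x: "X v"
    then show "E v = None \<and> E (Suc v) \<noteq> None"
      using cell_row(2)[of "M (Suc v)" "S (Suc v)" "E v" "X v"] step[of v] by fastforce
  next
    assume "E v = None \<and> E (Suc v) \<noteq> None"
    then show "X v"
      using cell_row(1)[of "M (Suc v)" "S (Suc v)" "E v" "X v"] step[of v] by fastforce
  qed
  define x where "x = (LEAST v. E v \<noteq> None)"
  have ex: "\<exists>v. E v \<noteq> None" using eV by blast
  then have x1: "E x \<noteq> None" unfolding x_def by (rule LeastI_ex)
  have x2: "v < x \<Longrightarrow> E v = None" for v unfolding x_def using not_less_Least by blast
  have x3: "x \<le> v \<Longrightarrow> E v \<noteq> None" for v
    by (induction rule: dec_induct) (use x1 per in auto)
  have Xx: "X v \<longleftrightarrow> Suc v = x" for v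
    using XI[of v] x2[of v] x3[of v] x2[of "Suc v"] x3[of "Suc v"] by linarith
  have "1 \<le> x" using x1 e0 by (cases x) auto
  have "chain T x T' E" unfolding chain_def using e0 step by (simp add: bT lT flip: Xx)
  then have "growth T x T' \<beta>" unfolding growth_def using eV by blast
  then show ?thesis using that \<open>sym_inc T\<close> \<open>1 \<le> x\<close> sh \<beta>_def by blast
qed

section \<open>Insertion into the doubled tableau\<close>

lemma entry_mono:
  assumes T: "sym_inc T" and s: "entry T i j = Some v" and le: "i' \<le> i" "j' \<le> j"
  shows "\<exists>u\<le>v. entry T i' j' = Some u \<and> ((i', j') \<noteq> (i, j) \<longrightarrow> u < v)"
proof -
  have row: "\<exists>u\<le>v. entry T i j' = Some u \<and> (j' \<noteq> j \<longrightarrow> u < v)" if "entry T i j = Some v" "j' \<le> j" for i j v j'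
    using that(2,1)
  proof (induction j arbitrary: v rule: dec_induct)
    case (step n)
    obtain w where "w < v" "entry T i n = Some w" using sym_inc_left[OF T step.prems] by blast
    then show ?case using step.IH[of w] step.hyps by fastforce
  qed simp
  obtain u where u: "u \<le> v" "entry T i j' = Some u" "j' \<noteq> j \<longrightarrow> u < v" using row[OF s le(2)] by blast
  then have "entry T j' i = Some u" by (simp add: entry_commute)
  from row[OF this le(1)] obtain w where w: "w \<le> u" "entry T j' i' = Some w" "i' \<noteq> i \<longrightarrow> w < u" by blast
  have "entry T i' j' = Some w" using w(2) by (simp add: entry_commute)
  moreover have "w \<le> v" using u w by simp
  moreover have "(i', j') \<noteq> (i, j) \<longrightarrow> w < v" using u(1,3) w(1,3) by auto
  ultimately show ?thesis by blast
qed

lemma entry_upd: "entry (T((min k l, max k l) \<mapsto> x)) i j = (if (i = k \<and> j = l) \<or> (i = l \<and> j = k) then Some x else entry T i j)"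
proof -
  have "(min i j, max i j) = (min k l, max k l) \<longleftrightarrow> (i = k \<and> j = l) \<or> (i = l \<and> j = k)"
    by (cases "i \<le> j"; cases "k \<le> l") (auto simp: min_absorb1 min_absorb2 max_absorb1 max_absorb2)
  then show ?thesis by (simp only: entry_def fun_upd_apply)
qed

text \<open>As \<open>x\<close> is smaller than the old entry, or the box was empty, the comparisons
  with the right and lower neighbours are automatic or void; only the left and upper ones
  remain.\<close>

lemma sym_inc_upd:
  assumes T: "sym_inc T" and x: "1 \<le> x" and b: "\<And>y. entry T k l = Some y \<Longrightarrow> x < y"
  shows "sym_inc (T((min k l, max k l) \<mapsto> x)) \<longleftrightarrow>
    (\<forall>k'. k = Suc k' \<longrightarrow> (\<exists>u<x. entry T k' l = Some u)) \<and> (\<forall>l'. l = Suc l' \<longrightarrow> (\<exists>u<x. entry T k l' = Some u))"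
    (is "sym_inc ?T \<longleftrightarrow> ?R")
proof
  assume s: "sym_inc ?T"
  define U where "U = ?T"
  have sU: "sym_inc U" using s U_def by simp
  have syU: "entry U i j = (if (i = k \<and> j = l) \<or> (i = l \<and> j = k) then Some x else entry T i j)" for i j
    unfolding U_def by (rule entry_upd)
  have x': "entry U k l = Some x" unfolding syU by simp
  have "\<exists>u<x. entry T k' l = Some u" if k: "k = Suc k'" for k'
  proof -
    have "\<not> ((k' = k \<and> l = l) \<or> (k' = l \<and> l = k))" using k by linarith
    then have "entry U k' l = entry T k' l" unfolding syU by (rule if_not_P)
    then show ?thesis using sym_inc_up[OF sU, of k' l x] x' k by simp
  qed
  moreover have "\<exists>u<x. entry T k l' = Some u" if l: "l = Suc l'" for l'
  proof -
    have "\<not> ((k = k \<and> l' = l) \<or> (k = l \<and> l' = k))" using l by linarith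
    then have "entry U k l' = entry T k l'" unfolding syU by (rule if_not_P)
    then show ?thesis using sym_inc_left[OF sU, of k l' x] x' l by simp
  qed
  ultimately show ?R by blast
next
  assume R: ?R
  define U where "U = ?T"
  have syU: "entry U i j = (if (i = k \<and> j = l) \<or> (i = l \<and> j = k) then Some x else entry T i j)" for i j
    unfolding U_def by (rule entry_upd)
  have "sym_inc U"
    unfolding sym_inc_def
  proof (intro conjI allI impI ballI)
    show "U (i, j) \<noteq> None \<Longrightarrow> i \<le> j" for i j using T unfolding sym_inc_def U_def by (auto split: if_splits)
    show "finite (dom U)" using T unfolding sym_inc_def U_def by simp
    show "1 \<le> v" if "v \<in> ran U" for v
    proof -
      have "v = x \<or> v \<in> ran T" using that unfolding U_def ran_def by (auto split: if_splits)
      then show ?thesis using T x unfolding sym_inc_def by blast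
    qed
    fix i j v assume s: "entry U i (Suc j) = Some v"
    have kl: "entry T l k = entry T k l" by (rule entry_commute)
    show "\<exists>u<v. entry U i j = Some u"
    proof (cases "(i = k \<and> Suc j = l) \<or> (i = l \<and> Suc j = k)")
      case True
      then show ?thesis
      proof
        assume a: "i = k \<and> Suc j = l"
        then have "v = x" using s unfolding syU by (metis option.inject)
        moreover have "\<exists>u<x. entry T i j = Some u" using R a by auto
        moreover have "entry U i j = entry T i j"
        proof -
          have "\<not> ((i = k \<and> j = l) \<or> (i = l \<and> j = k))" using a by linarith
          then show ?thesis unfolding syU by (rule if_not_P)
        qed
        ultimately show ?thesis by simp
      next
        assume a: "i = l \<and> Suc j = k"
        then have "v = x" using s unfolding syU by (metis option.inject)
        moreover have "\<exists>u<x. entry T j i = Some u" using R a by auto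
        moreover have "entry U i j = entry T j i"
        proof -
          have "\<not> ((i = k \<and> j = l) \<or> (i = l \<and> j = k))" using a by linarith
          then have "entry U i j = entry T i j" unfolding syU by (rule if_not_P)
          then show ?thesis by (simp only: entry_commute[of T i j])
        qed
        ultimately show ?thesis by simp
      qed
    next
      case False
      have "entry U i (Suc j) = entry T i (Suc j)" unfolding syU using False by (rule if_not_P)
      then have "entry T i (Suc j) = Some v" using s by simp
      then obtain u where u: "u < v" "entry T i j = Some u" using sym_inc_left[OF T] by blast
      show ?thesis
      proof (cases "(i = k \<and> j = l) \<or> (i = l \<and> j = k)")
        case True
        then have "x < u" using b u kl by auto
        then show ?thesis using True u unfolding syU by auto
      next
        case False
        then have "entry U i j = entry T i j" unfolding syU by (rule if_not_P)
        then show ?thesis using u by auto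
      qed
    qed
  qed
  then show "sym_inc ?T" unfolding U_def .
qed

definition put :: "itab \<Rightarrow> nat \<Rightarrow> nat \<Rightarrow> nat \<Rightarrow> itab" where
  "put T k l x = (if sym_inc (T((min k l, max k l) \<mapsto> x)) then T((min k l, max k l) \<mapsto> x) else T)"

definition pos :: "itab \<Rightarrow> nat \<Rightarrow> nat \<Rightarrow> nat \<Rightarrow> bool" where
  "pos T k x l \<longleftrightarrow> (\<forall>i<l. (k, i) \<in> below T x) \<and> (k, l) \<notin> below T x"

text \<open>Writing \<open>x\<close> into an empty box and replacing an entry by \<open>x\<close> are the same operation \<open>put\<close>.\<close>

inductive sym_ins :: "itab \<Rightarrow> nat \<Rightarrow> nat \<Rightarrow> itab \<Rightarrow> bool" where
  stop: "pos T k x l \<Longrightarrow> entry T k l = None \<Longrightarrow> sym_ins T k x (put T k l x)"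
| bump: "pos T k x l \<Longrightarrow> entry T k l = Some y \<Longrightarrow> sym_ins (put T k l x) (Suc k) y T' \<Longrightarrow> sym_ins T k x T'"

lemma sym_inc_put: "sym_inc T \<Longrightarrow> sym_inc (put T k l x)"
  by (simp add: put_def)

lemma sym_ins_increasing: "sym_ins T k x T' \<Longrightarrow> sym_inc T \<Longrightarrow> sym_inc T'"
  by (induction rule: sym_ins.induct) (auto simp: sym_inc_put)

lemma pos_less: "pos T k x l \<Longrightarrow> entry T k l = Some y \<Longrightarrow> x < y"
  unfolding pos_def in_below by (metis not_le)

lemma pos_len: assumes "sym_inc T" "pos T k x l" shows "l = len (below T x) k"
  using assms unfolding pos_def by (intro len_eqI[OF young_below, symmetric]) auto

section \<open>Shifted increasing tableaux are the same as symmetric ones\<close>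

lemma shifted_shape_left: "(i, Suc j) \<in> shifted_shape lam \<Longrightarrow> i \<le> j \<Longrightarrow> (i, j) \<in> shifted_shape lam"
  by (auto simp: shifted_shape_def)

lemma shifted_shape_up: assumes "strict_partition lam" "(Suc i, j) \<in> shifted_shape lam" shows "(i, j) \<in> shifted_shape lam"
proof -
  have "lam ! Suc i < lam ! i" using assms
    by (auto simp: strict_partition_def shifted_shape_def intro: sorted_wrt_nth_less)
  then show ?thesis using assms by (auto simp: shifted_shape_def)
qed

lemma finite_shifted_shape: "finite (shifted_shape lam)"
proof (rule finite_subset)
  show "shifted_shape lam \<subseteq> (SIGMA i:{..<length lam}. {..<i + lam ! i})" by (auto simp: shifted_shape_def)
qed simp

text \<open>Row \<open>i\<close> has \<open>len M i - i\<close> boxes on and right of the diagonal.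
  Row lengths weakly decrease while \<open>i\<close> grows, so these parts strictly decrease; their
  number is the number of diagonal boxes.\<close>

lemma young_strict_partition:
  assumes y: "young M"
  obtains lam where "strict_partition lam" "shifted_shape lam = {(i, j) \<in> M. i \<le> j}"
proof -
  have "finite ((\<lambda>l. (l, l)) -` M)"
    using young_finite[OF y] by (intro finite_vimageI) (auto simp: inj_on_def)
  then obtain n0 where "n0 \<notin> (\<lambda>l. (l, l)) -` M" using ex_new_if_finite[OF infinite_UNIV_nat] by blast
  then have n0: "(n0, n0) \<notin> M" by simp
  define n where "n = (LEAST n. (n, n) \<notin> M)"
  have "(n, n) \<notin> M" unfolding n_def using n0 by (rule LeastI)
  then have n: "i < n \<longleftrightarrow> (i, i) \<in> M" for i
    using not_less_Least[of i "\<lambda>n. (n, n) \<notin> M"] young_mono[OF y, of i i n n] unfolding n_def by (meson not_le)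
  define lam where "lam = map (\<lambda>i. len M i - i) [0..<n]"
  have diag: "i < n \<Longrightarrow> i < len M i" for i using n young_len[OF y] by blast
  have dec: "len M i' - i' < len M i - i" if "i < i'" "i' < n" for i i'
  proof -
    have "(i', len M i' - 1) \<in> M" using diag[OF that(2)] young_len[OF y] by simp
    then have "(i, len M i' - 1) \<in> M" using young_mono[OF y] that by (meson less_imp_le order_refl)
    then have "len M i' - 1 < len M i" using young_len[OF y] by blast
    then show ?thesis using diag[OF that(2)] that by linarith
  qed
  have "strict_partition lam"
    unfolding strict_partition_def
  proof
    show "sorted_wrt (>) lam" unfolding lam_def by (auto simp: sorted_wrt_iff_nth_less intro: dec)
    show "\<forall>x\<in>set lam. 0 < x" unfolding lam_def using diag by auto
  qed
  moreover have "shifted_shape lam = {(i, j) \<in> M. i \<le> j}"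
  proof -
    have "(i, j) \<in> shifted_shape lam \<longleftrightarrow> (i, j) \<in> M \<and> i \<le> j" for i j
    proof -
      have "(i, j) \<in> shifted_shape lam \<longleftrightarrow> i < n \<and> i \<le> j \<and> j < len M i"
        unfolding shifted_shape_def lam_def using diag[of i] by auto
      also have "\<dots> \<longleftrightarrow> (i, j) \<in> M \<and> i \<le> j"
        using n[of i] young_len[OF y, of i j] young_mono[OF y, of i j i i] by auto
      finally show ?thesis .
    qed
    then show ?thesis by auto
  qed
  ultimately show ?thesis using that by blast
qed

text \<open>Left of the diagonal, a left neighbour in the doubled tableau mirrors an upper neighbour
  in the shifted one, so the row condition there is the column condition. The partition is recovered
  by \<open>young_strict_partition\<close>.\<close>

lemma increasing_tab_iff: "increasing_tab T \<longleftrightarrow> sym_inc T"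
proof
  assume inc: "increasing_tab T"
  note i = inc[unfolded increasing_tab_def]
  obtain lam where lam: "strict_partition lam" "dom T = shifted_shape lam"
    using conjunct1[OF i] by (elim exE conjE)
  have row: "j < j' \<Longrightarrow> T (i, j) = Some v \<Longrightarrow> T (i, j') = Some v' \<Longrightarrow> v < v'" for i j j' v v'
    using conjunct1[OF conjunct2[OF conjunct2[OF i]]] by (elim allE[of _ i] allE[of _ j] allE[of _ j'] allE[of _ v] allE[of _ v']) simp
  have col: "j < j' \<Longrightarrow> T (j, i) = Some v \<Longrightarrow> T (j', i) = Some v' \<Longrightarrow> v < v'" for i j j' v v'
    using conjunct2[OF conjunct2[OF conjunct2[OF i]]] by (elim allE[of _ j] allE[of _ j'] allE[of _ i] allE[of _ v] allE[of _ v']) simp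
  show "sym_inc T"
    unfolding sym_inc_def
  proof (intro conjI allI impI)
    show "finite (dom T)" using lam finite_shifted_shape by simp
    show "\<forall>v\<in>ran T. 1 \<le> v" using conjunct1[OF conjunct2[OF i]] .
    show "T (i, j) \<noteq> None \<Longrightarrow> i \<le> j" for i j
      using lam(2) by (auto simp: shifted_shape_def dom_def)
    fix i j v assume s: "entry T i (Suc j) = Some v"
    show "\<exists>u<v. entry T i j = Some u"
    proof (cases "i \<le> j")
      case True
      then have t: "T (i, Suc j) = Some v" using s by (simp add: entry_def min_def max_def)
      then have "(i, j) \<in> dom T" using shifted_shape_left[of i j lam] True lam(2) by blast
      then obtain u where "T (i, j) = Some u" by blast
      then show ?thesis using row[OF _ _ t] True by (auto simp: entry_def min_def max_def)
    next
      case False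
      then have "min i (Suc j) = Suc j" "max i (Suc j) = i" by auto
      then have t: "T (Suc j, i) = Some v" using s by (simp add: entry_def)
      then have "(j, i) \<in> dom T" using shifted_shape_up[OF lam(1), of j i] lam(2) by blast
      then obtain u where "T (j, i) = Some u" by blast
      then show ?thesis using col[OF _ _ t] False by (auto simp: entry_def min_def max_def)
    qed
  qed
next
  assume s: "sym_inc T"
  obtain lam where lam: "strict_partition lam" "shifted_shape lam = {(i, j) \<in> shape T. i \<le> j}"
    using young_strict_partition[OF young_shape[OF s]] .
  have le: "T (i, j) \<noteq> None \<Longrightarrow> i \<le> j" for i j using s unfolding sym_inc_def by blast
  have T: "T (i, j) = Some v \<longleftrightarrow> i \<le> j \<and> entry T i j = Some v" for i j v
    using le[of i j] by (auto simp: entry_def min_def max_def)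
  have "dom T = shifted_shape lam"
    unfolding lam using T by (auto simp: in_shape dom_def)
  moreover have "v < v'" if "j < j'" "T (i, j) = Some v" "T (i, j') = Some v'" for i j j' v v'
    using entry_mono[OF s, of i j' v' i j] that unfolding T by auto
  moreover have "v < v'" if "i < i'" "T (i, j) = Some v" "T (i', j) = Some v'" for i i' j v v'
    using entry_mono[OF s, of i' j v' i j] that unfolding T by auto
  moreover have "\<forall>v\<in>ran T. 1 \<le> v" using s unfolding sym_inc_def by blast
  ultimately show "increasing_tab T" unfolding increasing_tab_def using lam(1) by (intro conjI exI[of _ lam]) (assumption | (intro allI impI, elim conjE, blast))+
qed

section \<open>Row and column insertion as insertion into rows of the doubled tableau\<close>

lemma tab_entry: "sym_inc T \<Longrightarrow> T (i, j) = Some v \<longleftrightarrow> i \<le> j \<and> entry T i j = Some v"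
  unfolding sym_inc_def entry_def by (auto simp: min_def max_def)

text \<open>If the doubled row ends left of the diagonal, \<open>row_end\<close> is still the
  diagonal box, which is not the end of the doubled row; hence the assumption on
  \<open>r\<close>.\<close>

lemma row_end_len: assumes s: "sym_inc T" and r: "r \<le> len (shape T) r"
  shows "row_end T r = (r, len (shape T) r)"
proof -
  have "{j. (r, j) \<in> dom T} = {r..<len (shape T) r}"
    using tab_entry[OF s] young_len[OF young_shape[OF s], of r, symmetric] by (auto simp: dom_def in_shape)
  then show ?thesis using r by (simp add: row_end_def)
qed

lemma col_end_len: assumes s: "sym_inc T" and r: "len (shape T) c \<le> c"
  shows "col_end T c = (len (shape T) c, c)"
proof -
  have "i < len (shape T) c \<longleftrightarrow> (i, c) \<in> dom T" for i
  proof -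
    have "i < len (shape T) c \<longleftrightarrow> (i, c) \<in> shape T"
      using young_len[OF young_shape[OF s], of c i] young_swap[OF young_shape[OF s], of c i] by simp
    moreover have "(i, c) \<in> dom T \<longleftrightarrow> i \<le> c \<and> (i, c) \<in> shape T"
      using tab_entry[OF s, of i c] by (auto simp: in_shape)
    ultimately show ?thesis using r by auto
  qed
  then have "{i. (i, c) \<in> dom T} = {..<len (shape T) c}" by auto
  then show ?thesis by (simp add: col_end_def)
qed

lemma entry_put:
  assumes "entry (put T k l x) i j = Some u"
  shows "entry T i j = Some u \<or> ((i = k \<and> j = l \<or> i = l \<and> j = k) \<and> u = x)"
proof (cases "sym_inc (T((min k l, max k l) \<mapsto> x))")
  case True
  then show ?thesis using assms unfolding put_def by (simp only: if_True entry_upd split: if_splits) auto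
next
  case False
  then show ?thesis using assms unfolding put_def by simp
qed

lemma put_row: "k \<le> l \<Longrightarrow> put T k l x = (if increasing_tab (T((k, l) \<mapsto> x)) then T((k, l) \<mapsto> x) else T)"
  unfolding put_def increasing_tab_iff by (simp add: min_def max_def)

lemma put_col: "l \<le> k \<Longrightarrow> put T k l x = (if increasing_tab (T((l, k) \<mapsto> x)) then T((l, k) \<mapsto> x) else T)"
  unfolding put_def increasing_tab_iff by (simp add: min_absorb2 max_absorb1)

lemma entry_row: "r \<le> j \<Longrightarrow> entry T r j = T (r, j)"
  by (simp add: entry_def min_def max_def)

lemma entry_col: "i \<le> c \<Longrightarrow> entry T c i = T (i, c)"
  by (simp add: entry_def min_absorb2 max_absorb1)

lemma posI: "\<lbrakk>\<And>i. i < l \<Longrightarrow> \<exists>u\<le>x. entry T k i = Some u; \<And>u. entry T k l = Some u \<Longrightarrow> x < u\<rbrakk> \<Longrightarrow> pos T k x l"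
  unfolding pos_def in_below by fastforce

text \<open>The invariants of the two phases: in the row phase all entries of row \<open>r\<close> left of the diagonal are at most
\<open>x\<close>, in the column phase some entry of row \<open>c\<close> left of the diagonal is missing or greater than \<open>x\<close>.
So the insertion position in the doubled row lies right, respectively left, of the diagonal.\<close>

definition row_ready :: "itab \<Rightarrow> nat \<Rightarrow> nat \<Rightarrow> bool" where
  "row_ready T r x \<longleftrightarrow> sym_inc T \<and> (\<forall>i<r. \<exists>u\<le>x. entry T r i = Some u)"

definition col_ready :: "itab \<Rightarrow> nat \<Rightarrow> nat \<Rightarrow> bool" where
  "col_ready T c x \<longleftrightarrow> sym_inc T \<and> (\<exists>i<c. \<forall>u. entry T c i = Some u \<longrightarrow> x < u)"

lemma row_ready_stop:
  assumes r: "row_ready T r x" and m: "\<forall>v\<in>row_vals T r. v \<le> x"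
  shows "sym_ins T r x (if increasing_tab (T(row_end T r \<mapsto> x)) then T(row_end T r \<mapsto> x) else T)"
proof -
  have s: "sym_inc T" using r unfolding row_ready_def by blast
  let ?l = "len (shape T) r"
  note lr = young_len[OF young_shape[OF s], of r, symmetric]
  have le: "r \<le> ?l"
  proof (rule ccontr)
    assume "\<not> r \<le> ?l"
    then have "\<exists>u\<le>x. entry T r ?l = Some u" using r unfolding row_ready_def by simp
    then have "(r, ?l) \<in> shape T" unfolding in_shape by blast
    then show False using lr by blast
  qed
  have n: "entry T r ?l = None" using lr[of ?l] by (auto simp: in_shape)
  have "pos T r x ?l"
  proof (rule posI)
    fix i assume i: "i < ?l"
    show "\<exists>u\<le>x. entry T r i = Some u"
    proof (cases "i < r")
      case True
      then show ?thesis using r unfolding row_ready_def by blast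
    next
      case False
      obtain u where u: "entry T r i = Some u" using i lr in_shape by blast
      then have "u \<in> row_vals T r" using False entry_row[of r i T] unfolding row_vals_def by auto
      then show ?thesis using m u by blast
    qed
  qed (use n in simp)
  then have "sym_ins T r x (put T r ?l x)" using n by (rule sym_ins.stop)
  then show ?thesis unfolding put_row[OF le] row_end_len[OF s le] .
qed

lemma row_ready_pos:
  assumes r: "row_ready T r x" and j: "T (r, j) = Some y" "x < y" and m: "\<forall>v\<in>row_vals T r. x < v \<longrightarrow> y \<le> v"
  shows "pos T r x j" "entry T r j = Some y" "r \<le> j"
proof -
  have s: "sym_inc T" using r unfolding row_ready_def by blast
  show rj: "r \<le> j" using tab_entry[OF s] j(1) by blast
  then show sj: "entry T r j = Some y" using entry_row j by simp
  show "pos T r x j"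
  proof (rule posI)
    fix i assume i: "i < j"
    show "\<exists>u\<le>x. entry T r i = Some u"
    proof (cases "i < r")
      case True
      then show ?thesis using r unfolding row_ready_def by blast
    next
      case False
      obtain u where u: "u < y" "entry T r i = Some u" using entry_mono[OF s sj, of r i] i by auto
      then have "u \<in> row_vals T r" using False entry_row[of r i T] unfolding row_vals_def by auto
      then have "u \<le> x" using m u(1) by (meson not_le)
      then show ?thesis using u by blast
    qed
  qed (use sj j in simp)
qed

lemma col_ready_stop:
  assumes r: "col_ready T c x" and m: "\<forall>v\<in>col_vals T c. v \<le> x"
  shows "sym_ins T c x (if increasing_tab (T(col_end T c \<mapsto> x)) then T(col_end T c \<mapsto> x) else T)"
proof -
  have s: "sym_inc T" using r unfolding col_ready_def by blast
  let ?l = "len (shape T) c"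
  note lr = young_len[OF young_shape[OF s], of c, symmetric]
  have cv: "u \<le> x" if "i \<le> c" "entry T c i = Some u" for i u
    using m that entry_col[of i c T] unfolding col_vals_def by auto
  obtain i where i: "i < c" "\<And>u. entry T c i = Some u \<Longrightarrow> x < u" using r unfolding col_ready_def by blast
  have "entry T c i = None"
  proof (rule ccontr)
    assume "entry T c i \<noteq> None"
    then obtain u where u: "entry T c i = Some u" by blast
    then show False using i(2)[OF u] cv[OF _ u] i(1) by simp
  qed
  then have "(c, i) \<notin> shape T" by (simp add: in_shape)
  then have "?l \<le> i" using lr by (meson not_le)
  then have le: "?l \<le> c" using i by simp
  have n: "entry T c ?l = None" using lr[of ?l] by (auto simp: in_shape)
  have "pos T c x ?l"
  proof (rule posI)
    fix i assume i: "i < ?l"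
    obtain u where u: "entry T c i = Some u" using i lr in_shape by blast
    then show "\<exists>u\<le>x. entry T c i = Some u" using cv[OF _ u] i le by auto
  qed (use n in simp)
  then have "sym_ins T c x (put T c ?l x)" using n by (rule sym_ins.stop)
  then show ?thesis unfolding put_col[OF le] col_end_len[OF s le] .
qed

lemma col_ready_pos:
  assumes r: "col_ready T c x" and j: "T (i, c) = Some y" "x < y" and m: "\<forall>v\<in>col_vals T c. x < v \<longrightarrow> y \<le> v"
  shows "pos T c x i" "entry T c i = Some y" "i < c"
proof -
  have s: "sym_inc T" using r unfolding col_ready_def by blast
  have ic: "i \<le> c" using tab_entry[OF s] j(1) by blast
  then show si: "entry T c i = Some y" using entry_col j by simp
  obtain i' where i': "i' < c" "\<And>u. entry T c i' = Some u \<Longrightarrow> x < u" using r unfolding col_ready_def by blast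
  have cv: "u \<in> col_vals T c" if "i \<le> c" "entry T c i = Some u" for i u
    using that entry_col[of i c T] unfolding col_vals_def by auto
  show "i < c"
  proof (rule ccontr)
    assume "\<not> i < c"
    then have "i = c" using ic by simp
    then obtain u where u: "u < y" "entry T c i' = Some u" using entry_mono[OF s si, of c i'] i'(1) by auto
    then have "y \<le> u" using m cv[OF _ u(2)] i' by simp
    then show False using u by simp
  qed
  show "pos T c x i"
  proof (rule posI)
    fix a assume a: "a < i"
    obtain u where u: "u < y" "entry T c a = Some u" using entry_mono[OF s si, of c a] a by auto
    then have "u \<in> col_vals T c" using cv[OF _ u(2)] a ic by simp
    then have "u \<le> x" using m u(1) by (meson not_le)
    then show "\<exists>u\<le>x. entry T c a = Some u" using u by blast
  qed (use si j in simp)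
qed

lemma row_ins_sym_ins: "row_ready T r x \<Longrightarrow> row_ins T r x T' \<Longrightarrow> sym_ins T r x T'"
  and col_ins_sym_ins: "col_ready T r x \<Longrightarrow> col_ins T r x T' \<Longrightarrow> sym_ins T r x T'"
proof -
  have "(row_ins T r x T' \<longrightarrow> row_ready T r x \<longrightarrow> sym_ins T r x T') \<and> (col_ins T0 c x0 T0' \<longrightarrow> col_ready T0 c x0 \<longrightarrow> sym_ins T0 c x0 T0')"
    for T r x T' T0 c x0 T0'
  proof (induction rule: row_ins_col_ins.induct)
    case (row_add T r x)
    show ?case
    proof
      assume "row_ready T r x"
      from row_ready_stop[OF this row_add(1)] row_add(2)
      show "sym_ins T r x (T(row_end T r \<mapsto> x))" by (simp only: if_True)
    qed
  next
    case (row_stop T r x)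
    show ?case using row_ready_stop[of T r x] row_stop by simp
  next
    case (row_bump_diag T r y x T1 T')
    show ?case
    proof
      assume r: "row_ready T r x"
      note p = row_ready_pos[OF r row_bump_diag(1-3)]
      have s: "sym_inc T" using r unfolding row_ready_def by blast
      have T1: "T1 = put T r r x" using row_bump_diag(4) put_row by simp
      \<comment> \<open>The turn at the diagonal: this box lies directly below the one that held
        \<open>y\<close>, so its entry, if any, exceeds \<open>y\<close> and the column phase
        begins.\<close>
      have "y < u" if "entry T1 (Suc r) r = Some u" for u
      proof -
        have "entry T (Suc r) r = Some u" using entry_put that unfolding T1 by fastforce
        then show ?thesis using entry_mono[OF s, of "Suc r" r u r r] p(2) by auto
      qed
      then have "col_ready T1 (Suc r) y" unfolding col_ready_def using sym_inc_put[OF s] T1 by blast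
      then have "sym_ins T1 (Suc r) y T'" using row_bump_diag by blast
      then show "sym_ins T r x T'" using sym_ins.bump[OF p(1,2)] T1 by blast
    qed
  next
    case (row_bump T r j y x T1 T')
    show ?case
    proof
      assume r: "row_ready T r x"
      note p = row_ready_pos[OF r row_bump(1,3,4)]
      have s: "sym_inc T" using r unfolding row_ready_def by blast
      have T1: "T1 = put T r j x" using row_bump(5) put_row[OF p(3)] by simp
      have s1: "sym_inc T1" using sym_inc_put[OF s] T1 by simp
      have rj: "Suc r \<le> j" using p(3) row_bump(2) by simp
      obtain w where w: "w \<le> y" "entry T1 r j = Some w"
      proof (cases "sym_inc (T((min r j, max r j) \<mapsto> x))")
        case True
        then have "entry T1 r j = Some x" unfolding T1 put_def by (simp only: if_True entry_upd) simp
        then show ?thesis using that row_bump(3) by simp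
      next
        case False
        then show ?thesis using that p(2) unfolding T1 put_def by simp
      qed
      \<comment> \<open>By symmetry this is the box \<open>(i, Suc r)\<close>, weakly above and left
        of \<open>(r, j)\<close> since \<open>j\<close> is right of the diagonal. So the next
        position is again on or right of the diagonal.\<close>
      have "\<exists>u\<le>y. entry T1 (Suc r) i = Some u" if "i < Suc r" for i
      proof -
        have "\<exists>u\<le>w. entry T1 i (Suc r) = Some u" using entry_mono[OF s1 w(2), of i "Suc r"] that rj by auto
        then show ?thesis using w(1) unfolding entry_commute[of T1 i] by (meson le_trans)
      qed
      then have "row_ready T1 (Suc r) y" unfolding row_ready_def using s1 by blast
      then have "sym_ins T1 (Suc r) y T'" using row_bump by blast
      then show "sym_ins T r x T'" using sym_ins.bump[OF p(1,2)] T1 by blast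
    qed
  next
    case (col_add T c x)
    show ?case
    proof
      assume "col_ready T c x"
      from col_ready_stop[OF this col_add(1)] col_add(2)
      show "sym_ins T c x (T(col_end T c \<mapsto> x))" by (simp only: if_True)
    qed
  next
    case (col_stop T c x)
    show ?case using col_ready_stop[of T c x] col_stop by simp
  next
    case (col_bump T i c y x T1 T')
    show ?case
    proof
      assume r: "col_ready T c x"
      note p = col_ready_pos[OF r col_bump(1-3)]
      have s: "sym_inc T" using r unfolding col_ready_def by blast
      have T1: "T1 = put T c i x" using col_bump(4) put_col[of i c] p(3) by simp
      \<comment> \<open>The box below the one that held \<open>y\<close> is empty or has a larger
        entry, and it is still left of the diagonal; so the column phase persists.\<close>
      have "y < u" if "entry T1 (Suc c) i = Some u" for u
      proof -
        have "entry T (Suc c) i = Some u" using entry_put that p(3) unfolding T1 by fastforce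
        then show ?thesis using entry_mono[OF s, of "Suc c" i u c i] p(2) by auto
      qed
      then have "col_ready T1 (Suc c) y" unfolding col_ready_def using sym_inc_put[OF s] T1 p(3) less_SucI by blast
      then have "sym_ins T1 (Suc c) y T'" using col_bump by blast
      then show "sym_ins T c x T'" using sym_ins.bump[OF p(1,2)] T1 by blast
    qed
  qed
  then show "row_ready T r x \<Longrightarrow> row_ins T r x T' \<Longrightarrow> sym_ins T r x T'"
    "col_ready T r x \<Longrightarrow> col_ins T r x T' \<Longrightarrow> sym_ins T r x T'" by blast+
qed

lemma least_above: assumes "\<not> (\<forall>v\<in>A. v \<le> (x::nat))" obtains y where "y \<in> A" "x < y" "\<forall>v\<in>A. x < v \<longrightarrow> y \<le> v"
proof -
  define y where "y = (LEAST v. v \<in> A \<and> x < v)"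
  have ex: "\<exists>v. v \<in> A \<and> x < v" using assms by (meson not_le)
  have "y \<in> A \<and> x < y" unfolding y_def using ex by (rule LeastI_ex)
  moreover have "\<forall>v\<in>A. x < v \<longrightarrow> y \<le> v" unfolding y_def by (simp add: Least_le)
  ultimately show ?thesis using that by blast
qed

text \<open>Every output exceeds the inserted value and is an entry of the tableau, hence at most
  \<open>B\<close>; so \<open>B - x\<close> drops with each bump.\<close>

lemma ins_total:
  assumes "\<forall>v\<in>ran T. v \<le> B"
  shows "(\<exists>T'. row_ins T r x T') \<and> (\<exists>T'. col_ins T r x T')"
  using assms
proof (induction "B - x" arbitrary: T r x rule: less_induct)
  case less
  have IH: "(\<exists>T'. row_ins T1 r' y T') \<and> (\<exists>T'. col_ins T1 r' y T')"
    if "x < y" "y \<in> ran T" and T1: "T1 = (if P then T(b \<mapsto> x) else T)" for T1 r' y P b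
  proof (rule less.hyps)
    have y: "y \<le> B" using less.prems that by blast
    then show "B - y < B - x" using that(1) by simp
    have "ran T1 \<subseteq> insert x (ran T)" unfolding T1 ran_def by (auto split: if_splits)
    then show "\<forall>v\<in>ran T1. v \<le> B" using less.prems y that(1) by fastforce
  qed
  have "\<exists>T'. row_ins T r x T'"
  proof (cases "\<forall>v\<in>row_vals T r. v \<le> x")
    case True
    then show ?thesis using row_add[of T r x] row_stop[of T r x] by blast
  next
    case False
    then obtain y where y: "y \<in> row_vals T r" "x < y" "\<forall>v\<in>row_vals T r. x < v \<longrightarrow> y \<le> v" using least_above by blast
    then obtain j where j: "T (r, j) = Some y" unfolding row_vals_def by blast
    then have ran: "y \<in> ran T" by (rule ranI)
    define T1 where "T1 = (if increasing_tab (T((r, j) \<mapsto> x)) then T((r, j) \<mapsto> x) else T)"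
    note I = IH[OF y(2) ran T1_def, of "Suc r"]
    show ?thesis
    proof (cases "j = r")
      case True
      then show ?thesis using row_bump_diag[of T r y x T1] j y I T1_def by blast
    next
      case False
      then show ?thesis using row_bump[of T r j y x T1] j y I T1_def by blast
    qed
  qed
  moreover have "\<exists>T'. col_ins T r x T'"
  proof (cases "\<forall>v\<in>col_vals T r. v \<le> x")
    case True
    then show ?thesis using col_add[of T r x] col_stop[of T r x] by blast
  next
    case False
    then obtain y where y: "y \<in> col_vals T r" "x < y" "\<forall>v\<in>col_vals T r. x < v \<longrightarrow> y \<le> v" using least_above by blast
    then obtain i where j: "T (i, r) = Some y" unfolding col_vals_def by blast
    then have ran: "y \<in> ran T" by (rule ranI)
    define T1 where "T1 = (if increasing_tab (T((i, r) \<mapsto> x)) then T((i, r) \<mapsto> x) else T)"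
    show ?thesis using col_bump[OF j y(2,3) T1_def] IH[OF y(2) ran T1_def, of "Suc r"] by blast
  qed
  ultimately show ?case by blast
qed

lemma row_ins_total: assumes "sym_inc T" shows "\<exists>T'. row_ins T r x T'"
proof -
  have "finite (ran T)" using assms finite_ran unfolding sym_inc_def by blast
  then show ?thesis using ins_total[of T "Max (ran T)" r x] by (meson Max_ge)
qed

text \<open>The value \<open>x\<close> was bumped from row \<open>k - 1\<close> and can have stayed there only outside the first column. The
latter guarantees that a blocked insertion has a box to its left.\<close>

definition ready :: "itab \<Rightarrow> nat \<Rightarrow> nat \<Rightarrow> bool" where
  "ready T k x \<longleftrightarrow> sym_inc T \<and> 1 \<le> x \<and> (\<forall>k'. k = Suc k' \<longrightarrow>
     (\<exists>j u. entry T k' j = Some u \<and> u \<le> x \<and> (k, j) \<notin> below T x \<and> (u = x \<longrightarrow> 0 < j)))"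

text \<open>Under \<open>ready\<close> only an equal entry to the left or above can prevent writing
  \<open>x\<close>; this is \<open>put_blocked\<close>.\<close>

definition blocked :: "itab \<Rightarrow> nat \<Rightarrow> nat \<Rightarrow> nat \<Rightarrow> bool" where
  "blocked T k x l \<longleftrightarrow> (\<exists>l'. l = Suc l' \<and> (k, l') \<in> level T x) \<or> (\<exists>k'. k = Suc k' \<and> (k', l) \<in> level T x)"

text \<open>When nothing can be written in column \<open>l\<close>, the insertion terminates at the bottom of column \<open>l - 1\<close>.\<close>

definition old_edge :: "itab \<Rightarrow> nat \<Rightarrow> nat \<Rightarrow> edge" where
  "old_edge T v l = Some ((len (below T v) (l - 1) - 1, l - 1), False)"

text \<open>The state expected at level \<open>x\<close> just after \<open>x\<close> has been
  inserted into row \<open>k\<close>, before larger entries are considered.\<close>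

definition init :: "itab \<Rightarrow> nat \<Rightarrow> nat \<Rightarrow> nat \<Rightarrow> diagram \<times> diagram \<times> edge" where
  "init T k x l = (if blocked T k x l then (below T x, level T x, old_edge T x l)
     else (below T x \<union> {(k, l), (l, k)}, level T x \<union> {(k, l), (l, k)}, Some ((k, l), True)))"

section \<open>Each bumping step agrees with the local rules up to the next bumped value\<close>

lemma pos_unique: assumes "pos T k x l" "pos T k x l'" shows "l = l'"
  using assms unfolding pos_def by (metis linorder_neqE_nat)

lemma below_mono: "v \<le> w \<Longrightarrow> below T v \<subseteq> below T w"
  unfolding below_def by (blast intro: le_trans)

lemma ready_above: assumes r: "ready T k x" and p: "pos T k x l" and k: "k = Suc k'"
  shows "\<exists>u\<le>x. entry T k' l = Some u" "(k', l) \<in> level T x \<Longrightarrow> 0 < l"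
proof -
  have s: "sym_inc T" using r unfolding ready_def by blast
  obtain j u where j: "entry T k' j = Some u" "u \<le> x" "(k, j) \<notin> below T x" "u = x \<longrightarrow> 0 < j"
    using r k unfolding ready_def by blast
  have lj: "l \<le> j" using p j(3) unfolding pos_def by (meson not_le)
  obtain w where w: "w \<le> u" "entry T k' l = Some w" "(k', l) \<noteq> (k', j) \<longrightarrow> w < u" using entry_mono[OF s j(1) _ lj, of k'] by blast
  then show "\<exists>u\<le>x. entry T k' l = Some u" using j(2) by (meson le_trans)
  assume "(k', l) \<in> level T x"
  then have "w = x" using w(2) by (simp add: in_level)
  then show "0 < l" using w j by (cases l) auto
qed

lemma put_blocked: assumes r: "ready T k x" and p: "pos T k x l"
  shows "sym_inc (T((min k l, max k l) \<mapsto> x)) \<longleftrightarrow> \<not> blocked T k x l"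
proof -
  have s: "sym_inc T" and x: "1 \<le> x" using r unfolding ready_def by blast+
  have "(\<exists>u<x. entry T k' l = Some u) \<longleftrightarrow> (k', l) \<notin> level T x" if "k = Suc k'" for k'
    using ready_above(1)[OF r p that] by (auto simp: in_level nless_le)
  moreover have "(\<exists>u<x. entry T k l' = Some u) \<longleftrightarrow> (k, l') \<notin> level T x" if "l = Suc l'" for l'
  proof -
    have "(k, l') \<in> below T x" using p that unfolding pos_def by simp
    then show ?thesis by (auto simp: in_level in_below nless_le)
  qed
  ultimately show ?thesis using sym_inc_upd[OF s x pos_less[OF p]] unfolding blocked_def by blast
qed

text \<open>Writing \<open>x\<close> over \<open>y\<close> changes the diagrams only at levels
  \<open>v\<close> with \<open>x \<le> v < y\<close>, and the level sets only at \<open>x\<close>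
  and \<open>y\<close>; for an empty box there is no upper bound. So cells strictly between see just
  an extra pair of boxes.\<close>

lemma put_levels:
  assumes r: "ready T k x" and p: "pos T k x l" and b: "\<not> blocked T k x l"
  shows "entry (put T k l x) i j = (if (i = k \<and> j = l) \<or> (i = l \<and> j = k) then Some x else entry T i j)"
    "v < x \<Longrightarrow> below (put T k l x) v = below T v" "v < x \<Longrightarrow> level (put T k l x) v = level T v"
    "\<forall>y. entry T k l = Some y \<longrightarrow> v < y \<Longrightarrow> x \<le> v \<Longrightarrow> below (put T k l x) v = below T v \<union> {(k, l), (l, k)}"
    "\<forall>y. entry T k l = Some y \<longrightarrow> v < y \<Longrightarrow> x < v \<Longrightarrow> level (put T k l x) v = level T v"
    "level (put T k l x) x = level T x \<union> {(k, l), (l, k)}"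
    "entry T k l = Some y \<Longrightarrow> level (put T k l x) y = level T y - {(k, l), (l, k)}"
    "entry T k l = Some y \<Longrightarrow> y \<le> v \<Longrightarrow> below (put T k l x) v = below T v"
    "entry T k l = Some y \<Longrightarrow> y < v \<Longrightarrow> level (put T k l x) v = level T v"
proof -
  define U where "U = put T k l x"
  have U: "U = T((min k l, max k l) \<mapsto> x)" unfolding U_def put_def using put_blocked[OF r p] b by simp
  have sU: "entry U i j = (if (i = k \<and> j = l) \<or> (i = l \<and> j = k) then Some x else entry T i j)" for i j
    unfolding U by (rule entry_upd)
  show "entry (put T k l x) i j = (if (i = k \<and> j = l) \<or> (i = l \<and> j = k) then Some x else entry T i j)"
    using sU unfolding U_def .
  define D where "D = {(k, l), (l, k)}"
  have inD: "(i, j) \<in> D \<longleftrightarrow> (i = k \<and> j = l) \<or> (i = l \<and> j = k)" for i j unfolding D_def by auto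
  have sU1: "(i, j) \<in> D \<Longrightarrow> entry U i j = Some x" and sU2: "(i, j) \<notin> D \<Longrightarrow> entry U i j = entry T i j" for i j
    unfolding inD sU by (rule if_P, assumption) (rule if_not_P, assumption)
  have sT: "(i, j) \<in> D \<Longrightarrow> entry T i j = entry T k l" for i j unfolding inD using entry_commute[of T k l] by auto
  note xy = pos_less[OF p]
  have lev: "level U v = (if v = x then level T v \<union> D else level T v - D)" for v
  proof -
    have "(i, j) \<in> level U v \<longleftrightarrow> (i, j) \<in> (if v = x then level T v \<union> D else level T v - D)" for i j
      using sU1[of i j] sU2[of i j] by (cases "(i, j) \<in> D") (auto simp: in_level)
    then show ?thesis by (auto simp: set_eq_iff)
  qed
  have bel: "below U v = (if x \<le> v then below T v \<union> D else below T v - D)" for v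
  proof -
    have "(i, j) \<in> below U v \<longleftrightarrow> (i, j) \<in> (if x \<le> v then below T v \<union> D else below T v - D)" for i j
      using sU1[of i j] sU2[of i j] by (cases "(i, j) \<in> D") (auto simp: in_below)
    then show ?thesis by (auto simp: set_eq_iff)
  qed
  have dis: "below T v \<inter> D = {}" if "\<forall>y. entry T k l = Some y \<longrightarrow> v < y" for v
    using that sT by (fastforce simp: below_def)
  have lD: "level T v \<subseteq> below T v" for v by (rule level_below)
  have sm: "\<forall>y. entry T k l = Some y \<longrightarrow> v < y" if "v \<le> x" for v using xy that by fastforce
  show "v < x \<Longrightarrow> below (put T k l x) v = below T v"
    using dis[OF sm, of v] unfolding U_def[symmetric] bel by auto
  show "v < x \<Longrightarrow> level (put T k l x) v = level T v"
    using dis[OF sm, of v] lD[of v] unfolding U_def[symmetric] lev by auto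
  show "\<forall>y. entry T k l = Some y \<longrightarrow> v < y \<Longrightarrow> x \<le> v \<Longrightarrow> below (put T k l x) v = below T v \<union> {(k, l), (l, k)}"
    unfolding U_def[symmetric] bel D_def[symmetric] by simp
  show "\<forall>y. entry T k l = Some y \<longrightarrow> v < y \<Longrightarrow> x < v \<Longrightarrow> level (put T k l x) v = level T v"
    using dis[of v] lD[of v] unfolding U_def[symmetric] lev by auto
  show "level (put T k l x) x = level T x \<union> {(k, l), (l, k)}"
    unfolding U_def[symmetric] lev D_def[symmetric] by simp
  show "entry T k l = Some y \<Longrightarrow> level (put T k l x) y = level T y - {(k, l), (l, k)}"
    using xy unfolding U_def[symmetric] lev D_def[symmetric] by auto
  show "entry T k l = Some y \<Longrightarrow> y \<le> v \<Longrightarrow> below (put T k l x) v = below T v"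
  proof -
    assume a: "entry T k l = Some y" "y \<le> v"
    have "D \<subseteq> below T v" using sT a by (auto simp: below_def)
    then show ?thesis using xy[OF a(1)] a(2) unfolding U_def[symmetric] bel by auto
  qed
  show "entry T k l = Some y \<Longrightarrow> y < v \<Longrightarrow> level (put T k l x) v = level T v"
  proof -
    assume a: "entry T k l = Some y" "y < v"
    have "D \<inter> level T v = {}" using sT a by (auto simp: level_def)
    then show ?thesis using xy[OF a(1)] a(2) unfolding U_def[symmetric] lev by auto
  qed
qed

lemma put_id: assumes "ready T k x" "pos T k x l" "blocked T k x l" shows "put T k l x = T"
  using put_blocked[OF assms(1,2)] assms(3) unfolding put_def by simp

lemma ready_next: assumes r: "ready T k x" and p: "pos T k x l" and y: "entry T k l = Some y"
  shows "ready (put T k l x) (Suc k) y"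
proof -
  have s: "sym_inc T" and x: "1 \<le> x" using r unfolding ready_def by blast+
  have s1: "sym_inc (put T k l x)" using sym_inc_put[OF s] .
  have xy: "x < y" using pos_less[OF p y] .
  have b: "(Suc k, l) \<notin> below T y" using sym_inc_up[OF s, of k l] y by (fastforce simp: in_below)
  show ?thesis
  proof (cases "blocked T k x l")
    case True
    \<comment> \<open>The box \<open>(k, l)\<close> still holds \<open>y\<close> and is the witness,
      with equality; this is the situation for which \<open>ready\<close> demands
      \<open>0 < j\<close>.\<close>
    have "0 < l" using True ready_above(2)[OF r p] unfolding blocked_def by auto
    then show ?thesis unfolding ready_def put_id[OF r p True] using s x xy y b by auto
  next
    case False
    have "entry (put T k l x) k l = Some x" using put_levels(1)[OF r p False, of k l] by simp
    then show ?thesis unfolding ready_def put_levels(8)[OF r p False y order_refl] using s1 x xy b by fastforce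
  qed
qed

definition row_edge :: "itab \<Rightarrow> nat \<Rightarrow> nat \<Rightarrow> nat \<Rightarrow> nat \<Rightarrow> edge" where
  "row_edge T k x l v = (if blocked T k x l then old_edge T v l else Some ((k, l), True))"

lemma init_put: assumes r: "ready T k x" and p: "pos T k x l"
  shows "init T k x l = (below (put T k l x) x, level (put T k l x) x, row_edge T k x l x)"
proof (cases "blocked T k x l")
  case True
  then show ?thesis unfolding init_def row_edge_def using put_id[OF r p] by simp
next
  case False
  have "\<forall>y. entry T k l = Some y \<longrightarrow> x < y" using pos_less[OF p] by blast
  then show ?thesis unfolding init_def row_edge_def using False put_levels(4,6)[OF r p False] by simp
qed

text \<open>The two sides differ only when \<open>x\<close> stands above the position but not to its
  left: \<open>row_rule\<close> would add a box where the insertion is blocked. In that case the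
  edge is already lower in column \<open>l - 1\<close>, and \<open>step_turn\<close> resorts to
  \<open>stay_below\<close>.\<close>

lemma init_row_rule: assumes s: "sym_inc T" and p: "pos T k x l"
  and a: "(\<exists>l'. l = Suc l' \<and> (k, l') \<in> level T x) \<or> \<not> (\<exists>k'. k = Suc k' \<and> (k', l) \<in> level T x)"
  shows "init T k x l = row_rule k (below T x) (level T x)"
proof -
  note y = young_below[OF s, of x] and ro = rook_level[OF s, of x]
  have l: "l = len (below T x) k" using pos_len[OF s p] .
  show ?thesis
  proof (cases "\<exists>l'. l = Suc l' \<and> (k, l') \<in> level T x")
    case True
    then obtain l' where l': "l = Suc l'" "(k, l') \<in> level T x" by blast
    have "(l', k) \<in> level T x" using l' rook_sym[OF ro] by blast
    then have "len (below T x) l' = Suc k" using corner_len[OF y rook_corner[OF ro]] by blast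
    moreover have "blocked T k x l" unfolding blocked_def using True by blast
    ultimately show ?thesis using row_rule_old[OF y ro l'(2)] l' by (simp add: init_def old_edge_def)
  next
    case False
    have "(k, q) \<notin> level T x" for q
    proof
      assume q: "(k, q) \<in> level T x"
      then have "l = Suc q" using corner_len[OF y rook_corner[OF ro q]] l by simp
      then show False using False q by blast
    qed
    moreover have "\<not> blocked T k x l" unfolding blocked_def using False a by blast
    ultimately show ?thesis using row_rule_new[OF y ro _ l] by (simp add: init_def)
  qed
qed

text \<open>Admitting \<open>v + 1\<close> adds at most one box to column \<open>l'\<close>, at its
  bottom, and the edge follows it. The last assumption excludes the other move of the local rule,
  caused by a \<open>v + 1\<close> to the right.\<close>

lemma stay_below:
  assumes s: "sym_inc T" and m: "m = len (below T v) l' - 1" and b: "(m, l') \<in> below T v"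
    and n: "(m, Suc l') \<notin> level T (Suc v)"
  shows "cell False (below T (Suc v)) (level T (Suc v)) (Some ((m, l'), False)) =
    (below T (Suc v), level T (Suc v), old_edge T (Suc v) (Suc l'))"
proof -
  note y = young_below[OF s, of "Suc v"] and ro = rook_level[OF s, of "Suc v"]
  have y0: "young (below T v)" by (rule young_below[OF s])
  have "(l', m) \<in> below T v" using b young_swap[OF y0] by blast
  then have ml: "len (below T v) l' = Suc m" using m young_len[OF y0, of l' m] by auto
  show ?thesis
  proof (cases "(Suc m, l') \<in> level T (Suc v)")
    case True
    then have "(l', Suc m) \<in> level T (Suc v)" using rook_sym[OF ro] by blast
    then have "len (below T (Suc v)) l' = Suc (Suc m)" using corner_len[OF y rook_corner[OF ro]] by blast
    then show ?thesis using row_rule_old[OF y ro True] True by (simp add: cell_def old_edge_def)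
  next
    case False
    then have "(l', Suc m) \<notin> level T (Suc v)" using rook_sym[OF ro] by blast
    moreover have "(l', Suc m) \<notin> below T v" using young_len[OF y0, of l'] ml by simp
    ultimately have "(l', Suc m) \<notin> below T (Suc v)" using below_Suc by blast
    moreover have "(l', m) \<in> below T (Suc v)" using \<open>(l', m) \<in> below T v\<close> below_Suc by blast
    ultimately have "len (below T (Suc v)) l' = Suc m" by (intro len_eqI[OF y]) auto
    then show ?thesis using False n by (simp add: cell_def old_edge_def)
  qed
qed

lemma blocked_bottom:
  assumes r: "ready T k x" and p: "pos T k x l" and b: "blocked T k x l" and v: "x \<le> v"
  obtains l' m where "l = Suc l'" "m = len (below T v) l' - 1" "(m, l') \<in> below T v" "(Suc m, l') \<notin> below T v" "k \<le> m"
    "(k, l') \<in> below T v"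
proof -
  have s: "sym_inc T" using r unfolding ready_def by blast
  have y0: "young (below T v)" by (rule young_below[OF s])
  have "0 < l" using b ready_above(2)[OF r p] unfolding blocked_def by auto
  then obtain l' where l: "l = Suc l'" by (cases l) auto
  have kl: "(k, l') \<in> below T v" using p l below_mono[OF v] unfolding pos_def by auto
  define m where "m = len (below T v) l' - 1"
  have i: "(i, l') \<in> below T v \<longleftrightarrow> i < len (below T v) l'" for i using young_swap[OF y0, of i l'] young_len[OF y0, of l' i] by simp
  then show ?thesis using that[OF l m_def] kl unfolding m_def by fastforce
qed

lemma step_cell:
  assumes r: "ready T k x" and p: "pos T k x l" and v: "x \<le> v" and y: "\<forall>y. entry T k l = Some y \<longrightarrow> Suc v < y"
  shows "cell False (below T (Suc v)) (level T (Suc v)) (row_edge T k x l v) =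
    (below (put T k l x) (Suc v), level (put T k l x) (Suc v), row_edge T k x l (Suc v))"
proof (cases "blocked T k x l")
  case True
  have s: "sym_inc T" using r unfolding ready_def by blast
  obtain l' m where lm: "l = Suc l'" "m = len (below T v) l' - 1" "(m, l') \<in> below T v" "k \<le> m"
    using blocked_bottom[OF r p True v] by blast
  \<comment> \<open>A \<open>v + 1\<close> right of the edge would lie in column \<open>l\<close>
    weakly below \<open>(k, l)\<close>, forcing an entry at most \<open>v + 1\<close> there, against
    the bound on \<open>y\<close>.\<close>
  have "(m, Suc l') \<notin> level T (Suc v)"
  proof
    assume "(m, Suc l') \<in> level T (Suc v)"
    then have "entry T m l = Some (Suc v)" using lm by (simp add: in_level)
    then obtain u where "u \<le> Suc v" "entry T k l = Some u" using entry_mono[OF s, of m l "Suc v" k l] lm by blast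
    then show False using y by auto
  qed
  note c = stay_below[OF s lm(2,3) this]
  have "row_edge T k x l v = Some ((m, l'), False)" using True lm(1,2) by (simp add: row_edge_def old_edge_def)
  then show ?thesis using c True lm(1) put_id[OF r p True] by (simp add: row_edge_def)
next
  case False
  have "(k, l) \<notin> level T (Suc v)" using y by (auto simp: in_level)
  then show ?thesis using False put_levels(4,5)[OF r p False, of "Suc v"] y v by (simp add: row_edge_def cell_def)
qed

text \<open>If \<open>x\<close> was written, or the edge still stands in row \<open>k\<close>, the
  local rule sends the bumped value into row \<open>k + 1\<close> just as the insertion does. If the
  edge stands lower in column \<open>l - 1\<close>, the value is inserted in the same column
  \<open>l\<close> and blocked by its own copy in row \<open>k\<close>, so the edge keeps following
  the bottom of column \<open>l - 1\<close>.\<close>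

lemma step_turn:
  assumes r: "ready T k x" and p: "pos T k x l" and v: "x \<le> v" and y: "entry T k l = Some (Suc v)"
    and p2: "pos (put T k l x) (Suc k) (Suc v) l2"
  shows "cell False (below T (Suc v)) (level T (Suc v)) (row_edge T k x l v) = init (put T k l x) (Suc k) (Suc v) l2"
proof -
  have s: "sym_inc T" using r unfolding ready_def by blast
  have s1: "sym_inc (put T k l x)" using sym_inc_put[OF s] .
  note yo = young_below[OF s, of "Suc v"] and ro = rook_level[OF s, of "Suc v"]
  have kl: "(k, l) \<in> level T (Suc v)" using y by (simp add: in_level)
  have kl': "(Suc k, l) \<notin> below T (Suc v)" using rook_corner[OF ro kl] unfolding corner_def by blast
  show ?thesis
  proof (cases "blocked T k x l")
    case False
    note pl = put_levels[OF r p False]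
    have l2: "l2 \<le> l" using p2 kl' unfolding pos_def pl(8)[OF y order_refl] by (meson not_le)
    have a: "entry (put T k l x) k l = Some x" using pl(1)[of k l] by simp
    have "(k, l2) \<notin> level (put T k l x) (Suc v)"
      using entry_mono[OF s1 a order_refl l2] v by (auto simp: in_level)
    then have "init (put T k l x) (Suc k) (Suc v) l2 = row_rule (Suc k) (below (put T k l x) (Suc v)) (level (put T k l x) (Suc v))"
      by (intro init_row_rule[OF s1 p2]) simp
    also have "\<dots> = row_rule (Suc k) (below T (Suc v)) (level T (Suc v) - {(k, l), (l, k)})"
      using pl(7,8)[OF y] by simp
    finally show ?thesis using False kl by (simp add: row_edge_def cell_def)
  next
    case True
    have T1: "put T k l x = T" by (rule put_id[OF r p True])
    note p2 = p2[unfolded T1]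
    obtain l' m where lm: "l = Suc l'" "m = len (below T v) l' - 1" "(m, l') \<in> below T v" "(Suc m, l') \<notin> below T v" "k \<le> m"
      "(k, l') \<in> below T v"
      using blocked_bottom[OF r p True v] by blast
    have e: "row_edge T k x l v = Some ((m, l'), False)" using True lm(1,2) by (simp add: row_edge_def old_edge_def)
    have l2: "l2 \<le> l" using p2 kl' unfolding pos_def by (meson not_le)
    show ?thesis
    proof (cases "(m, l) \<in> level T (Suc v)")
      case t: True
      have "m = k"
      proof (rule ccontr)
        assume "m \<noteq> k"
        then have "Suc k \<le> m" using lm by simp
        moreover have "(m, l) \<in> below T (Suc v)" using t level_below by blast
        ultimately have "(Suc k, l) \<in> below T (Suc v)" using young_mono[OF yo] by blast
        then show False using kl' by blast
      qed
      have "(\<exists>l'. l2 = Suc l' \<and> (Suc k, l') \<in> level T (Suc v)) \<or> \<not> (\<exists>k'. Suc k = Suc k' \<and> (k', l2) \<in> level T (Suc v))"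
      proof (cases "l2 = l")
        case True
        then have "(Suc k, l') \<in> below T (Suc v)" using p2 lm(1) unfolding pos_def by simp
        then have "(Suc k, l') \<in> level T (Suc v)" using below_Suc[of T v] lm(4) \<open>m = k\<close> by blast
        then show ?thesis using True lm(1) by blast
      next
        case False
        then have "(k, l2) \<noteq> (k, l)" by simp
        then have "(k, l2) \<notin> level T (Suc v)" using entry_mono[OF s y order_refl l2] by (auto simp: in_level)
        then show ?thesis by simp
      qed
      from init_row_rule[OF s p2 this] show ?thesis using t lm(1) e \<open>m = k\<close> unfolding T1 by (simp add: cell_def)
    next
      case f: False
      then have "m \<noteq> k" using kl by blast
      then have "Suc k \<le> m" using lm by simp
      then have "(Suc k, l') \<in> below T v" using young_mono[OF young_below[OF s] lm(3)] by blast
      then have q: "(Suc k, l') \<in> below T (Suc v)" using below_Suc by blast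
      have "pos T (Suc k) (Suc v) l" unfolding pos_def
        using kl' young_mono[OF yo q] lm(1) by (metis less_Suc_eq_le order_refl)
      then have "l2 = l" using pos_unique p2 by blast
      then have "blocked T (Suc k) (Suc v) l2" using kl unfolding blocked_def by blast
      then show ?thesis using stay_below[OF s lm(2,3)] f lm(1) e \<open>l2 = l\<close> unfolding T1 by (simp add: init_def)
    qed
  qed
qed

lemma old_edge_const: assumes "sym_inc T" obtains V where "\<And>v. V \<le> v \<Longrightarrow> old_edge T v l = old_edge T V l"
  using below_bound[OF assms] unfolding old_edge_def by (metis order_refl)

text \<open>Induction along the bumping path: the edges of the current row serve below the bumped
  value \<open>y\<close>, those of the remaining insertion from \<open>y\<close> on, and
  \<open>init\<close> is the state at the joint.\<close>

lemma sym_ins_chain: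
  assumes "sym_ins T k x T'" "ready T k x"
  shows "\<exists>E l. pos T k x l \<and> (below T' x, level T' x, E x) = init T k x l \<and>
    (\<forall>v<x. below T' v = below T v \<and> level T' v = level T v) \<and>
    (\<forall>v\<ge>x. cell False (below T (Suc v)) (level T (Suc v)) (E v) = (below T' (Suc v), level T' (Suc v), E (Suc v))) \<and>
    (\<exists>V \<beta>. \<forall>v\<ge>V. E v = Some \<beta>)"
  using assms
proof (induction rule: sym_ins.induct)
  case (stop T k x l)
  note r = stop(3) and p = stop(1)
  have s: "sym_inc T" using r unfolding ready_def by blast
  have "\<exists>V \<beta>. \<forall>v\<ge>V. row_edge T k x l v = Some \<beta>"
  proof (cases "blocked T k x l")
    case True
    obtain V where V: "\<And>v. V \<le> v \<Longrightarrow> old_edge T v l = old_edge T V l" using old_edge_const[OF s] by blast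
    have "\<forall>v\<ge>V. row_edge T k x l v = old_edge T V l" unfolding row_edge_def if_P[OF True] using V by blast
    then show ?thesis unfolding old_edge_def by blast
  next
    case False
    then show ?thesis unfolding row_edge_def by (intro exI[of _ 0] exI[of _ "((k, l), True)"]) simp
  qed
  moreover have "below (put T k l x) v = below T v \<and> level (put T k l x) v = level T v" if "v < x" for v
    using put_levels(2,3)[OF r p _ that] put_id[OF r p] by (cases "blocked T k x l") auto
  ultimately show ?case using p init_put[OF r p] step_cell[OF r p] stop(2)
    by (intro exI[of _ "row_edge T k x l"] exI[of _ l]) auto
next
  case (bump T k x l y T')
  note r = bump(5) and p = bump(1) and y = bump(2)
  have s: "sym_inc T" using r unfolding ready_def by blast
  have xy: "x < y" using pos_less[OF p y] .
  let ?T = "put T k l x"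
  obtain E2 l2 where I: "pos ?T (Suc k) y l2" "(below T' y, level T' y, E2 y) = init ?T (Suc k) y l2"
    "\<And>v. v < y \<Longrightarrow> below T' v = below ?T v \<and> level T' v = level ?T v"
    "\<And>v. v \<ge> y \<Longrightarrow> cell False (below ?T (Suc v)) (level ?T (Suc v)) (E2 v) = (below T' (Suc v), level T' (Suc v), E2 (Suc v))"
    "\<exists>V \<beta>. \<forall>v\<ge>V. E2 v = Some \<beta>"
    using bump.IH[OF ready_next[OF r p y]] by blast
  define E where "E v = (if v < y then row_edge T k x l v else E2 v)" for v
  have 1: "(below T' x, level T' x, E x) = init T k x l"
    using init_put[OF r p] I(3)[OF xy] xy by (simp add: E_def)
  have 2: "below T' v = below T v \<and> level T' v = level T v" if "v < x" for v
    using put_levels(2,3)[OF r p _ that] put_id[OF r p] I(3)[of v] xy that by (cases "blocked T k x l") auto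
  have 3: "cell False (below T (Suc v)) (level T (Suc v)) (E v) = (below T' (Suc v), level T' (Suc v), E (Suc v))"
    if v: "x \<le> v" for v
  proof -
    consider "Suc v < y" | "Suc v = y" | "y \<le> v" by linarith
    then show ?thesis
    proof cases
      case 1
      then show ?thesis using step_cell[OF r p v] y I(3)[OF 1] by (simp add: E_def)
    next
      case 2
      then show ?thesis using step_turn[OF r p v] y I(1,2) by (auto simp: E_def)
    next
      case 3
      have "below ?T (Suc v) = below T (Suc v) \<and> level ?T (Suc v) = level T (Suc v)"
        using put_levels(8,9)[OF r p _ y, of "Suc v"] put_id[OF r p] 3 by (cases "blocked T k x l") auto
      then show ?thesis using I(4)[OF 3] 3 by (simp add: E_def)
    qed
  qed
  obtain V \<beta> where "\<forall>v\<ge>V. E2 v = Some \<beta>" using I(5) by blast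
  then have "\<forall>v\<ge>max V y. E v = Some \<beta>" by (simp add: E_def)
  then show ?case using 1 2 3 p by blast
qed

lemma row_ins_growth:
  assumes s: "sym_inc T" and x: "1 \<le> x" and i: "row_ins T 0 x T'"
  shows "sym_inc T'" "\<exists>\<beta>. growth T x T' \<beta>"
proof -
  have si: "sym_ins T 0 x T'" using row_ins_sym_ins[OF _ i] s unfolding row_ready_def by simp
  show "sym_inc T'" using sym_ins_increasing[OF si s] .
  have "ready T 0 x" using s x unfolding ready_def by simp
  from sym_ins_chain[OF si this] obtain E2 l V \<beta> where I: "pos T 0 x l" "(below T' x, level T' x, E2 x) = init T 0 x l"
    "\<And>v. v < x \<Longrightarrow> below T' v = below T v \<and> level T' v = level T v"
    "\<And>v. v \<ge> x \<Longrightarrow> cell False (below T (Suc v)) (level T (Suc v)) (E2 v) = (below T' (Suc v), level T' (Suc v), E2 (Suc v))"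
    "\<forall>v\<ge>V. E2 v = Some \<beta>"
    by blast
  define E where "E v = (if v < x then None else E2 v)" for v
  have "chain T x T' E"
    unfolding chain_def
  proof (intro conjI allI)
    show "E 0 = None" using x by (simp add: E_def)
    fix v
    consider "Suc v < x" | "Suc v = x" | "x \<le> v" by linarith
    then show "cell (Suc v = x) (below T (Suc v)) (level T (Suc v)) (E v) = (below T' (Suc v), level T' (Suc v), E (Suc v))"
    proof cases
      case 1
      then show ?thesis using I(3)[of "Suc v"] by (simp add: E_def cell_def)
    next
      case 2
      \<comment> \<open>Row 0 has no row above it, so the exceptional case of
        \<open>init_row_rule\<close> cannot occur.\<close>
      then show ?thesis using I(2) init_row_rule[OF s I(1)] by (auto simp: E_def cell_def)
    next
      case 3
      then show ?thesis using I(4)[of v] by (simp add: E_def)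
    qed
  qed
  moreover have "\<forall>v\<ge>max V x. E v = Some \<beta>" using I(5) by (simp add: E_def)
  ultimately show "\<exists>\<beta>. growth T x T' \<beta>" unfolding growth_def by blast
qed

section \<open>Words and sequences of marked corners\<close>

text \<open>A mark \<open>((p, q), e)\<close> with \<open>q < p\<close> stands for a primed letter in the box \<open>(q, p)\<close> of the shifted shape, and
one with \<open>p \<le> q\<close> for an unprimed letter in the box \<open>(p, q)\<close>; \<open>e\<close> tells whether the box is new.\<close>

type_synonym mark = "(nat \<times> nat) \<times> bool"

inductive marking :: "mark list \<Rightarrow> diagram \<Rightarrow> bool" where
  marking_Nil: "marking [] {}"
| marking_snoc: "marking ms (del (Some ((p, q), e)) M) \<Longrightarrow> young M \<Longrightarrow> corner M p q \<Longrightarrow> marking (ms @ [((p, q), e)]) M"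

text \<open>Plays the part of the pair of insertion and recording tableau, the latter kept as the
  list of terminating corners.\<close>

inductive runs :: "nat list \<Rightarrow> itab \<Rightarrow> mark list \<Rightarrow> bool" where
  runs_Nil: "runs [] Map.empty []"
| runs_snoc: "runs w T ms \<Longrightarrow> 1 \<le> x \<Longrightarrow> sym_inc T' \<Longrightarrow> growth T x T' \<beta> \<Longrightarrow> runs (w @ [x]) T' (ms @ [\<beta>])"

lemma sym_inc_empty: "sym_inc Map.empty"
  by (simp add: sym_inc_def entry_def)

lemma runs_increasing: "runs w T ms \<Longrightarrow> sym_inc T"
  by (induction rule: runs.induct) (auto simp: sym_inc_empty)

lemma runs_length: "runs w T ms \<Longrightarrow> length w = length ms"
  by (induction rule: runs.induct) auto

lemma shape_empty: "sym_inc T \<Longrightarrow> shape T = {} \<longleftrightarrow> T = Map.empty"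
proof
  assume s: "sym_inc T" and e: "shape T = {}"
  show "T = Map.empty"
  proof
    fix b :: "nat \<times> nat"
    obtain i j where b: "b = (i, j)" by fastforce
    have "T (i, j) \<noteq> Some v" for v using tab_entry[OF s, of i j v] e in_shape[of i j T] by blast
    then show "T b = None" using b by (cases "T b") auto
  qed
qed (auto simp: shape_def entry_def)

lemma growth_shape: assumes s: "sym_inc T" "1 \<le> x" "sym_inc T'" and g: "growth T x T' ((p, q), e)"
  shows "corner (shape T') p q" "shape T = del (Some ((p, q), e)) (shape T')"
proof -
  obtain E V where c: "chain T x T' E" and V: "\<And>v. V \<le> v \<Longrightarrow> E v = Some ((p, q), e)"
    using g unfolding growth_def by blast
  obtain V1 where V1: "\<And>v. V1 \<le> v \<Longrightarrow> below T v = shape T" "\<And>v. V1 < v \<Longrightarrow> level T v = {}" using below_bound[OF s(1)] by blast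
  obtain V2 where V2: "\<And>v. V2 \<le> v \<Longrightarrow> below T' v = shape T'" "\<And>v. V2 < v \<Longrightarrow> level T' v = {}" using below_bound[OF s(3)] by blast
  define v where "v = max V (max V1 V2)"
  note f = chain_facts[OF s(1,2) c, of v]
  have e: "E v = Some ((p, q), e)" "below T v = shape T" "below T' v = shape T'"
    using V V1(1) V2(1) by (simp_all add: v_def)
  show "corner (shape T') p q" using f(2) e by simp
  show "shape T = del (Some ((p, q), e)) (shape T')"
    using del_app[OF young_below[OF s(1)] f(1)] f(3) e by simp
qed

lemma runs_marking: "runs w T ms \<Longrightarrow> marking ms (shape T)"
proof (induction rule: runs.induct)
  case runs_Nil
  then show ?case using shape_empty[OF sym_inc_empty] marking_Nil by simp
next
  case (runs_snoc w T ms x T' \<beta>)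
  obtain p q e where b: "\<beta> = ((p, q), e)" by (cases \<beta>) auto
  have s: "sym_inc T" using runs_increasing runs_snoc by blast
  note g = growth_shape[OF s runs_snoc(2,3), of p q e]
  show ?case unfolding b
    using marking_snoc[of ms p q e "shape T'"] g runs_snoc b young_shape by simp
qed

text \<open>Growth does not mention insertion; so backwards the insertion, which always has a
  result, is carried out and its result identified by \<open>growth_unique\<close>.\<close>

lemma runs_hecke: "(\<forall>x\<in>set w. 1 \<le> x) \<and> hecke_P w T \<longleftrightarrow> (\<exists>ms. runs w T ms)"
proof
  assume *: "(\<forall>x\<in>set w. 1 \<le> x) \<and> hecke_P w T"
  then have "hecke_P w T" "\<forall>x\<in>set w. 1 \<le> x" by auto
  then show "\<exists>ms. runs w T ms"
  proof (induction rule: hecke_P.induct)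
    case hecke_Nil
    show ?case using runs_Nil by blast
  next
    case (hecke_snoc w T x T')
    then obtain ms where r: "runs w T ms" by auto
    have x: "1 \<le> x" using hecke_snoc by simp
    note g = row_ins_growth[OF runs_increasing[OF r] x hecke_snoc(2)]
    show ?case using runs_snoc[OF r x g(1)] g(2) by blast
  qed
next
  assume "\<exists>ms. runs w T ms"
  then obtain ms where "runs w T ms" by blast
  then show "(\<forall>x\<in>set w. 1 \<le> x) \<and> hecke_P w T"
  proof (induction rule: runs.induct)
    case runs_Nil
    show ?case using hecke_Nil by simp
  next
    case (runs_snoc w T ms x T' \<beta>)
    have s: "sym_inc T" using runs_increasing runs_snoc by blast
    obtain T2 where T2: "row_ins T 0 x T2" using row_ins_total[OF s] by blast
    have "T2 = T'" using growth_unique(1)[OF _ runs_snoc(4)] row_ins_growth[OF s runs_snoc(2) T2] runs_snoc(3) by blast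
    then show ?case using T2 runs_snoc hecke_P.hecke_snoc by auto
  qed
qed

lemma runs_snocD:
  assumes "runs (w @ [x]) T' ms'"
  obtains ms \<beta> T where "ms' = ms @ [\<beta>]" "runs w T ms" "1 \<le> x" "sym_inc T'" "sym_inc T" "growth T x T' \<beta>"
  using assms by (cases rule: runs.cases) (auto dest: runs_increasing)

lemma runs_unique: "runs w T1 ms1 \<Longrightarrow> runs w T2 ms2 \<Longrightarrow> T1 = T2 \<and> ms1 = ms2"
proof (induction w arbitrary: T1 T2 ms1 ms2 rule: rev_induct)
  case Nil
  from Nil(1) have "T1 = Map.empty" "ms1 = []" by (cases rule: runs.cases; simp)+
  moreover from Nil(2) have "T2 = Map.empty" "ms2 = []" by (cases rule: runs.cases; simp)+
  ultimately show ?case by simp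
next
  case (snoc x w)
  obtain r1 b1 S1 where 1: "ms1 = r1 @ [b1]" "runs w S1 r1" "sym_inc T1" "growth S1 x T1 b1"
    using runs_snocD[OF snoc(2)] by metis
  obtain r2 b2 S2 where 2: "ms2 = r2 @ [b2]" "runs w S2 r2" "sym_inc T2" "growth S2 x T2 b2"
    using runs_snocD[OF snoc(3)] by metis
  have "S1 = S2" "r1 = r2" using snoc.IH 1 2 by blast+
  then show ?case using growth_unique[of S1 x T1 b1 T2 b2] 1 2 by simp
qed

lemma runs_inj: "runs w1 T ms \<Longrightarrow> runs w2 T ms \<Longrightarrow> w1 = w2"
proof (induction w1 arbitrary: w2 T ms rule: rev_induct)
  case Nil
  then show ?case using runs_length[OF Nil(1)] runs_length[OF Nil(2)] by simp
next
  case (snoc x w)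
  have "w2 \<noteq> []" using runs_length[OF snoc(2)] runs_length[OF snoc(3)] by auto
  then obtain v y where v: "w2 = v @ [y]" by (metis rev_exhaust)
  obtain r1 b1 S1 where 1: "ms = r1 @ [b1]" "runs w S1 r1" "1 \<le> x" "sym_inc T" "sym_inc S1" "growth S1 x T b1"
    using runs_snocD[OF snoc(2)] by metis
  obtain r2 b2 S2 where 2: "ms = r2 @ [b2]" "runs v S2 r2" "1 \<le> y" "sym_inc S2" "growth S2 y T b2"
    using runs_snocD[OF snoc(3)[unfolded v]] by metis
  have b: "r1 = r2" "b1 = b2" using 1 2 by auto
  have "S1 = S2" "x = y" using growth_inj[of S1 x T b1 S2 y] 1 2 b by blast+
  then show ?case using snoc.IH[of S1 r1 v] 1 2 b v by simp
qed

text \<open>Peels off the last mark with \<open>growth_surj\<close>. Together with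
  \<open>runs_inj\<close> it makes the words producing \<open>T\<close> correspond to all markings
  of its shape, whatever its entries are.\<close>

lemma runs_surj: "marking ms M \<Longrightarrow> sym_inc T \<Longrightarrow> shape T = M \<Longrightarrow> \<exists>w. runs w T ms"
proof (induction arbitrary: T rule: marking.induct)
  case marking_Nil
  then show ?case using shape_empty runs_Nil by blast
next
  case (marking_snoc ms p q e M)
  obtain S x where S: "sym_inc S" "1 \<le> x" "growth S x T ((p, q), e)" "shape S = del (Some ((p, q), e)) (shape T)"
    using growth_surj[OF marking_snoc(5), of p q e] marking_snoc by metis
  then obtain w where "runs w S ms" using marking_snoc by blast
  then show ?case using runs_snoc S marking_snoc by blast
qed

lemma marking_subset: "marking ms M \<Longrightarrow> set ms \<subseteq> M \<times> UNIV"
proof (induction rule: marking.induct)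
  case (marking_snoc ms p q e M)
  then show ?case by (auto simp: corner_def del_Some split: if_splits)
qed simp

text \<open>The rows of the two edges are compared upwards from the later of their starting levels.
  The edge starting there begins in row 0: if it is the second, it is weakly above the first; if it
  is the first, \<open>stacked_row_gt\<close> puts the other strictly below it at once.\<close>

lemma growth_descent:
  assumes s0: "sym_inc T0" and x: "1 \<le> x" and s1: "sym_inc T1" and y: "1 \<le> y"
    and g1: "growth T0 x T1 ((p1, q1), f1)" and g2: "growth T1 y T2 ((p2, q2), f2)"
  shows "x \<le> y \<longleftrightarrow> p2 \<le> p1"
proof -
  obtain a V1 where c1: "chain T0 x T1 a" and V1: "\<And>v. V1 \<le> v \<Longrightarrow> a v = Some ((p1, q1), f1)"
    using g1 unfolding growth_def by blast
  obtain b V2 where c2: "chain T1 y T2 b" and V2: "\<And>v. V2 \<le> v \<Longrightarrow> b v = Some ((p2, q2), f2)"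
    using g2 unfolding growth_def by blast
  note F1 = chain_facts[OF s0 x c1] and F2 = chain_facts[OF s1 y c2]
  have in1: "edge_in (below T0 (Suc v) - level T0 (Suc v)) (a v)" for v using F1(1) below_Suc by simp
  have in2: "edge_in (below T1 (Suc v) - level T1 (Suc v)) (b v)" for v using F2(1) below_Suc by simp
  define v where "v = max (max V1 V2) (max x y)"
  have v: "a v = Some ((p1, q1), f1)" "b v = Some ((p2, q2), f2)" "x \<le> v" "y \<le> v" using V1 V2 by (simp_all add: v_def)
  have le: "\<exists>k j e k2 j2 f. a v = Some ((k, j), e) \<and> b v = Some ((k2, j2), f) \<and> k2 \<le> k" if xy: "x \<le> y" and v: "y \<le> v" for v
    using v
  proof (induction rule: dec_induct)
    case base
    obtain u where u: "y = Suc u" using y by (cases y) auto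
    obtain q e where "b y = Some ((0, q), e)"
      using cell_row(2)[OF young_below[OF s1] rook_level[OF s1] in2 F2(5) F2(7), of u] u by auto
    moreover have "a y \<noteq> None" using F1(4)[of y] xy by simp
    then obtain k j e where "a y = Some ((k, j), e)" by (cases "a y" rule: edge_cases) auto
    ultimately show ?case by simp
  next
    case (step v)
    then obtain k j e k2 j2 f where s: "a v = Some ((k, j), e)" "b v = Some ((k2, j2), f)" "k2 \<le> k" by blast
    have n: "(Suc v = y) = False" using step by simp
    show ?case
      by (rule stacked_row_le[OF young_below[OF s0] rook_level[OF s0] in1 F1(7) F1(5) in2 F2(7)[of v, unfolded n] s])
  qed
  have gt: "\<exists>k j e k2 j2 f. a v = Some ((k, j), e) \<and> b v = Some ((k2, j2), f) \<and> k < k2" if xy: "y < x" and v: "x \<le> v" for v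
    using v
  proof (induction rule: dec_induct)
    case base
    obtain u where u: "x = Suc u" using x by (cases x) auto
    have "b u \<noteq> None" using F2(4)[of u] xy u by simp
    then obtain k2 j2 f where s: "b u = Some ((k2, j2), f)" by (cases "b u" rule: edge_cases) auto
    have n: "(Suc u = y) = False" using xy u by simp
    show ?case unfolding u
      by (rule stacked_row_gt[OF young_below[OF s0] rook_level[OF s0] in1 F1(7) F1(5) in2 F2(7)[of u, unfolded n] s])
        (use u in simp)
  next
    case (step v)
    then obtain k j e k2 j2 f where s: "a v = Some ((k, j), e)" "b v = Some ((k2, j2), f)" "k < k2" by blast
    have n: "(Suc v = y) = False" using step xy by simp
    show ?case
      by (rule stacked_row_gt[OF young_below[OF s0] rook_level[OF s0] in1 F1(7) F1(5) in2 F2(7)[of v, unfolded n] s(2)])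
        (use s in simp)
  qed
  show ?thesis
  proof
    assume "x \<le> y"
    from le[OF this v(4)] show "p2 \<le> p1" using v by simp
  next
    assume p: "p2 \<le> p1"
    show "x \<le> y"
    proof (rule ccontr)
      assume "\<not> x \<le> y"
      then have "y < x" by simp
      from gt[OF this v(3)] show False using v p by simp
    qed
  qed
qed

lemma runs_descents: "runs w T ms \<Longrightarrow> Suc i < length w \<Longrightarrow> w ! i \<le> w ! Suc i \<longleftrightarrow> fst (fst (ms ! Suc i)) \<le> fst (fst (ms ! i))"
proof (induction rule: runs.induct)
  case (runs_snoc w T ms x T' \<beta>)
  have len: "length w = length ms" using runs_length runs_snoc by blast
  show ?case
  proof (cases "Suc i < length w")
    case True
    then show ?thesis using runs_snoc len by (simp add: nth_append)
  next
    case False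
    then have i: "length w = Suc i" using runs_snoc by simp
    then have "w \<noteq> []" by auto
    then obtain v y where v: "w = v @ [y]" by (metis rev_exhaust)
    obtain r b S where 1: "ms = r @ [b]" "runs v S r" "1 \<le> y" "sym_inc T" "sym_inc S" "growth S y T b"
      using runs_snocD[OF runs_snoc(1)[unfolded v]] by metis
    obtain p1 q1 f1 p2 q2 f2 where b: "b = ((p1, q1), f1)" "\<beta> = ((p2, q2), f2)" by (cases b, cases \<beta>) auto
    have "y \<le> x \<longleftrightarrow> p2 \<le> p1"
      using growth_descent[OF 1(5,3,4) runs_snoc(2), of p1 q1 f1 T' p2 q2 f2] 1(6) runs_snoc(4) b by simp
    moreover have "length v = i" "length r = i" using i v 1 len by auto
    ultimately show ?thesis using v 1(1) b by (simp add: nth_append)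
  qed
qed simp

section \<open>Weak set-valued tableaux as sequences of marked corners\<close>

type_synonym mtab = "nat \<times> nat \<Rightarrow> nat multiset"

definition box :: "nat \<Rightarrow> nat \<Rightarrow> nat \<times> nat" where "box p q = (min p q, max p q)"

definition upper :: "diagram \<Rightarrow> diagram" where "upper M = {(i, j) \<in> M. i \<le> j}"

definition code :: "nat \<Rightarrow> nat \<Rightarrow> nat \<Rightarrow> nat" where
  "code k p q = (if q < p then primed_letter k else unprimed_letter k)"

text \<open>Places a primed letter in the mirror box below the diagonal. The column condition on
  unprimed letters and the row condition on primed ones then become one: a code has at most one box
  in each doubled column.\<close>

definition occ :: "mtab \<Rightarrow> nat \<Rightarrow> nat \<Rightarrow> nat \<Rightarrow> bool" where
  "occ Q c p q \<longleftrightarrow> c \<in># Q (box p q) \<and> (odd c \<longleftrightarrow> q < p)"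

definition sym_wsvt :: "diagram \<Rightarrow> mtab \<Rightarrow> bool" where
  "sym_wsvt M Q \<longleftrightarrow> (\<forall>b. Q b \<noteq> {#} \<longleftrightarrow> b \<in> upper M) \<and> (\<forall>b c. c \<in># Q b \<longrightarrow> 1 \<le> c) \<and>
     (\<forall>i j c d. c \<in># Q (i, j) \<longrightarrow> d \<in># Q (i, Suc j) \<longrightarrow> c \<le> d) \<and>
     (\<forall>i j c d. c \<in># Q (i, j) \<longrightarrow> d \<in># Q (Suc i, j) \<longrightarrow> c \<le> d) \<and>
     (\<forall>i c. c \<in># Q (i, i) \<longrightarrow> even c) \<and>
     (\<forall>c p p' q. occ Q c p q \<longrightarrow> occ Q c p' q \<longrightarrow> p = p')"

abbreviation add_entry :: "nat \<Rightarrow> nat \<Rightarrow> nat \<Rightarrow> mtab \<Rightarrow> mtab" where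
  "add_entry k p q Q \<equiv> Q(box p q := add_mset (code k p q) (Q (box p q)))"

text \<open>Letters weakly increase and, within one letter, doubled rows weakly decrease, so primed
  boxes precede unprimed ones. This matches the criterion for a non-descent of the word.\<close>

inductive filling :: "(nat \<times> mark) list \<Rightarrow> diagram \<Rightarrow> mtab \<Rightarrow> bool" where
  filling_Nil: "filling [] {} (\<lambda>_. {#})"
| filling_snoc: "filling R (del (Some ((p, q), e)) M) Q \<Longrightarrow> young M \<Longrightarrow> corner M p q \<Longrightarrow> 1 \<le> k \<Longrightarrow>
    (\<And>k' p' q' e'. R \<noteq> [] \<Longrightarrow> last R = (k', ((p', q'), e')) \<Longrightarrow> k' < k \<or> k' = k \<and> p \<le> p') \<Longrightarrow>
    filling (R @ [(k, ((p, q), e))]) M (add_entry k p q Q)"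

lemmas code_defs = code_def primed_letter_def unprimed_letter_def

lemma box_simps: "p \<le> q \<Longrightarrow> box p q = (p, q)" "q \<le> p \<Longrightarrow> box p q = (q, p)"
  by (simp_all add: box_def min_absorb1 max_absorb2 min_absorb2 max_absorb1)

lemma box_eq: "box p q = box p' q' \<longleftrightarrow> (p = p' \<and> q = q') \<or> (p = q' \<and> q = p')"
  by (cases "p \<le> q"; cases "p' \<le> q'") (auto simp: box_simps)

lemma box_upper: "young M \<Longrightarrow> box p q \<in> upper M \<longleftrightarrow> (p, q) \<in> M"
  using young_swap[of M p q] by (cases "p \<le> q") (auto simp: box_simps upper_def)

lemma box_self: "(i, j) \<in> upper M \<Longrightarrow> box i j = (i, j)"
  by (auto simp: upper_def box_simps)

lemma code_odd: "1 \<le> k \<Longrightarrow> odd (code k p q) \<longleftrightarrow> q < p"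
  by (auto simp: code_defs)

lemma code_pos: "1 \<le> k \<Longrightarrow> 1 \<le> code k p q"
  by (auto simp: code_defs)

lemma sym_wsvtI:
  assumes "\<And>b. Q b \<noteq> {#} \<longleftrightarrow> b \<in> upper M" "\<And>b c. c \<in># Q b \<Longrightarrow> 1 \<le> c"
    "\<And>i j c d. c \<in># Q (i, j) \<Longrightarrow> d \<in># Q (i, Suc j) \<Longrightarrow> c \<le> d"
    "\<And>i j c d. c \<in># Q (i, j) \<Longrightarrow> d \<in># Q (Suc i, j) \<Longrightarrow> c \<le> d"
    "\<And>i c. c \<in># Q (i, i) \<Longrightarrow> even c" "\<And>c p p' q. occ Q c p q \<Longrightarrow> occ Q c p' q \<Longrightarrow> p = p'"
  shows "sym_wsvt M Q"
  unfolding sym_wsvt_def by (intro conjI allI impI; (rule assms, assumption+ | rule assms))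

lemma sym_wsvtD:
  assumes "sym_wsvt M Q"
  shows "Q b \<noteq> {#} \<longleftrightarrow> b \<in> upper M" "c \<in># Q b \<Longrightarrow> 1 \<le> c"
    "c \<in># Q (i, j) \<Longrightarrow> d \<in># Q (i, Suc j) \<Longrightarrow> c \<le> d"
    "c \<in># Q (i, j) \<Longrightarrow> d \<in># Q (Suc i, j) \<Longrightarrow> c \<le> d"
    "c \<in># Q (i, i) \<Longrightarrow> even c" "occ Q c p q \<Longrightarrow> occ Q c p' q \<Longrightarrow> p = p'"
proof -
  note w = assms[unfolded sym_wsvt_def]
  show "Q b \<noteq> {#} \<longleftrightarrow> b \<in> upper M" using w[THEN conjunct1] by blast
  show "c \<in># Q b \<Longrightarrow> 1 \<le> c" using w[THEN conjunct2, THEN conjunct1] by blast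
  show "c \<in># Q (i, j) \<Longrightarrow> d \<in># Q (i, Suc j) \<Longrightarrow> c \<le> d" using w[THEN conjunct2, THEN conjunct2, THEN conjunct1] by blast
  show "c \<in># Q (i, j) \<Longrightarrow> d \<in># Q (Suc i, j) \<Longrightarrow> c \<le> d"
    using w[THEN conjunct2, THEN conjunct2, THEN conjunct2, THEN conjunct1] by blast
  show "c \<in># Q (i, i) \<Longrightarrow> even c"
    using w[THEN conjunct2, THEN conjunct2, THEN conjunct2, THEN conjunct2, THEN conjunct1] by blast
  show "occ Q c p q \<Longrightarrow> occ Q c p' q \<Longrightarrow> p = p'"
    using w[THEN conjunct2, THEN conjunct2, THEN conjunct2, THEN conjunct2, THEN conjunct2] by blast
qed

lemma sym_wsvt_nonempty: "sym_wsvt M Q \<Longrightarrow> c \<in># Q b \<Longrightarrow> b \<in> upper M"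
  using sym_wsvtD(1) by fastforce

lemma sym_wsvt_ent: assumes "sym_wsvt M Q" "c \<in># Q (i, j)"
  obtains p q where "occ Q c p q" "box p q = (i, j)"
proof -
  have u: "(i, j) \<in> upper M" by (rule sym_wsvt_nonempty[OF assms])
  then have le: "i \<le> j" by (simp add: upper_def)
  show ?thesis
  proof (cases "even c")
    case True
    have "box i j = (i, j)" using box_self[OF u] .
    then show ?thesis using that[of i j] True le assms(2) by (simp add: occ_def)
  next
    case False
    have "i \<noteq> j" using sym_wsvtD(5)[OF assms(1), of c i] assms(2) False by blast
    then have "i < j" using le by simp
    moreover have "box j i = (i, j)" using le by (simp add: box_simps)
    ultimately show ?thesis using that[of j i] False assms(2) by (simp add: occ_def)
  qed
qed

lemma sym_wsvt_ent_in: assumes "young M" "sym_wsvt M Q" "occ Q c p q" shows "(p, q) \<in> M"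
proof -
  have "box p q \<in> upper M" using sym_wsvt_nonempty[OF assms(2)] assms(3) unfolding occ_def by blast
  then show ?thesis using box_upper assms(1) by blast
qed

section \<open>Adding the last letter, and recovering it from the tableau\<close>

lemma occ_add: assumes "1 \<le> k"
  shows "occ (add_entry k p q Q) c p' q' \<longleftrightarrow>
    occ Q c p' q' \<or> (c = code k p q \<and> p' = p \<and> q' = q)"
proof (cases "box p' q' = box p q")
  case True
  have "c = code k p q \<Longrightarrow> (odd c \<longleftrightarrow> q' < p') \<Longrightarrow> p' = p \<and> q' = q"
    using True code_odd[OF assms, of p q] unfolding box_eq by auto
  moreover have "odd (code k p q) \<longleftrightarrow> q < p" using code_odd[OF assms] .
  ultimately show ?thesis using True unfolding occ_def by (simp; blast)
next
  case False
  then have "\<not> (p' = p \<and> q' = q)" by auto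
  then show ?thesis using False unfolding occ_def by (simp; blast)
qed

text \<open>A code has at most one box in each doubled column, so the last column of the largest
  code singles out one box: that of the last letter added.\<close>

definition top_entry :: "mtab \<Rightarrow> nat \<Rightarrow> nat \<Rightarrow> nat \<Rightarrow> bool" where
  "top_entry Q C p q \<longleftrightarrow> occ Q C p q \<and> (\<forall>c p' q'. occ Q c p' q' \<longrightarrow> c < C \<or> c = C \<and> (q' < q \<or> p' = p \<and> q' = q))"

lemma del_subset: "del E M \<subseteq> M"
  by (cases "(E, M)" rule: del.cases) auto

lemma corner_max: assumes "young M" "corner M p q" "(p', q') \<in> M" "p \<le> p'" shows "q' \<le> q" "q \<le> q' \<Longrightarrow> p' = p \<and> q' = q"
proof -
  have "\<not> Suc q \<le> q'" using young_mono[OF assms(1,3,4), of "Suc q"] assms(2) unfolding corner_def by blast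
  then show 1: "q' \<le> q" by simp
  assume "q \<le> q'"
  then have "q' = q" using 1 by simp
  moreover have "\<not> Suc p \<le> p'" using young_mono[OF assms(1,3), of "Suc p" q] assms(2) \<open>q \<le> q'\<close> unfolding corner_def by blast
  ultimately show "p' = p \<and> q' = q" using assms(4) by simp
qed

lemma corner_upper: assumes "young M" "corner M p q" "box p q = (i, j)" shows "(i, Suc j) \<notin> M" "(Suc i, j) \<notin> M"
  using assms corner_sym[OF assms(1,2)] by (cases "p \<le> q"; auto simp: box_simps corner_def)+

text \<open>For a larger letter this is clear. For an equal letter the new corner lies weakly above
  the previous box, hence weakly right of it: the code can change only from primed to unprimed, and
  if it stays the same, the column does not decrease.\<close>

lemma top_entry_add:
  assumes y: "young M" and c: "corner M p q" and k: "1 \<le> k" and w: "sym_wsvt M0 Q" and y0: "young M0" and sub: "M0 \<subseteq> M"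
    and emp: "R = [] \<Longrightarrow> Q = (\<lambda>_. {#})"
    and top: "\<And>k' p' q' e'. R \<noteq> [] \<Longrightarrow> last R = (k', ((p', q'), e')) \<Longrightarrow> 1 \<le> k' \<and> top_entry Q (code k' p' q') p' q'"
    and l: "\<And>k' p' q' e'. R \<noteq> [] \<Longrightarrow> last R = (k', ((p', q'), e')) \<Longrightarrow> k' < k \<or> k' = k \<and> p \<le> p'"
  shows "top_entry (add_entry k p q Q) (code k p q) p q"
    "\<And>c p' q'. occ Q c p' q' \<Longrightarrow> c < code k p q \<or> c = code k p q \<and> (q' < q \<or> p' = p \<and> q' = q)"
proof -
  show main: "c < code k p q \<or> c = code k p q \<and> (q' < q \<or> p' = p \<and> q' = q)" if e: "occ Q c p' q'" for c p' q'
  proof -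
    have R: "R \<noteq> []" using emp e unfolding occ_def by auto
    obtain k0 p0 q0 e0 where lr: "last R = (k0, ((p0, q0), e0))" by (metis prod.exhaust)
    have k0: "1 \<le> k0" and t: "top_entry Q (code k0 p0 q0) p0 q0" using top[OF R lr] by auto
    have c0: "c < code k0 p0 q0 \<or> c = code k0 p0 q0 \<and> (q' < q0 \<or> p' = p0 \<and> q' = q0)"
      using t e unfolding top_entry_def by blast
    show ?thesis
    proof (cases "k0 < k")
      case True
      then have "code k0 p0 q0 < code k p q" unfolding code_defs by (simp; linarith)
      then show ?thesis using c0 by auto
    next
      case False
      then have kk: "k0 = k" "p \<le> p0" using l[OF R lr] by auto
      have m0: "(p0, q0) \<in> M" using sym_wsvt_ent_in[OF y0 w, of "code k0 p0 q0" p0 q0] t sub unfolding top_entry_def by blast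
      note cm = corner_max[OF y c m0 kk(2)]
      have le: "code k0 p0 q0 \<le> code k p q"
      proof (cases "q < p")
        case True
        then have "q0 < p0" using cm kk by linarith
        then show ?thesis using True kk unfolding code_def by simp
      next
        case False
        then show ?thesis using kk unfolding code_defs by auto
      qed
      show ?thesis
      proof (cases "code k0 p0 q0 < code k p q")
        case True
        then show ?thesis using c0 by auto
      next
        case False
        then have eq: "code k0 p0 q0 = code k p q" using le by simp
        show ?thesis
        proof (cases "q \<le> q0")
          case True
          then have "p0 = p" "q0 = q" using cm by auto
          then show ?thesis using c0 eq by auto
        next
          case False
          then show ?thesis using c0 eq by auto
        qed
      qed
    qed
  qed
  show "top_entry (add_entry k p q Q) (code k p q) p q"
    unfolding top_entry_def occ_add[OF k] using main by blast
qed

text \<open>A corner has no right or lower neighbour and the new code is maximal, so the order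
  conditions survive; earlier equal codes lie left of column \<open>q\<close> or in the same box, so
  the column condition survives too.\<close>

lemma sym_wsvt_add:
  assumes y: "young M" and c: "corner M p q" and k: "1 \<le> k" and w: "sym_wsvt (del (Some ((p, q), e)) M) Q"
    and main: "\<And>c p' q'. occ Q c p' q' \<Longrightarrow> c < code k p q \<or> c = code k p q \<and> (q' < q \<or> p' = p \<and> q' = q)"
  shows "sym_wsvt M (add_entry k p q Q)" (is "sym_wsvt M ?Q")
proof -
  define C where "C = code k p q"
  define Q' where "Q' = ?Q"
  have Q': "c \<in># Q' b \<longleftrightarrow> c \<in># Q b \<or> (b = box p q \<and> c = C)" for c b by (auto simp: Q'_def C_def)
  have Cmax: "c \<le> C" if "c \<in># Q b" for c b
  proof -
    obtain i j where b: "b = (i, j)" by fastforce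
    from that have "c \<in># Q (i, j)" unfolding b .
    from sym_wsvt_ent[OF w this] obtain p' q' where "occ Q c p' q'" by blast
    then show ?thesis using main[of c p' q'] unfolding C_def by auto
  qed
  have supp: "b \<in> upper M" if "c \<in># Q b" for c b
  proof -
    have "b \<in> upper (del (Some ((p, q), e)) M)" by (rule sym_wsvt_nonempty[OF w that])
    then show ?thesis using del_subset[of "Some ((p, q), e)" M] unfolding upper_def by auto
  qed
  have tbu: "box p q \<in> upper M" using box_upper[OF y] c unfolding corner_def by blast
  obtain ti tj where t: "box p q = (ti, tj)" by fastforce
  note cu = corner_upper[OF y c t]
  have "Q' b \<noteq> {#} \<longleftrightarrow> b \<in> upper M" for b
  proof (cases "b = box p q")
    case True
    then show ?thesis using tbu by (simp add: Q'_def)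
  next
    case False
    obtain i j where b: "b = (i, j)" by fastforce
    have "b \<in> upper M \<longleftrightarrow> b \<in> upper (del (Some ((p, q), e)) M)"
      using False unfolding b by (cases "p \<le> q") (auto simp: upper_def del_Some box_simps)
    then show ?thesis using False sym_wsvtD(1)[OF w, of b] unfolding Q'_def by simp
  qed
  moreover have "1 \<le> c" if "c \<in># Q' b" for b c
    using that sym_wsvtD(2)[OF w, of c b] code_pos[OF k, of p q] unfolding Q' C_def by auto
  moreover have "c \<le> d" if "c \<in># Q' (i, j)" "d \<in># Q' (i, Suc j)" for i j c d
  proof -
    have "(i, Suc j) \<in> upper M" using that(2) supp tbu unfolding Q' by metis
    then have "(i, j) \<noteq> box p q" using cu unfolding t upper_def by auto
    then have "c \<in># Q (i, j)" using that(1) unfolding Q' by simp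
    then show ?thesis using that(2) sym_wsvtD(3)[OF w, of c i j d] Cmax[of c] unfolding Q' by blast
  qed
  moreover have "c \<le> d" if "c \<in># Q' (i, j)" "d \<in># Q' (Suc i, j)" for i j c d
  proof -
    have "(Suc i, j) \<in> upper M" using that(2) supp tbu unfolding Q' by metis
    then have "(i, j) \<noteq> box p q" using cu unfolding t upper_def by auto
    then have "c \<in># Q (i, j)" using that(1) unfolding Q' by simp
    then show ?thesis using that(2) sym_wsvtD(4)[OF w, of c i j d] Cmax[of c] unfolding Q' by blast
  qed
  moreover have "even c" if "c \<in># Q' (i, i)" for i c
  proof -
    have "even C" if "(i, i) = box p q" 
    proof -
      have "p = q" using that unfolding box_def by (metis max_def min_def prod.inject)
      then show ?thesis using code_odd[OF k, of p q] unfolding C_def by simp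
    qed
    then show ?thesis using that sym_wsvtD(5)[OF w, of c i] unfolding Q' by blast
  qed
  moreover have "p1 = p2" if "occ Q' c p1 q1" "occ Q' c p2 q1" for c p1 p2 q1
  proof -
    have 1: "occ Q c p1 q1 \<or> (c = C \<and> p1 = p \<and> q1 = q)" "occ Q c p2 q1 \<or> (c = C \<and> p2 = p \<and> q1 = q)"
      using that unfolding Q'_def C_def occ_add[OF k] by auto
    have "occ Q c p1 q1 \<Longrightarrow> occ Q c p2 q1 \<Longrightarrow> p1 = p2" by (rule sym_wsvtD(6)[OF w])
    then show ?thesis using 1 main[of c p1 q1] main[of c p2 q1] unfolding C_def by (metis less_irrefl)
  qed
  ultimately show ?thesis unfolding Q'_def[symmetric] by (rule sym_wsvtI)
qed

lemma filling_facts: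
  "filling R M Q \<Longrightarrow> young M \<and> sym_wsvt M Q \<and> (R = [] \<longrightarrow> Q = (\<lambda>_. {#})) \<and>
    (\<forall>k p q e. R \<noteq> [] \<longrightarrow> last R = (k, ((p, q), e)) \<longrightarrow> 1 \<le> k \<and> top_entry Q (code k p q) p q)"
proof (induction rule: filling.induct)
  case filling_Nil
  then show ?case by (auto simp: young_def sym_wsvt_def upper_def occ_def)
next
  case (filling_snoc R p q e M Q k)
  let ?m = "del (Some ((p, q), e)) M"
  have IH: "young ?m" "sym_wsvt ?m Q" "R = [] \<Longrightarrow> Q = (\<lambda>_. {#})"
    "\<And>k' p' q' e'. R \<noteq> [] \<Longrightarrow> last R = (k', ((p', q'), e')) \<Longrightarrow> 1 \<le> k' \<and> top_entry Q (code k' p' q') p' q'"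
    using filling_snoc(6) by blast+
  have t1: "top_entry (add_entry k p q Q) (code k p q) p q"
    by (rule top_entry_add(1)[OF filling_snoc(2-4) IH(2,1) del_subset]; (erule IH(3) | erule (1) IH(4) | erule (1) filling_snoc(5)))
  have t2: "c < code k p q \<or> c = code k p q \<and> (q' < q \<or> p' = p \<and> q' = q)" if "occ Q c p' q'" for c p' q'
    by (rule top_entry_add(2)[OF filling_snoc(2-4) IH(2,1) del_subset _ _ _ that]; (erule IH(3) | erule (1) IH(4) | erule (1) filling_snoc(5)))
  have "sym_wsvt M (add_entry k p q Q)"
    by (rule sym_wsvt_add[OF filling_snoc(2-4) IH(2) t2])
  then show ?case using t1 filling_snoc(2,4) by (simp del: fun_upd_apply)
qed

lemma code_inj: "1 \<le> k \<Longrightarrow> 1 \<le> k' \<Longrightarrow> code k p q = code k' p q \<Longrightarrow> k = k'"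
  unfolding code_defs by (auto split: if_splits)

lemma filling_snocD:
  assumes "filling (R @ [(k, ((p, q), e))]) M Q'"
  obtains Q where "filling R (del (Some ((p, q), e)) M) Q" "young M" "corner M p q" "1 \<le> k"
    "Q' = add_entry k p q Q"
    "\<And>k' p' q' e'. R \<noteq> [] \<Longrightarrow> last R = (k', ((p', q'), e')) \<Longrightarrow> k' < k \<or> k' = k \<and> p \<le> p'"
  using assms by (cases rule: filling.cases) auto

lemma filling_Nil_iff: "filling [] M Q \<longleftrightarrow> M = {} \<and> Q = (\<lambda>_. {#})"
  by (auto intro: filling_Nil elim: filling.cases)

lemma filling_last_unique:
  assumes y: "young M" "corner M p q" "sym_wsvt (del (Some ((p, q), e)) M) Q"
  shows "e \<longleftrightarrow> Q (box p q) = {#}"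
proof -
  have "young (del (Some ((p, q), e)) M)" using young_del_edge[OF y(1)] y(2) by simp
  then have "Q (box p q) \<noteq> {#} \<longleftrightarrow> (p, q) \<in> del (Some ((p, q), e)) M"
    using sym_wsvtD(1)[OF y(3)] box_upper by blast
  moreover have "(p, q) \<in> M" using y(2) unfolding corner_def by blast
  ultimately show ?thesis by (cases e) auto
qed

text \<open>The last letter must be the top entry of \<open>Q\<close>, and its bit is forced by
  whether the box becomes empty; removing the letter reduces to shorter lists.\<close>

lemma filling_unique: "filling R M Q \<Longrightarrow> filling R' M Q \<Longrightarrow> R = R'"
proof (induction R arbitrary: R' M Q rule: rev_induct)
  case Nil
  then have Q: "Q = (\<lambda>_. {#})" by (simp add: filling_Nil_iff)
  show ?case
  proof (rule ccontr)
    assume "[] \<noteq> R'"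
    then obtain R1 k p q e where R': "R' = R1 @ [(k, ((p, q), e))]" by (metis prod.exhaust rev_exhaust)
    from Nil(2)[unfolded R'] obtain Q1 where "Q = add_entry k p q Q1"
      using filling_snocD by blast
    then have "Q (box p q) \<noteq> {#}" by simp
    then show False using Q by simp
  qed
next
  case (snoc z R)
  obtain k p q e where z: "z = (k, ((p, q), e))" by (metis prod.exhaust)
  from snoc(2)[unfolded z] obtain Q1 where 1: "filling R (del (Some ((p, q), e)) M) Q1" "young M" "corner M p q" "1 \<le> k"
    "Q = add_entry k p q Q1"
    using filling_snocD by blast
  have "R' \<noteq> []"
  proof
    assume "R' = []"
    then have "Q (box p q) = {#}" using snoc(3) by (simp add: filling_Nil_iff)
    then show False using 1(5) by simp
  qed
  then obtain R2 k' p' q' e' where R': "R' = R2 @ [(k', ((p', q'), e'))]" by (metis prod.exhaust rev_exhaust)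
  from snoc(3)[unfolded R'] obtain Q2 where 2: "filling R2 (del (Some ((p', q'), e')) M) Q2" "corner M p' q'" "1 \<le> k'"
    "Q = Q2(box p' q' := add_mset (code k' p' q') (Q2 (box p' q')))"
    using filling_snocD by blast
  have t1: "top_entry Q (code k p q) p q" using filling_facts[OF snoc(2)] z by simp
  have t2: "top_entry Q (code k' p' q') p' q'" using filling_facts[OF snoc(3)] R' by simp
  have cc: "code k p q = code k' p' q'" and pq: "p = p'" "q = q'"
    using t1 t2 unfolding top_entry_def by (metis less_asym less_irrefl)+
  have kk: "k = k'" using code_inj[OF 1(4) 2(3)] cc pq by simp
  have QQ: "Q1 = Q2"
  proof
    fix b
    show "Q1 b = Q2 b"
    proof (cases "b = box p q")
      case True
      have "Q b = add_mset (code k p q) (Q1 b)" using 1(5) True by simp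
      moreover have "Q b = add_mset (code k p q) (Q2 b)" using 2(4) True pq kk by simp
      ultimately show ?thesis by simp
    next
      case False
      have "Q b = Q1 b" using 1(5) False by simp
      moreover have "Q b = Q2 b" using 2(4) False pq by simp
      ultimately show ?thesis by simp
    qed
  qed
  have "sym_wsvt (del (Some ((p, q), e)) M) Q1" using filling_facts[OF 1(1)] by blast
  from filling_last_unique[OF 1(2,3) this] have e1: "e \<longleftrightarrow> Q1 (box p q) = {#}" .
  have "sym_wsvt (del (Some ((p, q), e')) M) Q1" using filling_facts[OF 2(1)] pq QQ by blast
  from filling_last_unique[OF 1(2,3) this] have "e = e'" using e1 by blast
  then show ?case using snoc.IH[OF 1(1), of R2] 2(1) pq QQ kk z R' by simp
qed

section \<open>Every weak set-valued tableau arises from a filling\<close>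

lemma sym_wsvt_finite_entries: assumes "young M" "sym_wsvt M Q" shows "finite {c. \<exists>p q. occ Q c p q}" "finite {q. \<exists>p. occ Q c p q}"
proof -
  have fu: "finite (upper M)" using young_finite[OF assms(1)] by (auto simp: upper_def intro: finite_subset)
  have "{c. \<exists>p q. occ Q c p q} \<subseteq> (\<Union>b\<in>upper M. set_mset (Q b))"
    using sym_wsvt_nonempty[OF assms(2)] unfolding occ_def by blast
  then show "finite {c. \<exists>p q. occ Q c p q}" using fu finite_subset by (metis finite_UN finite_set_mset)
  have "{q. \<exists>p. occ Q c p q} \<subseteq> snd ` M" using sym_wsvt_ent_in[OF assms] by force
  then show "finite {q. \<exists>p. occ Q c p q}" using young_finite[OF assms(1)] finite_subset by blast
qed

lemma ex_top_entry: assumes y: "young M" and w: "sym_wsvt M Q" and n: "M \<noteq> {}" shows "\<exists>C p q. top_entry Q C p q"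
proof -
  obtain i j where "(i, j) \<in> M" using n by auto
  then have "Q (box i j) \<noteq> {#}" using sym_wsvtD(1)[OF w] box_upper[OF y] by blast
  then obtain c where c: "c \<in># Q (box i j)" by blast
  obtain a b where ab: "box i j = (a, b)" by fastforce
  from c have "c \<in># Q (a, b)" unfolding ab .
  from sym_wsvt_ent[OF w this] obtain p q where e: "occ Q c p q" by blast
  let ?C = "{c. \<exists>p q. occ Q c p q}"
  define C where "C = Max ?C"
  note f = sym_wsvt_finite_entries[OF y w]
  have "C \<in> ?C" unfolding C_def using f(1) e by (intro Max_in) auto
  then obtain p1 q1 where e1: "occ Q C p1 q1" by blast
  define q where "q = Max {q. \<exists>p. occ Q C p q}"
  have "q \<in> {q. \<exists>p. occ Q C p q}" unfolding q_def using f(2) e1 by (intro Max_in) auto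
  then obtain p where pq: "occ Q C p q" by blast
  have "c < C \<or> c = C \<and> (q' < q \<or> p' = p \<and> q' = q)" if e': "occ Q c p' q'" for c p' q'
  proof -
    have "c \<le> C" unfolding C_def using f(1) e' by (intro Max_ge) auto
    moreover have "q' \<le> q" if "c = C" unfolding q_def using f(2) e' that by (intro Max_ge) auto
    moreover have "p' = p" if "c = C" "q' = q" using sym_wsvtD(6)[OF w, of C p' q p] e' pq that by simp
    ultimately show ?thesis by (meson nless_le)
  qed
  then show ?thesis using pq unfolding top_entry_def by blast
qed

text \<open>A right or lower neighbour would contain a code at least \<open>C\<close>, hence
  \<open>C\<close> itself. In doubled coordinates one of these neighbours is in the column of the
  top entry and the other in a later column, both against the choice of the top; the parity of
  \<open>C\<close> decides which is which.\<close>

lemma top_entry_corner: assumes y: "young M" and w: "sym_wsvt M Q" and t: "top_entry Q C p q" shows "corner M p q"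
proof -
  have e: "occ Q C p q" and mx: "\<And>c p' q'. occ Q c p' q' \<Longrightarrow> c < C \<or> c = C \<and> (q' < q \<or> p' = p \<and> q' = q)"
    using t unfolding top_entry_def by blast+
  have m: "(p, q) \<in> M" using sym_wsvt_ent_in[OF y w e] .
  obtain i j where ij: "box p q = (i, j)" by fastforce
  have u: "(i, j) \<in> upper M" using box_upper[OF y, of p q] m ij by simp
  then have le: "i \<le> j" and mij: "(i, j) \<in> M" by (auto simp: upper_def)
  have CQ: "C \<in># Q (i, j)" and par: "odd C \<longleftrightarrow> q < p" using e ij unfolding occ_def by auto
  have pq: "if odd C then p = j \<and> q = i else p = i \<and> q = j"
    using ij par by (cases "p \<le> q") (auto simp: box_simps)
  have no: False if d: "(i', j') \<in> upper M" and s: "i' = i \<and> j' = Suc j \<or> i' = Suc i \<and> j' = j" for i' j'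
  proof -
    obtain d where d: "d \<in># Q (i', j')" using sym_wsvtD(1)[OF w, of "(i', j')"] d by blast
    have "C \<le> d" using s sym_wsvtD(3)[OF w CQ, of d] sym_wsvtD(4)[OF w CQ, of d] d by auto
    obtain p' q' where e': "occ Q d p' q'" and ij': "box p' q' = (i', j')" using sym_wsvt_ent[OF w d] by blast
    have dC: "d = C" "q' < q \<or> p' = p \<and> q' = q" using mx[OF e'] \<open>C \<le> d\<close> by auto
    have "odd C \<longleftrightarrow> q' < p'" using e' dC unfolding occ_def by auto
    then have pq': "if odd C then p' = j' \<and> q' = i' else p' = i' \<and> q' = j'"
      using ij' by (cases "p' \<le> q'") (auto simp: box_simps)
    show False
    proof (cases "odd C")
      case True
      then show False using pq pq' dC(2) s by auto
    next
      case False
      then show False using pq pq' dC(2) s by auto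
    qed
  qed
  have 1: "(i, Suc j) \<notin> M" using no[of i "Suc j"] le by (auto simp: upper_def)
  have 2: "(Suc i, j) \<notin> M"
  proof
    assume a: "(Suc i, j) \<in> M"
    show False
    proof (cases "Suc i \<le> j")
      case True
      then show False using no[of "Suc i" j] a by (auto simp: upper_def)
    next
      case False
      \<comment> \<open>Below a diagonal box, the doubled neighbour mirrors the one to the right,
        already excluded.\<close>
      then have "i = j" using le by simp
      then show False using a 1 young_swap[OF y] by blast
    qed
  qed
  have "corner M i j" using 1 2 mij unfolding corner_def by blast
  then show ?thesis using pq corner_sym[OF y] by (cases "odd C") auto
qed

lemma sym_wsvt_remove:
  assumes y: "young M" and w: "sym_wsvt M Q" and t: "top_entry Q C p q" and e: "e \<longleftrightarrow> size (Q (box p q)) = 1"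
  shows "sym_wsvt (del (Some ((p, q), e)) M) (Q(box p q := Q (box p q) - {#C#}))"
proof -
  define Q0 where "Q0 = Q(box p q := Q (box p q) - {#C#})"
  have sub: "c \<in># Q b" if "c \<in># Q0 b" for b c using that unfolding Q0_def by (auto split: if_splits dest: in_diffD)
  have CQ: "C \<in># Q (box p q)" using t unfolding top_entry_def occ_def by blast
  have c: "corner M p q" using top_entry_corner[OF y w t] .
  have y0: "young (del (Some ((p, q), e)) M)" using young_del_edge[OF y] c by simp
  have supp: "Q0 b \<noteq> {#} \<longleftrightarrow> b \<in> upper (del (Some ((p, q), e)) M)" for b
  proof (cases "b = box p q")
    case True
    have "size (Q (box p q)) = Suc (size (Q0 (box p q)))" using insert_DiffM[OF CQ] size_add_mset[of C "Q (box p q) - {#C#}"] by (simp add: Q0_def)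
    then have "Q0 (box p q) \<noteq> {#} \<longleftrightarrow> \<not> e" using e by auto
    also have "\<dots> \<longleftrightarrow> (p, q) \<in> del (Some ((p, q), e)) M" using c by (auto simp: del_Some corner_def)
    finally show ?thesis using True box_upper[OF y0] by simp
  next
    case False
    obtain i j where b: "b = (i, j)" by fastforce
    have "b \<in> upper M \<longleftrightarrow> b \<in> upper (del (Some ((p, q), e)) M)"
      using False unfolding b by (cases "p \<le> q") (auto simp: upper_def del_Some box_simps)
    then show ?thesis using False sym_wsvtD(1)[OF w, of b] unfolding Q0_def by simp
  qed
  have en: "occ Q c p q" if "occ Q0 c p q" for c p q using that sub unfolding occ_def by blast
  have "sym_wsvt (del (Some ((p, q), e)) M) Q0"
    by (rule sym_wsvtI[OF supp]) (blast dest: sub en intro: sym_wsvtD[OF w])+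
  then show ?thesis unfolding Q0_def .
qed

lemma code_decode: assumes "1 \<le> C" "odd C \<longleftrightarrow> q < p" shows "code ((C + 1) div 2) p q = C"
  using assms unfolding code_defs by (auto elim!: oddE evenE)

lemma code_div: "1 \<le> k \<Longrightarrow> (code k p q + 1) div 2 = k"
  unfolding code_defs by auto

lemma corner_del_contra:
  assumes y: "young M" and m: "(p, q) \<in> M" and c: "corner (del (Some ((p, q), e)) M) p' q'" and lt: "p' < p" "q' < q"
  shows False
proof -
  have "(p', Suc q') \<in> M" using young_mono[OF y m, of p' "Suc q'"] lt by simp
  moreover have "(p', Suc q') \<noteq> (p, q)" "(p', Suc q') \<noteq> (q, p)" using lt by auto
  ultimately have "(p', Suc q') \<in> del (Some ((p, q), e)) M" by (simp add: del_Some)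
  then show False using c unfolding corner_def by blast
qed

text \<open>Removes the top entry, by induction on the number of entries. The sum runs over a fixed
  finite \<open>U\<close> because the shape shrinks when a box is emptied.\<close>

lemma sym_wsvt_filling_aux:
  assumes "finite U"
  shows "upper M \<subseteq> U \<Longrightarrow> (\<Sum>b\<in>U. size (Q b)) = n \<Longrightarrow> young M \<Longrightarrow> sym_wsvt M Q \<Longrightarrow> \<exists>R. filling R M Q"
proof (induction n arbitrary: M Q rule: less_induct)
  case (less n)
  note y = less.prems(3) and w = less.prems(4)
  show ?case
  proof (cases "M = {}")
    case True
    then have "Q b = {#}" for b using sym_wsvtD(1)[OF w, of b] by (simp add: upper_def)
    then have "Q = (\<lambda>_. {#})" by blast
    then show ?thesis using filling_Nil True by blast
  next
    case False
    obtain C p q where t: "top_entry Q C p q" using ex_top_entry[OF y w False] by blast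
    have c: "corner M p q" using top_entry_corner[OF y w t] .
    have m: "(p, q) \<in> M" using c unfolding corner_def by blast
    have en: "occ Q C p q" and mx: "\<And>c p' q'. occ Q c p' q' \<Longrightarrow> c < C \<or> c = C \<and> (q' < q \<or> p' = p \<and> q' = q)"
      using t unfolding top_entry_def by blast+
    have CQ: "C \<in># Q (box p q)" and par: "odd C \<longleftrightarrow> q < p" using en unfolding occ_def by auto
    have C1: "1 \<le> C" using sym_wsvtD(2)[OF w CQ] .
    define k where "k = (C + 1) div 2"
    have cd: "code k p q = C" unfolding k_def using code_decode[OF C1 par] .
    have k1: "1 \<le> k" unfolding k_def using C1 by auto
    define e where "e = (size (Q (box p q)) = 1)"
    define Q0 where "Q0 = Q(box p q := Q (box p q) - {#C#})"
    let ?m = "del (Some ((p, q), e)) M"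
    have w0: "sym_wsvt ?m Q0" unfolding Q0_def by (rule sym_wsvt_remove[OF y w t]) (simp add: e_def)
    have y0: "young ?m" using young_del_edge[OF y] c by simp
    have readd: "add_entry k p q Q0 = Q"
      unfolding cd Q0_def using CQ by auto
    have u0: "upper ?m \<subseteq> U" using less.prems(1) del_subset[of "Some ((p, q), e)" M] unfolding upper_def by auto
    have tU: "box p q \<in> U" using box_upper[OF y, of p q] m less.prems(1) by blast
    have "(\<Sum>b\<in>U. size (Q0 b)) < n"
    proof -
      have "size (Q0 (box p q)) < size (Q (box p q))" unfolding Q0_def using CQ by (simp add: size_Diff1_less)
      moreover have "(\<Sum>b\<in>U - {box p q}. size (Q0 b)) = (\<Sum>b\<in>U - {box p q}. size (Q b))"
        by (rule sum.cong) (auto simp: Q0_def)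
      ultimately have "(\<Sum>b\<in>U. size (Q0 b)) < (\<Sum>b\<in>U. size (Q b))"
        using sum.remove[OF assms tU, of "\<lambda>b. size (Q0 b)"] sum.remove[OF assms tU, of "\<lambda>b. size (Q b)"] by simp
      then show ?thesis using less.prems(2) by simp
    qed
    from less.IH[OF this u0 refl y0 w0] obtain R where R: "filling R ?m Q0" by blast
    \<comment> \<open>For an equal letter in a row above \<open>p\<close>, the previous box would
      also lie left of \<open>q\<close>: by the choice of the top entry if the codes agree, and by
      \<open>q' < p' < p \<le> q\<close> if they pass from primed to unprimed. Such a box cannot be
      a corner, its right neighbour being present.\<close>
    have l: "k' < k \<or> k' = k \<and> p \<le> p'" if ne: "R \<noteq> []" and la: "last R = (k', ((p', q'), e'))" for k' p' q' e'
    proof -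
      have "1 \<le> k' \<and> top_entry Q0 (code k' p' q') p' q'" using filling_facts[OF R] ne la by blast
      then have k': "1 \<le> k'" and e0: "occ Q0 (code k' p' q') p' q'" unfolding top_entry_def by blast+
      then have "occ Q (code k' p' q') p' q'" unfolding occ_def Q0_def by (auto split: if_splits dest: in_diffD)
      then have cl: "code k' p' q' < C \<or> code k' p' q' = C \<and> (q' < q \<or> p' = p \<and> q' = q)" by (rule mx)
      have "R = butlast R @ [(k', ((p', q'), e'))]" using ne la by (metis append_butlast_last_id)
      then have co: "corner ?m p' q'" using R filling_snocD by metis
      have "(code k' p' q' + 1) div 2 \<le> (C + 1) div 2" using cl by (intro div_le_mono) auto
      then have kle: "k' \<le> k" using code_div[OF k'] k_def by simp
      have "p \<le> p'" if kk: "k' = k"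
      proof (rule ccontr)
        assume "\<not> p \<le> p'"
        then have lt: "p' < p" by simp
        have "q' < q"
        proof (cases "code k' p' q' = C")
          case True
          then show ?thesis using cl lt by auto
        next
          case False
          then have "code k p' q' < code k p q" using cl cd kk by simp
          then have "q' < p'" "\<not> q < p" unfolding code_defs by (auto split: if_splits)
          then show ?thesis using lt by simp
        qed
        then show False using corner_del_contra[OF y m co lt] by blast
      qed
      then show ?thesis using kle by auto
    qed
    have "filling (R @ [(k, ((p, q), e))]) M (add_entry k p q Q0)"
      by (rule filling_snoc[OF R y c k1]; erule (1) l)
    then have "filling (R @ [(k, ((p, q), e))]) M Q" unfolding readd .
    then show ?thesis by blast
  qed
qed

lemma sym_wsvt_filling: assumes "young M" "sym_wsvt M Q" shows "\<exists>R. filling R M Q"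
proof -
  have "finite (upper M)" using young_finite[OF assms(1)] by (auto simp: upper_def intro: finite_subset)
  from sym_wsvt_filling_aux[OF this order_refl refl assms] show ?thesis .
qed

lemma filling_fun: "filling R M Q \<Longrightarrow> filling R M Q' \<Longrightarrow> Q = Q'"
proof (induction R arbitrary: M Q Q' rule: rev_induct)
  case Nil
  then show ?case by (simp add: filling_Nil_iff)
next
  case (snoc z R)
  obtain k p q e where z: "z = (k, ((p, q), e))" by (metis prod.exhaust)
  from snoc(2)[unfolded z] obtain Q1 where 1: "filling R (del (Some ((p, q), e)) M) Q1" 
    "Q = add_entry k p q Q1"
    using filling_snocD by blast
  from snoc(3)[unfolded z] obtain Q2 where 2: "filling R (del (Some ((p, q), e)) M) Q2" 
    "Q' = add_entry k p q Q2"
    using filling_snocD by blast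
  have "Q1 = Q2" using snoc.IH 1(1) 2(1) by blast
  then show ?case using 1(2) 2(2) by simp
qed

section \<open>Comparison with the given notions of tableau and weight\<close>

lemma card_le_1I: "(\<And>x y. x \<in> A \<Longrightarrow> y \<in> A \<Longrightarrow> x = y) \<Longrightarrow> card A \<le> 1"
  by (cases "finite A") (simp_all add: card_le_Suc0_iff_eq)

lemma wsvt_sym_wsvt:
  assumes y: "young M" and s: "shifted_shape lam = upper M"
  shows "wsvt lam Q \<longleftrightarrow> sym_wsvt M Q"
proof
  assume w: "wsvt lam Q"
  have a1: "\<And>b. b \<notin> upper M \<Longrightarrow> Q b = {#}"
    and a2: "\<And>b. b \<in> upper M \<Longrightarrow> Q b \<noteq> {#} \<and> (\<forall>c\<in>#Q b. 1 \<le> c)"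
    and a3: "\<And>i j. (i, j) \<in> upper M \<Longrightarrow> (i, Suc j) \<in> upper M \<Longrightarrow> Max (set_mset (Q (i, j))) \<le> Min (set_mset (Q (i, Suc j)))"
    and a4: "\<And>i j. (i, j) \<in> upper M \<Longrightarrow> (Suc i, j) \<in> upper M \<Longrightarrow> Max (set_mset (Q (i, j))) \<le> Min (set_mset (Q (Suc i, j)))"
    and a5: "\<And>i c. c \<in># Q (i, i) \<Longrightarrow> even c"
    and a6: "\<And>j k. card {i. unprimed_letter k \<in># Q (i, j)} \<le> 1"
    and a7: "\<And>i k. 1 \<le> k \<Longrightarrow> card {j. primed_letter k \<in># Q (i, j)} \<le> 1"
    using w unfolding wsvt_def s by auto
  have sup: "b \<in> upper M" if "c \<in># Q b" for b c using a1[of b] that by fastforce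
  have fin: "finite M" using young_finite[OF y] .
  have box: "c \<le> d" if "c \<in># Q b" "d \<in># Q b'" "Max (set_mset (Q b)) \<le> Min (set_mset (Q b'))" for b b' c d
  proof -
    have "c \<le> Max (set_mset (Q b))" using that by simp
    also note that(3)
    also have "Min (set_mset (Q b')) \<le> d" using that by simp
    finally show ?thesis .
  qed
  have c4: "i = i'" if "even c" "c \<in># Q (i, j)" "c \<in># Q (i', j)" for c i i' j
  proof -
    have "c = unprimed_letter (c div 2)" using that by (simp add: unprimed_letter_def)
    then have "card {i. c \<in># Q (i, j)} \<le> Suc 0" using a6[of "c div 2" j] by simp
    \<comment> \<open>Finiteness has to be supplied, since \<open>card\<close> of an infinite set is
      0.\<close>
    moreover have "{i. c \<in># Q (i, j)} \<subseteq> fst ` M" using sup by (force simp: upper_def)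
    then have "finite {i. c \<in># Q (i, j)}" using fin finite_subset by blast
    ultimately show ?thesis using that(2,3) by (auto simp: card_le_Suc0_iff_eq)
  qed
  have c5: "j = j'" if "odd c" "c \<in># Q (i, j)" "c \<in># Q (i, j')" for c i j j'
  proof -
    have "c = primed_letter ((c + 1) div 2)" "1 \<le> (c + 1) div 2" using that(1) by (auto simp: primed_letter_def elim: oddE)
    then have "card {j. c \<in># Q (i, j)} \<le> Suc 0" using a7[of "(c + 1) div 2" i] by simp
    moreover have "{j. c \<in># Q (i, j)} \<subseteq> snd ` M" using sup by (force simp: upper_def)
    then have "finite {j. c \<in># Q (i, j)}" using fin finite_subset by blast
    ultimately show ?thesis using that(2,3) by (auto simp: card_le_Suc0_iff_eq)
  qed
  show "sym_wsvt M Q"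
  proof (rule sym_wsvtI)
    show "Q b \<noteq> {#} \<longleftrightarrow> b \<in> upper M" for b using a1 a2 by blast
    show "1 \<le> c" if "c \<in># Q b" for b c using a2[OF sup[OF that]] that by blast
    show "c \<le> d" if "c \<in># Q (i, j)" "d \<in># Q (i, Suc j)" for i j c d
      using box[OF that a3[OF sup[OF that(1)] sup[OF that(2)]]] .
    show "c \<le> d" if "c \<in># Q (i, j)" "d \<in># Q (Suc i, j)" for i j c d
      using box[OF that a4[OF sup[OF that(1)] sup[OF that(2)]]] .
    show "even c" if "c \<in># Q (i, i)" for i c using a5[OF that] .
    show "p = p'" if "occ Q c p q" "occ Q c p' q" for c p p' q
    proof (cases "odd c")
      case True
      then have "q < p" "q < p'" using that unfolding occ_def by auto
      then show ?thesis using c5[OF True, of q p p'] that unfolding occ_def by (simp add: box_simps)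
    next
      case False
      then have "p \<le> q" "p' \<le> q" using that unfolding occ_def by auto
      then show ?thesis using c4[of c p q p'] False that unfolding occ_def by (simp add: box_simps)
    qed
  qed
next
  assume w: "sym_wsvt M Q"
  have box: "Max (set_mset (Q b)) \<le> Min (set_mset (Q b'))"
    if "b \<in> upper M" "b' \<in> upper M" "\<And>c d. c \<in># Q b \<Longrightarrow> d \<in># Q b' \<Longrightarrow> c \<le> d" for b b'
  proof -
    have "Q b \<noteq> {#}" "Q b' \<noteq> {#}" using sym_wsvtD(1)[OF w] that by blast+
    then have "Max (set_mset (Q b)) \<in># Q b" "Min (set_mset (Q b')) \<in># Q b'" by simp_all
    then show ?thesis by (rule that(3))
  qed
  have le: "i \<le> j" if "c \<in># Q (i, j)" for c i j using sym_wsvt_nonempty[OF w that] by (simp add: upper_def)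
  show "wsvt lam Q"
    unfolding wsvt_def s
  proof (intro conjI allI impI ballI)
    show "Q b = {#}" if "b \<notin> upper M" for b using sym_wsvtD(1)[OF w] that by blast
    show "Q b \<noteq> {#}" if "b \<in> upper M" for b using sym_wsvtD(1)[OF w] that by blast
    show "1 \<le> c" if "b \<in> upper M" "c \<in># Q b" for b c using sym_wsvtD(2)[OF w that(2)] .
    show "Max (set_mset (Q (i, j))) \<le> Min (set_mset (Q (i, Suc j)))"
      if "(i, j) \<in> upper M \<and> (i, Suc j) \<in> upper M" for i j
      using box[of "(i, j)" "(i, Suc j)"] that sym_wsvtD(3)[OF w] by blast
    show "Max (set_mset (Q (i, j))) \<le> Min (set_mset (Q (Suc i, j)))"
      if "(i, j) \<in> upper M \<and> (Suc i, j) \<in> upper M" for i j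
      using box[of "(i, j)" "(Suc i, j)"] that sym_wsvtD(4)[OF w] by blast
    show "even c" if "c \<in># Q (i, i)" for i c using sym_wsvtD(5)[OF w that] .
    show "card {i. unprimed_letter k \<in># Q (i, j)} \<le> 1" for j k
    proof -
      have "i = i'" if "unprimed_letter k \<in># Q (i, j)" "unprimed_letter k \<in># Q (i', j)" for i i'
      proof -
        have "occ Q (unprimed_letter k) i j" "occ Q (unprimed_letter k) i' j"
          using le[OF that(1)] le[OF that(2)] that unfolding occ_def by (auto simp: box_simps unprimed_letter_def)
        then show ?thesis by (rule sym_wsvtD(6)[OF w])
      qed
      then show ?thesis by (intro card_le_1I) auto
    qed
    show "card {j. primed_letter k \<in># Q (i, j)} \<le> 1" if k: "1 \<le> k" for i k
    proof -
      have o: "odd (primed_letter k)" using k by (simp add: primed_letter_def)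
      have "j = j'" if "primed_letter k \<in># Q (i, j)" "primed_letter k \<in># Q (i, j')" for j j'
      proof -
        have "i \<noteq> j" "i \<noteq> j'" using sym_wsvtD(5)[OF w, of "primed_letter k" i] that o by blast+
        then have "i < j" "i < j'" using le[OF that(1)] le[OF that(2)] by auto
        then have "occ Q (primed_letter k) j i" "occ Q (primed_letter k) j' i"
          using that o unfolding occ_def by (auto simp: box_simps)
        then show ?thesis by (rule sym_wsvtD(6)[OF w])
      qed
      then show ?thesis by (intro card_le_1I) auto
    qed
  qed
qed

lemma letter_eq: assumes "1 \<le> (k'::nat)" "1 \<le> k"
  shows "primed_letter k' = primed_letter k \<longleftrightarrow> k = k'" "unprimed_letter k' = unprimed_letter k \<longleftrightarrow> k = k'"
    "primed_letter k' \<noteq> unprimed_letter k" "unprimed_letter k' \<noteq> primed_letter k"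
  using assms unfolding primed_letter_def unprimed_letter_def by presburger+

lemma filling_weight:
  "filling R M Q \<Longrightarrow> 1 \<le> k \<Longrightarrow>
    (\<Sum>b\<in>upper M. count (Q b) (unprimed_letter k) + count (Q b) (primed_letter k)) = count (mset (map fst R)) k"
proof (induction rule: filling.induct)
  case filling_Nil
  then show ?case by (simp add: upper_def)
next
  case (filling_snoc R p q e M Q k')
  let ?m = "del (Some ((p, q), e)) M"
  let ?w = "\<lambda>Q b. count (Q b) (unprimed_letter k) + count (Q b) (primed_letter k)"
  let ?Q = "Q(box p q := add_mset (code k' p q) (Q (box p q)))"
  have fu: "finite (upper M)" using young_finite[OF filling_snoc(2)] by (auto simp: upper_def intro: finite_subset)
  have w: "sym_wsvt ?m Q" using filling_facts[OF filling_snoc(1)] by blast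
  have tu: "box p q \<in> upper M" using box_upper[OF filling_snoc(2)] filling_snoc(3) unfolding corner_def by blast
  have "?w ?Q (box p q) = ?w Q (box p q) + (if k = k' then 1 else 0)"
    using letter_eq[OF filling_snoc(4,7)] by (auto simp: code_def)
  moreover have "(\<Sum>b\<in>upper M - {box p q}. ?w ?Q b) = (\<Sum>b\<in>upper M - {box p q}. ?w Q b)"
    by (rule sum.cong) auto
  ultimately have "(\<Sum>b\<in>upper M. ?w ?Q b) = (\<Sum>b\<in>upper M. ?w Q b) + (if k = k' then 1 else 0)"
    using sum.remove[OF fu tu, of "?w ?Q"] sum.remove[OF fu tu, of "?w Q"] by simp
  also have "(\<Sum>b\<in>upper M. ?w Q b) = (\<Sum>b\<in>upper ?m. ?w Q b)"
  proof (rule sum.mono_neutral_right[OF fu])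
    show "upper ?m \<subseteq> upper M" using del_subset[of "Some ((p, q), e)" M] unfolding upper_def by auto
    show "\<forall>b\<in>upper M - upper ?m. ?w Q b = 0"
    proof
      fix b assume "b \<in> upper M - upper ?m"
      then have "Q b = {#}" using sym_wsvtD(1)[OF w, of b] by blast
      then show "?w Q b = 0" by simp
    qed
  qed
  finally show ?case using filling_snoc(6,7) by simp
qed

section \<open>Compatible sequences and the final count\<close>

definition compat :: "nat list \<Rightarrow> mark list \<Rightarrow> bool" where
  "compat s ms \<longleftrightarrow> (\<forall>i. Suc i < length s \<longrightarrow>
     s ! i < s ! Suc i \<or> s ! i = s ! Suc i \<and> fst (fst (ms ! Suc i)) \<le> fst (fst (ms ! i)))"

lemma compat_snoc:
  assumes "length s = length ms"
  shows "compat (s @ [k]) (ms @ [\<beta>]) \<longleftrightarrow> compat s ms \<and>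
    (s \<noteq> [] \<longrightarrow> last s < k \<or> last s = k \<and> fst (fst \<beta>) \<le> fst (fst (last ms)))" (is "?l \<longleftrightarrow> ?r")
proof -
  let ?P = "\<lambda>s ms i. s ! i < s ! Suc i \<or> s ! i = s ! Suc i \<and> fst (fst (ms ! Suc i)) \<le> fst (fst (ms ! i))"
  have 1: "?P (s @ [k]) (ms @ [\<beta>]) i \<longleftrightarrow> ?P s ms i" if "Suc i < length s" for i
    using that assms by (simp add: nth_append)
  have 2: "?P (s @ [k]) (ms @ [\<beta>]) i \<longleftrightarrow> last s < k \<or> last s = k \<and> fst (fst \<beta>) \<le> fst (fst (last ms))"
    if "Suc i = length s" for i
  proof -
    have "s \<noteq> []" "ms \<noteq> []" using that assms by auto
    moreover have "length s - 1 = i" "length ms - 1 = i" using that assms by auto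
    ultimately have "last s = s ! i" "last ms = ms ! i" by (simp_all add: last_conv_nth)
    then show ?thesis using that assms by (simp add: nth_append)
  qed
  have "?l \<longleftrightarrow> (\<forall>i. Suc i \<le> length s \<longrightarrow> ?P (s @ [k]) (ms @ [\<beta>]) i)"
    unfolding compat_def by (simp only: length_append_singleton less_Suc_eq_le)
  also have "\<dots> \<longleftrightarrow> (\<forall>i. Suc i < length s \<longrightarrow> ?P (s @ [k]) (ms @ [\<beta>]) i) \<and>
      (\<forall>i. Suc i = length s \<longrightarrow> ?P (s @ [k]) (ms @ [\<beta>]) i)"
    unfolding le_less by blast
  also have "\<dots> \<longleftrightarrow> (\<forall>i. Suc i < length s \<longrightarrow> ?P s ms i) \<and>
      (\<forall>i. Suc i = length s \<longrightarrow> last s < k \<or> last s = k \<and> fst (fst \<beta>) \<le> fst (fst (last ms)))"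
    using 1 2 by meson
  also have "\<dots> \<longleftrightarrow> ?r"
  proof -
    have "(\<exists>i. Suc i = length s) \<longleftrightarrow> s \<noteq> []" by (cases s) auto
    then show ?thesis unfolding compat_def by blast
  qed
  finally show ?thesis .
qed

lemma marking_filling:
  "marking ms M \<Longrightarrow> length s = length ms \<Longrightarrow> \<forall>k\<in>set s. 1 \<le> k \<Longrightarrow> compat s ms \<Longrightarrow> \<exists>Q. filling (zip s ms) M Q"
proof (induction arbitrary: s rule: marking.induct)
  case marking_Nil
  then show ?case using filling_Nil by auto
next
  case (marking_snoc ms p q e M)
  obtain s' k where s: "s = s' @ [k]" using marking_snoc(5) by (cases s rule: rev_cases) auto
  have len: "length s' = length ms" using marking_snoc(5) s by simp
  have c: "compat s' ms" "s' \<noteq> [] \<Longrightarrow> last s' < k \<or> last s' = k \<and> p \<le> fst (fst (last ms))"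
    using marking_snoc(7) unfolding s compat_snoc[OF len] by auto
  obtain Q where Q: "filling (zip s' ms) (del (Some ((p, q), e)) M) Q"
    using marking_snoc.IH[OF len _ c(1)] marking_snoc(6) s by auto
  have k: "1 \<le> k" using marking_snoc(6) s by simp
  have "filling (zip s' ms @ [(k, ((p, q), e))]) M (add_entry k p q Q)"
  proof (rule filling_snoc[OF Q marking_snoc(2,3) k])
    fix k' p' q' e'
    assume ne: "zip s' ms \<noteq> []" and la: "last (zip s' ms) = (k', ((p', q'), e'))"
    have "s' \<noteq> []" "ms \<noteq> []" using ne by auto
    then have "last s' = k'" "last ms = ((p', q'), e')" using la last_zip[of s' ms] len by auto
    then show "k' < k \<or> k' = k \<and> p \<le> p'" using c(2) \<open>s' \<noteq> []\<close> by auto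
  qed
  then show ?case using len s by auto
qed

lemma filling_marking:
  "filling R M Q \<Longrightarrow> marking (map snd R) M \<and> (\<forall>k\<in>set (map fst R). 1 \<le> k) \<and> compat (map fst R) (map snd R)"
proof (induction rule: filling.induct)
  case filling_Nil
  then show ?case using marking_Nil by (simp add: compat_def)
next
  case (filling_snoc R p q e M Q k)
  have "last (map fst R) < k \<or> last (map fst R) = k \<and> p \<le> fst (fst (last (map snd R)))" if ne: "R \<noteq> []"
  proof -
    obtain k' p' q' e' where la: "last R = (k', ((p', q'), e'))" by (metis prod.exhaust)
    then show ?thesis using filling_snoc(5)[OF ne la] ne by (simp add: last_map)
  qed
  then have "compat (map fst R @ [k]) (map snd R @ [((p, q), e)])"
    using compat_snoc[of "map fst R" "map snd R" k "((p, q), e)"] filling_snoc(6) by simp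
  then show ?case using marking.marking_snoc[of "map snd R" p q e M] filling_snoc(2,3,4,6) by simp
qed

lemma compat_sorted: "compat s ms \<Longrightarrow> sorted s"
  unfolding sorted_iff_nth_Suc compat_def by (auto intro: less_imp_le)

text \<open>For sorted \<open>s\<close>, strictness at descents means that an equality in
  \<open>s\<close> forces a non-descent of \<open>w\<close>, and by \<open>runs_descents\<close>
  non-descents are the weak decreases of the row.\<close>

lemma runs_compat:
  assumes r: "runs w T ms" and l: "length s = length w" and s: "sorted s"
  shows "(\<forall>j\<in>descents w. s ! (j - 1) < s ! j) \<longleftrightarrow> compat s ms"
proof -
  have "(\<forall>j\<in>descents w. s ! (j - 1) < s ! j) \<longleftrightarrow> (\<forall>i. Suc i < length w \<longrightarrow> w ! Suc i < w ! i \<longrightarrow> s ! i < s ! Suc i)"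
  proof
    assume a: "\<forall>j\<in>descents w. s ! (j - 1) < s ! j"
    show "\<forall>i. Suc i < length w \<longrightarrow> w ! Suc i < w ! i \<longrightarrow> s ! i < s ! Suc i"
    proof (intro allI impI)
      fix i assume "Suc i < length w" "w ! Suc i < w ! i"
      then have "Suc i \<in> descents w" by (simp add: descents_def)
      then show "s ! i < s ! Suc i" using a by force
    qed
  next
    assume a: "\<forall>i. Suc i < length w \<longrightarrow> w ! Suc i < w ! i \<longrightarrow> s ! i < s ! Suc i"
    show "\<forall>j\<in>descents w. s ! (j - 1) < s ! j"
    proof
      fix j assume "j \<in> descents w"
      then have "Suc (j - 1) = j" "Suc (j - 1) < length w" "w ! Suc (j - 1) < w ! (j - 1)" by (auto simp: descents_def)
      then show "s ! (j - 1) < s ! j" using a by metis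
    qed
  qed
  also have "\<dots> \<longleftrightarrow> compat s ms"
  proof -
    have "(w ! Suc i < w ! i \<longrightarrow> s ! i < s ! Suc i) \<longleftrightarrow>
        s ! i < s ! Suc i \<or> s ! i = s ! Suc i \<and> fst (fst (ms ! Suc i)) \<le> fst (fst (ms ! i))"
      if i: "Suc i < length w" for i
    proof -
      have "s ! i \<le> s ! Suc i" using s i l by (simp add: sorted_iff_nth_Suc)
      then show ?thesis using runs_descents[OF r i] by linarith
    qed
    then show ?thesis unfolding compat_def l by blast
  qed
  finally show ?thesis .
qed

text \<open>Words and tableaux are linked through a list of marks, hence by a relation, which is
  unique in both directions.\<close>

lemma card_eq_rel:
  assumes "\<And>x. x \<in> A \<Longrightarrow> \<exists>!y. y \<in> B \<and> r x y" "\<And>y. y \<in> B \<Longrightarrow> \<exists>!x. x \<in> A \<and> r x y"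
  shows "card A = card B"
proof -
  define f where "f x = (THE y. y \<in> B \<and> r x y)" for x
  have f: "f x \<in> B" "r x (f x)" if "x \<in> A" for x using theI'[OF assms(1)[OF that]] unfolding f_def by auto
  have "bij_betw f A B"
    unfolding bij_betw_def inj_on_def
  proof (intro conjI ballI impI)
    show "x = x'" if "x \<in> A" "x' \<in> A" "f x = f x'" for x x'
      using assms(2)[OF f(1)[OF that(1)]] f[OF that(1)] f[OF that(2)] that by auto
    show "f ` A = B"
    proof
      show "f ` A \<subseteq> B" using f by blast
      show "B \<subseteq> f ` A"
      proof
        fix y assume y: "y \<in> B"
        then obtain x where x: "x \<in> A" "r x y" using assms(2) by blast
        have "f x = y" using assms(1)[OF x(1)] f[OF x(1)] x y by blast
        then show "y \<in> f ` A" using x by blast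
      qed
    qed
  qed
  then show ?thesis by (rule bij_betw_same_card)
qed

text \<open>The content determines a weakly increasing sequence, so \<open>s\<close> is the only
  candidate and the coefficient is 0 or 1.\<close>

lemma fund_coeff_eq:
  assumes s: "\<And>k. count (mset s) k = a k" and a0: "a 0 = 0" and so: "sorted s"
  shows "fund_coeff D n a = (if length s = n \<and> (\<forall>j\<in>D. s ! (j - 1) < s ! j) then 1 else 0)"
proof -
  have pos: "\<forall>x\<in>set s. 1 \<le> x"
  proof
    fix x assume "x \<in> set s"
    then have "count (mset s) x \<noteq> 0" by simp
    then show "1 \<le> x" using s a0 by (cases x) auto
  qed
  have eq: "s' = s" if "sorted s'" "\<forall>k. count (mset s') k = a k" for s'
  proof -
    have "mset s' = mset s" using that(2) s by (intro multiset_eqI) simp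
    then show ?thesis using that(1) so by (metis properties_for_sort)
  qed
  let ?S = "{s'. length s' = n \<and> (\<forall>x\<in>set s'. 1 \<le> x) \<and> sorted s' \<and> (\<forall>j\<in>D. s' ! (j - 1) < s' ! j) \<and> (\<forall>k. count (mset s') k = a k)}"
  have sub: "?S \<subseteq> {s}" using eq by blast
  have "s \<in> ?S \<longleftrightarrow> length s = n \<and> (\<forall>j\<in>D. s ! (j - 1) < s ! j)"
    unfolding mem_Collect_eq using pos so s by blast
  then have "?S = (if length s = n \<and> (\<forall>j\<in>D. s ! (j - 1) < s ! j) then {s} else {})"
    using sub by (metis (no_types, lifting) subset_singletonD insertI1 empty_iff)
  then show ?thesis unfolding fund_coeff_def by simp
qed

theorem theorem3:
  fixes lam :: "nat list" and T :: itab and a :: "nat \<Rightarrow> nat"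
  assumes "strict_partition lam"
    and "increasing_tab T"
    and "dom T = shifted_shape lam"
    and "finite {k. a k \<noteq> 0}"
    and "a 0 = 0"
  shows "((\<lambda>w. real (fund_coeff (descents w) (length w) a)) has_sum real (K_coeff lam a))
           {w. (\<forall>x\<in>set w. 1 \<le> x) \<and> hecke_P w T}"
proof -
  have T: "sym_inc T" using assms(2) increasing_tab_iff by blast
  let ?M = "shape T"
  have y: "young ?M" by (rule young_shape[OF T])
  have sh: "shifted_shape lam = upper ?M"
  proof -
    have "(i, j) \<in> dom T \<longleftrightarrow> (i, j) \<in> upper ?M" for i j
      using tab_entry[OF T, of i j] by (auto simp: upper_def in_shape dom_def)
    then have "dom T = upper ?M" by auto
    then show ?thesis using assms(3) by simp
  qed
  \<comment> \<open>The weakly increasing sequence with content \<open>a\<close>; the finite support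
    of \<open>a\<close> makes \<open>Abs_multiset a\<close> meaningful.\<close>
  define s where "s = sorted_list_of_multiset (Abs_multiset a)"
  have "{x. 0 < a x} = {k. a k \<noteq> 0}" by auto
  then have s: "count (mset s) k = a k" for k
    using assms(4) by (simp add: s_def count_Abs_multiset)
  have so: "sorted s" by (simp add: s_def)
  have pos: "\<forall>k\<in>set s. 1 \<le> k"
  proof
    fix x assume "x \<in> set s"
    then have "count (mset s) x \<noteq> 0" by simp
    then show "1 \<le> x" using s assms(5) by (cases x) auto
  qed
  define A where "A = {w. (\<forall>x\<in>set w. 1 \<le> x) \<and> hecke_P w T}"
  \<comment> \<open>The words with coefficient 1; the other words in \<open>A\<close> contribute
    0.\<close>
  define W where "W = {w \<in> A. length s = length w \<and> (\<forall>j\<in>descents w. s ! (j - 1) < s ! j)}"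
  define B where "B = {Q. wsvt lam Q \<and> wsvt_weight lam Q = a}"
  have runs_A: "w \<in> A \<longleftrightarrow> (\<exists>ms. runs w T ms)" for w unfolding A_def using runs_hecke[of w T] by blast
  have B: "Q \<in> B \<longleftrightarrow> (\<exists>R. filling R ?M Q \<and> map fst R = s)" for Q
  proof
    assume "Q \<in> B"
    then have Q: "sym_wsvt ?M Q" "wsvt_weight lam Q = a" unfolding B_def using wsvt_sym_wsvt[OF y sh] by auto
    obtain R where R: "filling R ?M Q" using sym_wsvt_filling[OF y Q(1)] by blast
    have v: "\<forall>k\<in>set (map fst R). 1 \<le> k" "sorted (map fst R)" using filling_marking[OF R] compat_sorted by blast+
    have "count (mset (map fst R)) k = a k" for k
    proof (cases "k = 0")
      case True
      then have "k \<notin> set (map fst R)" using v(1) by force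
      then have "count (mset (map fst R)) k = 0" by (metis count_eq_zero_iff set_mset_mset)
      then show ?thesis using True assms(5) by simp
    next
      case False
      then have "count (mset (map fst R)) k = wsvt_weight lam Q k"
        using filling_weight[OF R, of k] by (simp add: wsvt_weight_def sh)
      then show ?thesis using Q(2) by simp
    qed
    then have "mset (map fst R) = mset s" using s by (intro multiset_eqI) simp
    then have "map fst R = s" using v(2) so by (metis properties_for_sort)
    then show "\<exists>R. filling R ?M Q \<and> map fst R = s" using R by blast
  next
    assume "\<exists>R. filling R ?M Q \<and> map fst R = s"
    then obtain R where R: "filling R ?M Q" "map fst R = s" by blast
    have "wsvt lam Q" using wsvt_sym_wsvt[OF y sh] filling_facts[OF R(1)] by blast
    moreover have "wsvt_weight lam Q k = a k" for k
      using filling_weight[OF R(1), of k] s[of k] assms(5) unfolding R(2) by (simp add: wsvt_weight_def sh)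
    ultimately show "Q \<in> B" unfolding B_def by blast
  qed
  have "card W = card B"
  proof (rule card_eq_rel[where r = "\<lambda>w Q. \<exists>ms. runs w T ms \<and> filling (zip s ms) ?M Q"])
    fix w assume w: "w \<in> W"
    then obtain ms where r: "runs w T ms" using runs_A unfolding W_def by blast
    have l: "length s = length w" using w W_def by blast
    then have l': "length s = length ms" using runs_length[OF r] by simp
    have "compat s ms" using runs_compat[OF r l so] w W_def by blast
    then obtain Q where Q: "filling (zip s ms) ?M Q" using marking_filling[OF runs_marking[OF r] l' pos] by blast
    show "\<exists>!Q. Q \<in> B \<and> (\<exists>ms. runs w T ms \<and> filling (zip s ms) ?M Q)"
    proof (rule ex1I[of _ Q])
      have "map fst (zip s ms) = s" using l' by simp
      then show "Q \<in> B \<and> (\<exists>ms. runs w T ms \<and> filling (zip s ms) ?M Q)" using B r Q by blast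
    next
      fix Q' assume "Q' \<in> B \<and> (\<exists>ms. runs w T ms \<and> filling (zip s ms) ?M Q')"
      then obtain ms' where "runs w T ms'" "filling (zip s ms') ?M Q'" by blast
      then show "Q' = Q" using runs_unique[OF r] filling_fun[OF Q] by blast
    qed
  next
    fix Q assume "Q \<in> B"
    then obtain R where R: "filling R ?M Q" "map fst R = s" using B by blast
    have v: "marking (map snd R) ?M" "compat s (map snd R)" using filling_marking[OF R(1)] R(2) by auto
    obtain w where r: "runs w T (map snd R)" using runs_surj[OF v(1) T refl] by blast
    have l: "length s = length w" using runs_length[OF r] R(2) by (metis length_map)
    have z: "zip s (map snd R) = R" using R(2) zip_map_fst_snd[of R] by simp
    show "\<exists>!w. w \<in> W \<and> (\<exists>ms. runs w T ms \<and> filling (zip s ms) ?M Q)"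
    proof (rule ex1I[of _ w])
      have "w \<in> W" unfolding W_def using runs_A r l runs_compat[OF r l so] v(2) by blast
      then show "w \<in> W \<and> (\<exists>ms. runs w T ms \<and> filling (zip s ms) ?M Q)" using r R(1) z by auto
    next
      fix w' assume a: "w' \<in> W \<and> (\<exists>ms. runs w' T ms \<and> filling (zip s ms) ?M Q)"
      then obtain ms where r': "runs w' T ms" and Q': "filling (zip s ms) ?M Q" by blast
      have "length s = length ms" using a runs_length[OF r'] unfolding W_def by simp
      moreover have "zip s ms = R" using filling_unique[OF Q' R(1)] .
      ultimately have "map snd R = ms" by (metis map_snd_zip)
      then show "w' = w" using runs_inj[OF r' ] r by blast
    qed
  qed
  then have KW: "card W = K_coeff lam a" unfolding K_coeff_def B_def .
  have fin: "finite W"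
  proof -
    \<comment> \<open>\<open>A\<close> may be infinite, but a word in \<open>W\<close> is determined
      by its marks, a list of length \<open>length s\<close> over finitely many boxes and
      bits.\<close>
    let ?F = "{ms. set ms \<subseteq> ?M \<times> (UNIV :: bool set) \<and> length ms = length s}"
    have "finite ?F" using finite_lists_length_eq[of "?M \<times> (UNIV :: bool set)"] young_finite[OF y] by simp
    moreover have "W \<subseteq> (\<lambda>ms. THE w. runs w T ms) ` ?F"
    proof
      fix w assume w: "w \<in> W"
      then obtain ms where r: "runs w T ms" using runs_A unfolding W_def by blast
      have "(THE w. runs w T ms) = w" using r runs_inj by blast
      moreover have "ms \<in> ?F" using marking_subset[OF runs_marking[OF r]] runs_length[OF r] w unfolding W_def by auto
      ultimately show "w \<in> (\<lambda>ms. THE w. runs w T ms) ` ?F" by force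
    qed
    ultimately show ?thesis by (rule finite_surj)
  qed
  have "((\<lambda>w. 1) has_sum (\<Sum>w\<in>W. 1 :: real)) W" using fin by (rule has_sum_finite)
  then have "((\<lambda>w. 1) has_sum real (K_coeff lam a)) W" using KW by simp
  moreover have "((\<lambda>w. 1 :: real) has_sum real (K_coeff lam a)) W \<longleftrightarrow>
      ((\<lambda>w. real (fund_coeff (descents w) (length w) a)) has_sum real (K_coeff lam a)) A"
    by (rule has_sum_cong_neutral) (auto simp: fund_coeff_eq[OF s assms(5) so] W_def)
  ultimately show ?thesis unfolding A_def by blast
qed

end
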